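(* Let $(B,m_B,u_B,\Delta_B,\varepsilon_B,c_B)$ be a graded braided bialgebra over a field $K$, endowed with a bracket $b:E(B)\to B^1$. Then $$U(B,b):=\frac{B}{\big((\mathrm{Id}-b)[E(B)]\big)}$$ (the quotient by the two-sided ideal generated by all $z-b(z)$, $z\in E(B)$) has a unique braided bialgebra structure such that the canonical projection $\pi_U:B\to U(B,b)$ is a braided bialgebra homomorphism.
   Context: $K$ is a field, vector spaces are over $K$, $\otimes=\otimes_K$, and the name of an object also denotes its identity map. A braided vector space $(V,c)$ is a vector space $V$ with a $K$-linear map $c:V\otimes V\to V\otimes V$ such that $(c\otimes V)(V\otimes c)(c\otimes V)=(V\otimes c)(c\otimes V)(V\otimes c)$; a morphism $f:(V,c_V)\to(W,c_W)$ is a linear map with $c_W(f\otimes f)=(f\otimes f)c_V$. A braided algebra $(A,m,u,c)$ is an associative unital algebra with a braided vector space $(A,c)$ such that $c(m\otimes A)=(A\otimes m)(c\otimes A)(A\otimes c)$, $c(A\otimes m)=(m\otimes A)(A\otimes c)(c\otimes A)$, $c(u\otimes A)=A\otimes u$, $c(A\otimes u)=u\otimes A$. A braided coalgebra $(C,\Delta,\varepsilon,c)$ is a coassociative counital coalgebra with a braided vector space $(C,c)$ such that $(\Delta\otimes C)c=(C\otimes c)(c\otimes C)(C\otimes\Delta)$, $(C\otimes\Delta)c=(c\otimes C)(C\otimes c)(\Delta\otimes C)$, $(\varepsilon\otimes C)c=C\otimes\varepsilon$, $(C\otimes\varepsilon)c=\varepsilon\otimes C$. A braided bialgebra $(B,m,u,\Delta,\varepsilon,c)$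 is both a braided algebra and a braided coalgebra with $\Delta m=(m\otimes m)(B\otimes c\otimes B)(\Delta\otimes\Delta)$, with $\Delta,\varepsilon$ unital and $\varepsilon$ multiplicative. Morphisms are maps compatible with all the structure. A graded braided bialgebra is a braided bialgebra with a decomposition $B=\bigoplus_{n\in\mathbb N}B^n$ such that $m(B^a\otimes B^b)\subseteq B^{a+b}$, $c(B^a\otimes B^b)\subseteq B^b\otimes B^a$, $\Delta(B^n)\subseteq\bigoplus_{a+b=n}B^a\otimes B^b$, and $\varepsilon|_{B^n}=0$ for $n>0$. Write $c_B^{a,b}:B^a\otimes B^b\to B^b\otimes B^a$ and $\Delta_B^{a,b}:B^{a+b}\to B^a\otimes B^b$ for the homogeneous components. $E(B):=\bigoplus_n E_n(B)$, where $E_0(B)=E_1(B)=0$ and $E_n(B)=\bigcap_{a,b\ge1,\ a+b=n}\ker(\Delta_B^{a,b})\subseteq B^n$ for $n\ge2$. The braiding $c_B$ maps $E_t(B)\otimes B^u$ into $B^u\otimes E_t(B)$ and $B^u\otimes E_t(B)$ into $E_t(B)\otimes B^u$; the resulting restrictions (summed over $t$) are denoted $c_{E(B),B^u}:E(B)\otimes B^u\to B^u\otimes E(B)$ and $c_{B^u,E(B)}:B^u\otimes E(B)\to E(B)\otimes B^u$. Also $\Delta_B^{t,0}(E_t(B))\subseteq E_t(B)\otimes B^0$ and $\Delta_B^{0,t}(E_t(B))\subseteq B^0\otimes E_t(B)$. A bracket for $B$ is a $K$-linear map $b:E(B)\to B^1$ such that for every $t\in\mathbb N$: $c_B^{1,t}(b\otimes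 B^t)=(B^t\otimes b)c_{E(B),B^t}$, $c_B^{t,1}(B^t\otimes b)=(b\otimes B^t)c_{B^t,E(B)}$, and, on $E_t(B)$, $\Delta_B^{1,0}b=(b\otimes B^0)\Delta_B^{t,0}$ and $\Delta_B^{0,1}b=(B^0\otimes b)\Delta_B^{0,t}$. *)

theory Defs
  imports "HOL-Algebra.Module" "HOL-Algebra.QuotRing"
begin

section \<open>Vector spaces and linear maps\<close>

text \<open>
  Vector spaces are modules in the sense of HOL-Algebra over a field; the fields
  \<^const>\<open>monoid.mult\<close> and \<^const>\<open>monoid.one\<close> of a module record play no role.
  Linear maps are extensional functions, so that two linear maps on \<open>V\<close> are equal in HOL
  as soon as they agree on the carrier of \<open>V\<close>.
\<close>

locale vspace = field K + module K V for K (structure) and V (structure)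

definition Lin :: "('k, 'l) ring_scheme \<Rightarrow> ('k, 'v, 'm) module_scheme
    \<Rightarrow> ('k, 'w, 'n) module_scheme \<Rightarrow> ('v \<Rightarrow> 'w) set" where
  "Lin K V W = {f \<in> carrier V \<rightarrow>\<^sub>E carrier W.
     (\<forall>x\<in>carrier V. \<forall>y\<in>carrier V. f (x \<oplus>\<^bsub>V\<^esub> y) = f x \<oplus>\<^bsub>W\<^esub> f y) \<and>
     (\<forall>k\<in>carrier K. \<forall>x\<in>carrier V. f (k \<odot>\<^bsub>V\<^esub> x) = k \<odot>\<^bsub>W\<^esub> f x)}"

definition idm :: "('k, 'v, 'm) module_scheme \<Rightarrow> 'v \<Rightarrow> 'v" where
  "idm V = (\<lambda>x\<in>carrier V. x)"

abbreviation sub :: "('k, 'v, 'm) module_scheme \<Rightarrow> 'v set \<Rightarrow> ('k, 'v, 'm) module_scheme" where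
  "sub V X \<equiv> V\<lparr>carrier := X\<rparr>"

definition lspan :: "('k, 'l) ring_scheme \<Rightarrow> ('k, 'v, 'm) module_scheme \<Rightarrow> 'v set \<Rightarrow> 'v set" where
  "lspan K V S = \<Inter>{H. submodule H K V \<and> S \<subseteq> H}"

definition self :: "('k, 'l) ring_scheme \<Rightarrow> ('k, 'k) module" where
  "self K = \<lparr>carrier = carrier K, mult = mult K, one = one K, zero = zero K, add = add K,
     smult = mult K\<rparr>"

definition quot :: "('k, 'v, 'm) module_scheme \<Rightarrow> 'v set \<Rightarrow> ('k, 'v set) module" where
  "quot V N = \<lparr>carrier = a_rcosets\<^bsub>V\<^esub> N, mult = undefined, one = undefined,
     zero = N, add = set_add V, smult = (\<lambda>k C. \<Union>x\<in>C. N +>\<^bsub>V\<^esub> (k \<odot>\<^bsub>V\<^esub> x))\<rparr>"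

definition quot_proj :: "('k, 'v, 'm) module_scheme \<Rightarrow> 'v set \<Rightarrow> 'v \<Rightarrow> 'v set" where
  "quot_proj V N = (\<lambda>x\<in>carrier V. N +>\<^bsub>V\<^esub> x)"


section \<open>Tensor products\<close>

definition free_space :: "('k, 'l) ring_scheme \<Rightarrow> 'x set \<Rightarrow> ('k, 'x \<Rightarrow> 'k) module" where
  "free_space K X = \<lparr>carrier = {f. (\<forall>x. f x \<in> carrier K) \<and> finite {x. f x \<noteq> \<zero>\<^bsub>K\<^esub>} \<and>
       {x. f x \<noteq> \<zero>\<^bsub>K\<^esub>} \<subseteq> X},
     mult = undefined, one = undefined, zero = (\<lambda>x. \<zero>\<^bsub>K\<^esub>),
     add = (\<lambda>f g x. f x \<oplus>\<^bsub>K\<^esub> g x), smult = (\<lambda>k f x. k \<otimes>\<^bsub>K\<^esub> f x)\<rparr>"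

definition free_gen :: "('k, 'l) ring_scheme \<Rightarrow> 'x \<Rightarrow> 'x \<Rightarrow> 'k" where
  "free_gen K x = (\<lambda>y. if y = x then \<one>\<^bsub>K\<^esub> else \<zero>\<^bsub>K\<^esub>)"

definition tensor_free :: "('k, 'l) ring_scheme \<Rightarrow> ('k, 'v, 'm) module_scheme
    \<Rightarrow> ('k, 'w, 'n) module_scheme \<Rightarrow> ('k, 'v \<times> 'w \<Rightarrow> 'k) module" where
  "tensor_free K V W = free_space K (carrier V \<times> carrier W)"

definition tensor_rels :: "('k, 'l) ring_scheme \<Rightarrow> ('k, 'v, 'm) module_scheme
    \<Rightarrow> ('k, 'w, 'n) module_scheme \<Rightarrow> ('v \<times> 'w \<Rightarrow> 'k) set" where
  "tensor_rels K V W = (let F = tensor_free K V W; d = free_gen K in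
     {d (v \<oplus>\<^bsub>V\<^esub> v', w) \<ominus>\<^bsub>F\<^esub> (d (v, w) \<oplus>\<^bsub>F\<^esub> d (v', w)) | v v' w.
        v \<in> carrier V \<and> v' \<in> carrier V \<and> w \<in> carrier W} \<union>
     {d (v, w \<oplus>\<^bsub>W\<^esub> w') \<ominus>\<^bsub>F\<^esub> (d (v, w) \<oplus>\<^bsub>F\<^esub> d (v, w')) | v w w'.
        v \<in> carrier V \<and> w \<in> carrier W \<and> w' \<in> carrier W} \<union>
     {d (k \<odot>\<^bsub>V\<^esub> v, w) \<ominus>\<^bsub>F\<^esub> k \<odot>\<^bsub>F\<^esub> d (v, w) | k v w.
        k \<in> carrier K \<and> v \<in> carrier V \<and> w \<in> carrier W} \<union>
     {d (v, k \<odot>\<^bsub>W\<^esub> w) \<ominus>\<^bsub>F\<^esub> k \<odot>\<^bsub>F\<^esub> d (v, w) | k v w.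
        k \<in> carrier K \<and> v \<in> carrier V \<and> w \<in> carrier W})"

definition tensor_null :: "('k, 'l) ring_scheme \<Rightarrow> ('k, 'v, 'm) module_scheme
    \<Rightarrow> ('k, 'w, 'n) module_scheme \<Rightarrow> ('v \<times> 'w \<Rightarrow> 'k) set" where
  "tensor_null K V W = lspan K (tensor_free K V W) (tensor_rels K V W)"

definition tens :: "('k, 'l) ring_scheme \<Rightarrow> ('k, 'v, 'm) module_scheme
    \<Rightarrow> ('k, 'w, 'n) module_scheme \<Rightarrow> ('k, ('v \<times> 'w \<Rightarrow> 'k) set) module" where
  "tens K V W = quot (tensor_free K V W) (tensor_null K V W)"

definition pure :: "('k, 'l) ring_scheme \<Rightarrow> ('k, 'v, 'm) module_scheme
    \<Rightarrow> ('k, 'w, 'n) module_scheme \<Rightarrow> 'v \<Rightarrow> 'w \<Rightarrow> ('v \<times> 'w \<Rightarrow> 'k) set" where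
  "pure K V W v w = tensor_null K V W +>\<^bsub>tensor_free K V W\<^esub> free_gen K (v, w)"

text \<open>
  The linear map out of a tensor product that is induced by a bilinear map \<open>\<beta>\<close>. Only the values
  of \<open>\<beta>\<close> on the two carriers matter.
\<close>

definition tlift :: "('k, 'l) ring_scheme \<Rightarrow> ('k, 'v, 'm) module_scheme
    \<Rightarrow> ('k, 'w, 'n) module_scheme \<Rightarrow> ('k, 'p, 'q) module_scheme
    \<Rightarrow> ('v \<Rightarrow> 'w \<Rightarrow> 'p) \<Rightarrow> ('v \<times> 'w \<Rightarrow> 'k) set \<Rightarrow> 'p" where
  "tlift K V W P \<beta> = (THE h. h \<in> Lin K (tens K V W) P \<and>
     (\<forall>v\<in>carrier V. \<forall>w\<in>carrier W. h (pure K V W v w) = \<beta> v w))"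

definition tmap :: "('k, 'l) ring_scheme \<Rightarrow> ('k, 'v, 'm) module_scheme
    \<Rightarrow> ('k, 'w, 'n) module_scheme \<Rightarrow> ('k, 'v', 'm') module_scheme
    \<Rightarrow> ('k, 'w', 'n') module_scheme \<Rightarrow> ('v \<Rightarrow> 'v') \<Rightarrow> ('w \<Rightarrow> 'w')
    \<Rightarrow> ('v \<times> 'w \<Rightarrow> 'k) set \<Rightarrow> ('v' \<times> 'w' \<Rightarrow> 'k) set" where
  "tmap K V W V' W' f g = tlift K V W (tens K V' W') (\<lambda>v w. pure K V' W' (f v) (g w))"

text \<open>The associativity isomorphism, its inverse, and the unit isomorphisms.\<close>

definition asc :: "('k, 'l) ring_scheme \<Rightarrow> ('k, 'u, 'm) module_scheme
    \<Rightarrow> ('k, 'v, 'n) module_scheme \<Rightarrow> ('k, 'w, 'p) module_scheme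
    \<Rightarrow> (('u \<times> 'v \<Rightarrow> 'k) set \<times> 'w \<Rightarrow> 'k) set \<Rightarrow> ('u \<times> ('v \<times> 'w \<Rightarrow> 'k) set \<Rightarrow> 'k) set" where
  "asc K U V W = (THE h. h \<in> Lin K (tens K (tens K U V) W) (tens K U (tens K V W)) \<and>
     (\<forall>u\<in>carrier U. \<forall>v\<in>carrier V. \<forall>w\<in>carrier W.
        h (pure K (tens K U V) W (pure K U V u v) w) =
        pure K U (tens K V W) u (pure K V W v w)))"

definition asc_inv :: "('k, 'l) ring_scheme \<Rightarrow> ('k, 'u, 'm) module_scheme
    \<Rightarrow> ('k, 'v, 'n) module_scheme \<Rightarrow> ('k, 'w, 'p) module_scheme
    \<Rightarrow> ('u \<times> ('v \<times> 'w \<Rightarrow> 'k) set \<Rightarrow> 'k) set \<Rightarrow> (('u \<times> 'v \<Rightarrow> 'k) set \<times> 'w \<Rightarrow> 'k) set" where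
  "asc_inv K U V W = (THE h. h \<in> Lin K (tens K U (tens K V W)) (tens K (tens K U V) W) \<and>
     (\<forall>u\<in>carrier U. \<forall>v\<in>carrier V. \<forall>w\<in>carrier W.
        h (pure K U (tens K V W) u (pure K V W v w)) =
        pure K (tens K U V) W (pure K U V u v) w))"

definition lunit :: "('k, 'l) ring_scheme \<Rightarrow> ('k, 'v, 'm) module_scheme
    \<Rightarrow> ('k \<times> 'v \<Rightarrow> 'k) set \<Rightarrow> 'v" where
  "lunit K V = tlift K (self K) V V (\<lambda>k v. k \<odot>\<^bsub>V\<^esub> v)"

definition runit :: "('k, 'l) ring_scheme \<Rightarrow> ('k, 'v, 'm) module_scheme
    \<Rightarrow> ('v \<times> 'k \<Rightarrow> 'k) set \<Rightarrow> 'v" where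
  "runit K V = tlift K V (self K) V (\<lambda>v k. k \<odot>\<^bsub>V\<^esub> v)"

text \<open>
  The canonical map \<open>V \<otimes> W \<rightarrow> V' \<otimes> W'\<close> for subspaces \<open>V\<close> of \<open>V'\<close> and \<open>W\<close> of \<open>W'\<close>. It is
  injective because the scalars form a field, so \<open>V \<otimes> W\<close> is identified with its image.
\<close>

definition tincl :: "('k, 'l) ring_scheme \<Rightarrow> ('k, 'v, 'm) module_scheme
    \<Rightarrow> ('k, 'w, 'n) module_scheme \<Rightarrow> ('k, 'v, 'm') module_scheme
    \<Rightarrow> ('k, 'w, 'n') module_scheme \<Rightarrow> ('v \<times> 'w \<Rightarrow> 'k) set \<Rightarrow> ('v \<times> 'w \<Rightarrow> 'k) set" where
  "tincl K V W V' W' = tmap K V W V' W' (idm V) (idm W)"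

definition tsub :: "('k, 'l) ring_scheme \<Rightarrow> ('k, 'v, 'm) module_scheme
    \<Rightarrow> 'v set \<Rightarrow> 'v set \<Rightarrow> ('v \<times> 'v \<Rightarrow> 'k) set set" where
  "tsub K V X Y = tincl K (sub V X) (sub V Y) V V ` carrier (tens K (sub V X) (sub V Y))"


section \<open>Braided bialgebras\<close>

text \<open>
  Threefold tensor powers are bracketed to the left. For an endomorphism \<open>c\<close> of \<open>V \<otimes> V\<close>,
  \<open>br12\<close> is \<open>c \<otimes> V\<close>, \<open>br23\<close> is \<open>V \<otimes> c\<close>, and \<open>br_mid\<close> is \<open>V \<otimes> c \<otimes> V\<close> on \<open>(V \<otimes> V) \<otimes> (V \<otimes> V)\<close>.
\<close>

definition br12 :: "('k, 'l) ring_scheme \<Rightarrow> ('k, 'v, 'm) module_scheme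
    \<Rightarrow> (('v \<times> 'v \<Rightarrow> 'k) set \<Rightarrow> ('v \<times> 'v \<Rightarrow> 'k) set)
    \<Rightarrow> (('v \<times> 'v \<Rightarrow> 'k) set \<times> 'v \<Rightarrow> 'k) set \<Rightarrow> (('v \<times> 'v \<Rightarrow> 'k) set \<times> 'v \<Rightarrow> 'k) set" where
  "br12 K V c = tmap K (tens K V V) V (tens K V V) V c (idm V)"

definition br23 :: "('k, 'l) ring_scheme \<Rightarrow> ('k, 'v, 'm) module_scheme
    \<Rightarrow> (('v \<times> 'v \<Rightarrow> 'k) set \<Rightarrow> ('v \<times> 'v \<Rightarrow> 'k) set)
    \<Rightarrow> (('v \<times> 'v \<Rightarrow> 'k) set \<times> 'v \<Rightarrow> 'k) set \<Rightarrow> (('v \<times> 'v \<Rightarrow> 'k) set \<times> 'v \<Rightarrow> 'k) set" where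
  "br23 K V c = asc_inv K V V V \<circ> tmap K V (tens K V V) V (tens K V V) (idm V) c \<circ> asc K V V V"

definition br_mid :: "('k, 'l) ring_scheme \<Rightarrow> ('k, 'v, 'm) module_scheme
    \<Rightarrow> (('v \<times> 'v \<Rightarrow> 'k) set \<Rightarrow> ('v \<times> 'v \<Rightarrow> 'k) set)
    \<Rightarrow> (('v \<times> 'v \<Rightarrow> 'k) set \<times> ('v \<times> 'v \<Rightarrow> 'k) set \<Rightarrow> 'k) set
    \<Rightarrow> (('v \<times> 'v \<Rightarrow> 'k) set \<times> ('v \<times> 'v \<Rightarrow> 'k) set \<Rightarrow> 'k) set" where
  "br_mid K V c = (let VV = tens K V V in
     asc_inv K V V VV \<circ>
     tmap K V (tens K V VV) V (tens K V VV) (idm V)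
       (asc K V V V \<circ> br12 K V c \<circ> asc_inv K V V V) \<circ>
     asc K V V VV)"

locale braided_vector_space = vspace K V
  for K :: "('k, 'l) ring_scheme" and V :: "('k, 'v, 'm) module_scheme"
    and c :: "('v \<times> 'v \<Rightarrow> 'k) set \<Rightarrow> ('v \<times> 'v \<Rightarrow> 'k) set" +
  assumes braid_Lin: "c \<in> Lin K (tens K V V) (tens K V V)"
    and braid_eq: "\<And>z. z \<in> carrier (tens K (tens K V V) V) \<Longrightarrow>
      br12 K V c (br23 K V c (br12 K V c z)) = br23 K V c (br12 K V c (br23 K V c z))"

text \<open>
  The unit axioms below use the identifications \<open>K \<otimes> A = A = A \<otimes> K\<close>, under which \<open>u \<otimes> A\<close> sends
  \<open>a\<close> to \<open>u 1 \<otimes> a\<close> and \<open>A \<otimes> u\<close> sends \<open>a\<close> to \<open>a \<otimes> u 1\<close>.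
\<close>

locale braided_algebra = braided_vector_space K A c
  for K :: "('k, 'l) ring_scheme" and A :: "('k, 'a, 'm) module_scheme"
    and m :: "('a \<times> 'a \<Rightarrow> 'k) set \<Rightarrow> 'a" and u :: "'k \<Rightarrow> 'a"
    and c :: "('a \<times> 'a \<Rightarrow> 'k) set \<Rightarrow> ('a \<times> 'a \<Rightarrow> 'k) set" +
  assumes mul_Lin: "m \<in> Lin K (tens K A A) A"
    and unit_Lin: "u \<in> Lin K (self K) A"
    and mul_assoc: "\<And>z. z \<in> carrier (tens K (tens K A A) A) \<Longrightarrow>
      m (tmap K (tens K A A) A A A m (idm A) z) =
      m (tmap K A (tens K A A) A A (idm A) m (asc K A A A z))"
    and unit_left: "\<And>a. a \<in> carrier A \<Longrightarrow> m (pure K A A (u \<one>\<^bsub>K\<^esub>) a) = a"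
    and unit_right: "\<And>a. a \<in> carrier A \<Longrightarrow> m (pure K A A a (u \<one>\<^bsub>K\<^esub>)) = a"
    and braid_mul_left: "\<And>z. z \<in> carrier (tens K (tens K A A) A) \<Longrightarrow>
      c (tmap K (tens K A A) A A A m (idm A) z) =
      tmap K A (tens K A A) A A (idm A) m (asc K A A A (br12 K A c (br23 K A c z)))"
    and braid_mul_right: "\<And>z. z \<in> carrier (tens K (tens K A A) A) \<Longrightarrow>
      c (tmap K A (tens K A A) A A (idm A) m (asc K A A A z)) =
      tmap K (tens K A A) A A A m (idm A) (br23 K A c (br12 K A c z))"
    and braid_unit_left: "\<And>a. a \<in> carrier A \<Longrightarrow>
      c (pure K A A (u \<one>\<^bsub>K\<^esub>) a) = pure K A A a (u \<one>\<^bsub>K\<^esub>)"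
    and braid_unit_right: "\<And>a. a \<in> carrier A \<Longrightarrow>
      c (pure K A A a (u \<one>\<^bsub>K\<^esub>)) = pure K A A (u \<one>\<^bsub>K\<^esub>) a"

locale braided_coalgebra = braided_vector_space K C c
  for K :: "('k, 'l) ring_scheme" and C :: "('k, 'a, 'm) module_scheme"
    and \<Delta> :: "'a \<Rightarrow> ('a \<times> 'a \<Rightarrow> 'k) set" and \<epsilon> :: "'a \<Rightarrow> 'k"
    and c :: "('a \<times> 'a \<Rightarrow> 'k) set \<Rightarrow> ('a \<times> 'a \<Rightarrow> 'k) set" +
  assumes comul_Lin: "\<Delta> \<in> Lin K C (tens K C C)"
    and counit_Lin: "\<epsilon> \<in> Lin K C (self K)"
    and comul_coassoc: "\<And>x. x \<in> carrier C \<Longrightarrow>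
      asc K C C C (tmap K C C (tens K C C) C \<Delta> (idm C) (\<Delta> x)) =
      tmap K C C C (tens K C C) (idm C) \<Delta> (\<Delta> x)"
    and counit_left: "\<And>x. x \<in> carrier C \<Longrightarrow>
      lunit K C (tmap K C C (self K) C \<epsilon> (idm C) (\<Delta> x)) = x"
    and counit_right: "\<And>x. x \<in> carrier C \<Longrightarrow>
      runit K C (tmap K C C C (self K) (idm C) \<epsilon> (\<Delta> x)) = x"
    and braid_comul_left: "\<And>z. z \<in> carrier (tens K C C) \<Longrightarrow>
      tmap K C C (tens K C C) C \<Delta> (idm C) (c z) =
      br23 K C c (br12 K C c (asc_inv K C C C (tmap K C C C (tens K C C) (idm C) \<Delta> z)))"
    and braid_comul_right: "\<And>z. z \<in> carrier (tens K C C) \<Longrightarrow>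
      asc_inv K C C C (tmap K C C C (tens K C C) (idm C) \<Delta> (c z)) =
      br12 K C c (br23 K C c (tmap K C C (tens K C C) C \<Delta> (idm C) z))"
    and braid_counit_left: "\<And>z. z \<in> carrier (tens K C C) \<Longrightarrow>
      lunit K C (tmap K C C (self K) C \<epsilon> (idm C) (c z)) =
      runit K C (tmap K C C C (self K) (idm C) \<epsilon> z)"
    and braid_counit_right: "\<And>z. z \<in> carrier (tens K C C) \<Longrightarrow>
      runit K C (tmap K C C C (self K) (idm C) \<epsilon> (c z)) =
      lunit K C (tmap K C C (self K) C \<epsilon> (idm C) z)"

record ('k, 'b) bb_data =
  mul :: "('b \<times> 'b \<Rightarrow> 'k) set \<Rightarrow> 'b"
  unt :: "'k \<Rightarrow> 'b"
  comul :: "'b \<Rightarrow> ('b \<times> 'b \<Rightarrow> 'k) set"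
  counit :: "'b \<Rightarrow> 'k"
  braid :: "('b \<times> 'b \<Rightarrow> 'k) set \<Rightarrow> ('b \<times> 'b \<Rightarrow> 'k) set"

locale braided_bialgebra =
  braided_algebra K B "mul S" "unt S" "braid S" +
  braided_coalgebra K B "comul S" "counit S" "braid S"
  for K :: "('k, 'l) ring_scheme" and B :: "('k, 'b, 'm) module_scheme"
    and S :: "('k, 'b) bb_data" +
  assumes comul_mul: "\<And>z. z \<in> carrier (tens K B B) \<Longrightarrow>
      comul S (mul S z) =
      tmap K (tens K B B) (tens K B B) B B (mul S) (mul S)
        (br_mid K B (braid S)
          (tmap K B B (tens K B B) (tens K B B) (comul S) (comul S) z))"
    and comul_unit: "comul S (unt S \<one>\<^bsub>K\<^esub>) = pure K B B (unt S \<one>\<^bsub>K\<^esub>) (unt S \<one>\<^bsub>K\<^esub>)"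
    and counit_unit: "counit S (unt S \<one>\<^bsub>K\<^esub>) = \<one>\<^bsub>K\<^esub>"
    and counit_mul: "\<And>x y. x \<in> carrier B \<Longrightarrow> y \<in> carrier B \<Longrightarrow>
      counit S (mul S (pure K B B x y)) = counit S x \<otimes>\<^bsub>K\<^esub> counit S y"

definition braided_bialgebra_hom :: "('k, 'l) ring_scheme
    \<Rightarrow> ('k, 'b, 'm) module_scheme \<Rightarrow> ('k, 'b) bb_data
    \<Rightarrow> ('k, 'd, 'n) module_scheme \<Rightarrow> ('k, 'd) bb_data \<Rightarrow> ('b \<Rightarrow> 'd) \<Rightarrow> bool" where
  "braided_bialgebra_hom K B S D T f \<longleftrightarrow>
     f \<in> Lin K B D \<and>
     (\<forall>z\<in>carrier (tens K B B). f (mul S z) = mul T (tmap K B B D D f f z)) \<and>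
     (\<forall>k\<in>carrier K. f (unt S k) = unt T k) \<and>
     (\<forall>x\<in>carrier B. comul T (f x) = tmap K B B D D f f (comul S x)) \<and>
     (\<forall>x\<in>carrier B. counit T (f x) = counit S x) \<and>
     (\<forall>z\<in>carrier (tens K B B). braid T (tmap K B B D D f f z) = tmap K B B D D f f (braid S z))"


section \<open>Graded braided bialgebras\<close>

definition is_decomp :: "('k, 'b, 'm) module_scheme \<Rightarrow> (nat \<Rightarrow> 'b set) \<Rightarrow> 'b \<Rightarrow> (nat \<Rightarrow> 'b) \<Rightarrow> bool"
where
  "is_decomp B G x f \<longleftrightarrow> (\<forall>n. f n \<in> G n) \<and> finite {n. f n \<noteq> \<zero>\<^bsub>B\<^esub>} \<and>
     x = finsum B f {n. f n \<noteq> \<zero>\<^bsub>B\<^esub>}"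

locale graded_braided_bialgebra = braided_bialgebra K B S
  for K :: "('k, 'l) ring_scheme" and B :: "('k, 'b, 'm) module_scheme"
    and S :: "('k, 'b) bb_data" and G :: "nat \<Rightarrow> 'b set" +
  assumes grade_sub: "\<And>n. submodule (G n) K B"
    and grade_decomp: "\<And>x. x \<in> carrier B \<Longrightarrow> \<exists>!f. is_decomp B G x f"
    and grade_mul: "\<And>i j. mul S ` tsub K B (G i) (G j) \<subseteq> G (i + j)"
    and grade_braid: "\<And>i j. braid S ` tsub K B (G i) (G j) \<subseteq> tsub K B (G j) (G i)"
    and grade_comul: "\<And>n x. x \<in> G n \<Longrightarrow>
      \<exists>f. (\<forall>i\<le>n. f i \<in> tsub K B (G i) (G (n - i))) \<and>
          comul S x = finsum (tens K B B) f {..n}"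
    and grade_counit: "\<And>n x. n > 0 \<Longrightarrow> x \<in> G n \<Longrightarrow> counit S x = \<zero>\<^bsub>K\<^esub>"

definition grade_proj :: "('k, 'b, 'm) module_scheme \<Rightarrow> (nat \<Rightarrow> 'b set) \<Rightarrow> nat \<Rightarrow> 'b \<Rightarrow> 'b" where
  "grade_proj B G n = (\<lambda>x\<in>carrier B. (THE f. is_decomp B G x f) n)"

text \<open>
  \<open>comul_comp K B S G i j\<close> is \<open>\<Delta>\<^sup>i\<^sup>,\<^sup>j : B\<^sup>i\<^sup>+\<^sup>j \<rightarrow> B\<^sup>i \<otimes> B\<^sup>j\<close>; the projection of \<open>B \<otimes> B\<close> onto its
  summand \<open>B\<^sup>i \<otimes> B\<^sup>j\<close> is the tensor product of the projections of \<open>B\<close>.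
\<close>

definition comul_comp :: "('k, 'l) ring_scheme \<Rightarrow> ('k, 'b, 'm) module_scheme
    \<Rightarrow> ('k, 'b) bb_data \<Rightarrow> (nat \<Rightarrow> 'b set) \<Rightarrow> nat \<Rightarrow> nat \<Rightarrow> 'b \<Rightarrow> ('b \<times> 'b \<Rightarrow> 'k) set" where
  "comul_comp K B S G i j = (\<lambda>x\<in>G (i + j).
     tmap K B B (sub B (G i)) (sub B (G j)) (grade_proj B G i) (grade_proj B G j) (comul S x))"

text \<open>
  The map \<open>X \<otimes> Y \<rightarrow> Y \<otimes> X\<close> obtained by restricting the braiding to subspaces \<open>X\<close> and \<open>Y\<close> of \<open>B\<close>;
  meaningful when the braiding maps \<open>X \<otimes> Y\<close> into \<open>Y \<otimes> X\<close>.
\<close>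

definition braid_restr :: "('k, 'l) ring_scheme \<Rightarrow> ('k, 'b, 'm) module_scheme
    \<Rightarrow> ('k, 'b) bb_data \<Rightarrow> 'b set \<Rightarrow> 'b set \<Rightarrow> ('b \<times> 'b \<Rightarrow> 'k) set \<Rightarrow> ('b \<times> 'b \<Rightarrow> 'k) set" where
  "braid_restr K B S X Y = (\<lambda>z\<in>carrier (tens K (sub B X) (sub B Y)).
     the_inv_into (carrier (tens K (sub B Y) (sub B X))) (tincl K (sub B Y) (sub B X) B B)
       (braid S (tincl K (sub B X) (sub B Y) B B z)))"


section \<open>Brackets and the quotient\<close>

definition E_comp :: "('k, 'l) ring_scheme \<Rightarrow> ('k, 'b, 'm) module_scheme
    \<Rightarrow> ('k, 'b) bb_data \<Rightarrow> (nat \<Rightarrow> 'b set) \<Rightarrow> nat \<Rightarrow> 'b set" where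
  "E_comp K B S G n = (if n < 2 then {\<zero>\<^bsub>B\<^esub>} else
     {x \<in> G n. \<forall>i j. 1 \<le> i \<and> 1 \<le> j \<and> i + j = n \<longrightarrow>
        comul_comp K B S G i j x = \<zero>\<^bsub>tens K (sub B (G i)) (sub B (G j))\<^esub>})"

text \<open>The sum of the \<open>E\<^sub>n\<close> inside \<open>B\<close>; it is direct because \<open>E\<^sub>n \<subseteq> B\<^sup>n\<close>.\<close>

definition E_space :: "('k, 'l) ring_scheme \<Rightarrow> ('k, 'b, 'm) module_scheme
    \<Rightarrow> ('k, 'b) bb_data \<Rightarrow> (nat \<Rightarrow> 'b set) \<Rightarrow> 'b set" where
  "E_space K B S G = lspan K B (\<Union>n. E_comp K B S G n)"

text \<open>The corestrictions of \<open>\<Delta>\<^sup>t\<^sup>,\<^sup>0\<close> and \<open>\<Delta>\<^sup>0\<^sup>,\<^sup>t\<close> to \<open>E\<^sub>t \<rightarrow> E\<^sub>t \<otimes> B\<^sup>0\<close> and \<open>E\<^sub>t \<rightarrow> B\<^sup>0 \<otimes> E\<^sub>t\<close>.\<close>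

definition E_coact_right :: "('k, 'l) ring_scheme \<Rightarrow> ('k, 'b, 'm) module_scheme
    \<Rightarrow> ('k, 'b) bb_data \<Rightarrow> (nat \<Rightarrow> 'b set) \<Rightarrow> nat \<Rightarrow> 'b \<Rightarrow> ('b \<times> 'b \<Rightarrow> 'k) set" where
  "E_coact_right K B S G t = (let Et = sub B (E_comp K B S G t); B0 = sub B (G 0) in
     (\<lambda>x\<in>carrier Et. the_inv_into (carrier (tens K Et B0)) (tincl K Et B0 (sub B (G t)) B0)
       (comul_comp K B S G t 0 x)))"

definition E_coact_left :: "('k, 'l) ring_scheme \<Rightarrow> ('k, 'b, 'm) module_scheme
    \<Rightarrow> ('k, 'b) bb_data \<Rightarrow> (nat \<Rightarrow> 'b set) \<Rightarrow> nat \<Rightarrow> 'b \<Rightarrow> ('b \<times> 'b \<Rightarrow> 'k) set" where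
  "E_coact_left K B S G t = (let Et = sub B (E_comp K B S G t); B0 = sub B (G 0) in
     (\<lambda>x\<in>carrier Et. the_inv_into (carrier (tens K B0 Et)) (tincl K B0 Et B0 (sub B (G t)))
       (comul_comp K B S G 0 t x)))"

definition is_bracket :: "('k, 'l) ring_scheme \<Rightarrow> ('k, 'b, 'm) module_scheme
    \<Rightarrow> ('k, 'b) bb_data \<Rightarrow> (nat \<Rightarrow> 'b set) \<Rightarrow> ('b \<Rightarrow> 'b) \<Rightarrow> bool" where
  "is_bracket K B S G b \<longleftrightarrow>
     (let E = E_space K B S G; EE = sub B E; B0 = sub B (G 0); B1 = sub B (G 1) in
      b \<in> Lin K EE B1 \<and>
      (\<forall>t. let Bt = sub B (G t); Et = sub B (E_comp K B S G t) in
        (\<forall>z\<in>carrier (tens K EE Bt).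
           braid_restr K B S (G 1) (G t) (tmap K EE Bt B1 Bt b (idm Bt) z) =
           tmap K Bt EE Bt B1 (idm Bt) b (braid_restr K B S E (G t) z)) \<and>
        (\<forall>z\<in>carrier (tens K Bt EE).
           braid_restr K B S (G t) (G 1) (tmap K Bt EE Bt B1 (idm Bt) b z) =
           tmap K EE Bt B1 Bt b (idm Bt) (braid_restr K B S (G t) E z)) \<and>
        (\<forall>x\<in>carrier Et.
           comul_comp K B S G 1 0 (b x) =
           tmap K Et B0 B1 B0 b (idm B0) (E_coact_right K B S G t x)) \<and>
        (\<forall>x\<in>carrier Et.
           comul_comp K B S G 0 1 (b x) =
           tmap K B0 Et B0 B1 (idm B0) b (E_coact_left K B S G t x))))"

text \<open>A two-sided ideal of this ring is closed under scalars, since these act as multiples of \<open>u 1\<close>.\<close>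

definition underlying_ring :: "('k, 'l) ring_scheme \<Rightarrow> ('k, 'b, 'm) module_scheme
    \<Rightarrow> ('k, 'b) bb_data \<Rightarrow> 'b ring" where
  "underlying_ring K B S = \<lparr>carrier = carrier B, mult = (\<lambda>x y. mul S (pure K B B x y)),
     one = unt S \<one>\<^bsub>K\<^esub>, zero = zero B, add = add B\<rparr>"

definition U_ideal :: "('k, 'l) ring_scheme \<Rightarrow> ('k, 'b, 'm) module_scheme
    \<Rightarrow> ('k, 'b) bb_data \<Rightarrow> (nat \<Rightarrow> 'b set) \<Rightarrow> ('b \<Rightarrow> 'b) \<Rightarrow> 'b set" where
  "U_ideal K B S G b =
     Idl\<^bsub>underlying_ring K B S\<^esub> ((\<lambda>z. z \<ominus>\<^bsub>B\<^esub> b z) ` E_space K B S G)"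

definition U_space :: "('k, 'l) ring_scheme \<Rightarrow> ('k, 'b, 'm) module_scheme
    \<Rightarrow> ('k, 'b) bb_data \<Rightarrow> (nat \<Rightarrow> 'b set) \<Rightarrow> ('b \<Rightarrow> 'b) \<Rightarrow> ('k, 'b set) module" where
  "U_space K B S G b = quot B (U_ideal K B S G b)"

definition U_proj :: "('k, 'l) ring_scheme \<Rightarrow> ('k, 'b, 'm) module_scheme
    \<Rightarrow> ('k, 'b) bb_data \<Rightarrow> (nat \<Rightarrow> 'b set) \<Rightarrow> ('b \<Rightarrow> 'b) \<Rightarrow> 'b \<Rightarrow> 'b set" where
  "U_proj K B S G b = quot_proj B (U_ideal K B S G b)"

end

theory Submission
  imports Defs
begin

text \<open>
  Let \<open>I\<close> be a two-sided ideal of a braided bialgebra \<open>B\<close> such that \<open>c\<close> maps \<open>I \<otimes> B\<close> into \<open>B \<otimes> I\<close> and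
  \<open>B \<otimes> I\<close> into \<open>I \<otimes> B\<close>, \<open>\<Delta>(I) \<subseteq> I \<otimes> B + B \<otimes> I\<close> and \<open>\<epsilon>(I) = 0\<close>. Then all structure maps descend
  to \<open>B / I\<close>. The axioms hold there because they hold in \<open>B\<close> and every map occurring in them
  commutes with the tensor powers of the projection \<open>\<pi>\<close>, and the structure is unique because
  \<open>\<pi>\<close> and \<open>\<pi> \<otimes> \<pi>\<close> are surjective (\<open>braided_bialgebra_transfer\<close>, \<open>quotient_bialgebra\<close>).

  Each of the conditions on \<open>I\<close> says that \<open>I\<close> is contained in a certain set of elements of \<open>B\<close>, and
  the compatibility of \<open>c\<close>, \<open>\<Delta>\<close> and \<open>\<epsilon>\<close> with the multiplication makes each of these sets a two-sided
  ideal. So it is enough to verify the conditions on generators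
  (\<open>quotient_by_generated_ideal\<close>), here on the elements \<open>z - b z\<close> with \<open>z \<in> E\<^sub>t\<close>.

  For these, the bracket axioms give \<open>c((z - b z) \<otimes> y) = (B \<otimes> (Id - b)) c(z \<otimes> y)\<close>, its mirror image,
  and, since an element of \<open>E\<^sub>t\<close> has only the two extreme components of its comultiplication,
  \<open>\<Delta>(z - b z) = ((Id - b) \<otimes> B) \<Delta>\<^sup>t\<^sup>,\<^sup>0 z + (B \<otimes> (Id - b)) \<Delta>\<^sup>0\<^sup>,\<^sup>t z\<close>. Both are meaningful, and lie in the
  required subspaces, because \<open>c(z \<otimes> y) \<in> B \<otimes> E\<^sub>t\<close>, \<open>\<Delta>\<^sup>t\<^sup>,\<^sup>0 z \<in> E\<^sub>t \<otimes> B\<^sup>0\<close> and \<open>\<Delta>\<^sup>0\<^sup>,\<^sup>t z \<in> B\<^sup>0 \<otimes> E\<^sub>t\<close>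
  (\<open>braid_E_comp\<close>, \<open>coaction_E_comp\<close>). To see this, \<open>E\<^sub>t\<close> with \<open>t \<ge> 2\<close> is written as the kernel of a
  single map \<open>\<delta> = (q \<otimes> q) \<Delta>\<close> on \<open>B\<^sup>t\<close>, where \<open>q\<close> kills degree zero and is the identity in positive degrees
  (\<open>E_comp_iff\<close>). The compatibility of \<open>c\<close> with \<open>\<Delta>\<close>, respectively coassociativity, shows that the
  tensors in question are killed by \<open>B \<otimes> \<delta>\<close> or \<open>\<delta> \<otimes> B\<close>, and over a field the kernel of \<open>f \<otimes> W\<close>
  is \<open>ker f \<otimes> W\<close> (\<open>tspan_kernel_left\<close>, \<open>tspan_kernel_right\<close>).
\<close>

section \<open>Linear maps and subspaces\<close>

text \<open>
  Linearity without the extensionality that is part of \<^const>\<open>Lin\<close>: a bracket is extensional on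
  \<open>E\<close>, but has to be read as a linear map on each \<open>E\<^sub>t\<close>, and composites written as
  \<open>\<lambda>\<close>-terms are not extensional.
\<close>

definition lin :: "('k, 'l) ring_scheme \<Rightarrow> ('k, 'v, 'm) module_scheme
    \<Rightarrow> ('k, 'w, 'n) module_scheme \<Rightarrow> ('v \<Rightarrow> 'w) \<Rightarrow> bool" where
  "lin K V W f \<longleftrightarrow> (\<forall>x\<in>carrier V. f x \<in> carrier W) \<and>
     (\<forall>x\<in>carrier V. \<forall>y\<in>carrier V. f (x \<oplus>\<^bsub>V\<^esub> y) = f x \<oplus>\<^bsub>W\<^esub> f y) \<and>
     (\<forall>k\<in>carrier K. \<forall>x\<in>carrier V. f (k \<odot>\<^bsub>V\<^esub> x) = k \<odot>\<^bsub>W\<^esub> f x)"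

lemma Lin_iff: "f \<in> Lin K V W \<longleftrightarrow> lin K V W f \<and> f \<in> extensional (carrier V)"
  by (auto simp: Lin_def lin_def PiE_iff)

lemma Lin_lin: "f \<in> Lin K V W \<Longrightarrow> lin K V W f"
  by (simp add: Lin_iff)

lemma Lin_restrict:
  assumes "vspace K V" "lin K V W f"
  shows "restrict f (carrier V) \<in> Lin K V W"
proof -
  interpret V: vspace K V by fact
  show ?thesis using assms(2) by (simp add: Lin_iff lin_def)
qed

lemma Lin_eqI:
  assumes "f \<in> Lin K V W" "g \<in> Lin K V W" "\<And>x. x \<in> carrier V \<Longrightarrow> f x = g x"
  shows "f = g"
  using assms by (auto simp: Lin_iff intro: extensionalityI)

lemma lin_closed: "lin K V W f \<Longrightarrow> x \<in> carrier V \<Longrightarrow> f x \<in> carrier W"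
  by (simp add: lin_def)

lemma lin_add: "lin K V W f \<Longrightarrow> x \<in> carrier V \<Longrightarrow> y \<in> carrier V \<Longrightarrow>
    f (x \<oplus>\<^bsub>V\<^esub> y) = f x \<oplus>\<^bsub>W\<^esub> f y"
  by (simp add: lin_def)

lemma lin_smult: "lin K V W f \<Longrightarrow> k \<in> carrier K \<Longrightarrow> x \<in> carrier V \<Longrightarrow>
    f (k \<odot>\<^bsub>V\<^esub> x) = k \<odot>\<^bsub>W\<^esub> f x"
  by (simp add: lin_def)

lemma linI:
  assumes "\<And>x. x \<in> carrier V \<Longrightarrow> f x \<in> carrier W"
    and "\<And>x y. x \<in> carrier V \<Longrightarrow> y \<in> carrier V \<Longrightarrow> f (x \<oplus>\<^bsub>V\<^esub> y) = f x \<oplus>\<^bsub>W\<^esub> f y"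
    and "\<And>k x. k \<in> carrier K \<Longrightarrow> x \<in> carrier V \<Longrightarrow> f (k \<odot>\<^bsub>V\<^esub> x) = k \<odot>\<^bsub>W\<^esub> f x"
  shows "lin K V W f"
  using assms by (simp add: lin_def)

lemma lin_cong:
  assumes "vspace K V" "lin K V W f" "\<And>x. x \<in> carrier V \<Longrightarrow> f x = g x"
  shows "lin K V W g"
proof -
  interpret V: vspace K V by fact
  show ?thesis using assms(2,3) by (simp add: lin_def)
qed

lemma lin_comp:
  assumes "lin K V W g" "lin K U V f"
  shows "lin K U W (\<lambda>x. g (f x))"
  using assms by (simp add: lin_def)

lemma lin_ident: "lin K V V (\<lambda>x. x)"
  by (simp add: lin_def)

lemma idm_apply: "x \<in> carrier V \<Longrightarrow> idm V x = x"
  by (simp add: idm_def)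

lemma lin_idm: "vspace K V \<Longrightarrow> lin K V V (idm V)"
  by (rule lin_cong[OF _ lin_ident]) (simp_all add: idm_def)

lemma vspace_field: "vspace K V \<Longrightarrow> field K"
  by (simp add: vspace_def)

lemma vspace_diff_zero:
  assumes "vspace K V" "x \<in> carrier V"
  shows "x \<ominus>\<^bsub>V\<^esub> \<zero>\<^bsub>V\<^esub> = x"
proof -
  interpret V: vspace K V by fact
  have "\<zero>\<^bsub>V\<^esub> \<oplus>\<^bsub>V\<^esub> (\<ominus>\<^bsub>V\<^esub> \<zero>\<^bsub>V\<^esub>) = \<zero>\<^bsub>V\<^esub>" by (rule V.M.r_neg) simp
  then have "\<ominus>\<^bsub>V\<^esub> \<zero>\<^bsub>V\<^esub> = \<zero>\<^bsub>V\<^esub>" by simp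
  then show ?thesis using assms by (simp add: a_minus_def)
qed

lemma minus_eq_zero_iff:
  assumes "vspace K V" "x \<in> carrier V" "y \<in> carrier V"
  shows "x \<ominus>\<^bsub>V\<^esub> y = \<zero>\<^bsub>V\<^esub> \<longleftrightarrow> x = y"
proof -
  interpret V: vspace K V by fact
  show ?thesis
  proof
    assume "x \<ominus>\<^bsub>V\<^esub> y = \<zero>\<^bsub>V\<^esub>"
    then have "(x \<ominus>\<^bsub>V\<^esub> y) \<oplus>\<^bsub>V\<^esub> y = y" using assms(3) by simp
    then show "x = y" using assms(2,3) by (simp add: a_minus_def V.M.a_assoc V.M.l_neg)
  qed (use assms(3) in \<open>simp add: a_minus_def V.M.r_neg\<close>)
qed

lemma lin_zero:
  assumes "vspace K V" "vspace K W" "lin K V W f"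
  shows "f \<zero>\<^bsub>V\<^esub> = \<zero>\<^bsub>W\<^esub>"
proof -
  interpret V: vspace K V by fact
  interpret W: vspace K W by fact
  have "f (\<zero>\<^bsub>K\<^esub> \<odot>\<^bsub>V\<^esub> \<zero>\<^bsub>V\<^esub>) = \<zero>\<^bsub>K\<^esub> \<odot>\<^bsub>W\<^esub> f \<zero>\<^bsub>V\<^esub>"
    by (rule lin_smult[OF assms(3)]) auto
  then show ?thesis using lin_closed[OF assms(3), of "\<zero>\<^bsub>V\<^esub>"] by simp
qed

lemma lin_minus:
  assumes "vspace K V" "vspace K W" "lin K V W f" "x \<in> carrier V" "y \<in> carrier V"
  shows "f (x \<ominus>\<^bsub>V\<^esub> y) = f x \<ominus>\<^bsub>W\<^esub> f y"
proof -
  interpret V: vspace K V by fact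
  interpret W: vspace K W by fact
  have "f (\<ominus>\<^bsub>V\<^esub> y) = \<ominus>\<^bsub>W\<^esub> f y"
    using lin_smult[OF assms(3), of "\<ominus>\<^bsub>K\<^esub> \<one>\<^bsub>K\<^esub>" y] assms(4,5) lin_closed[OF assms(3)]
    by (simp add: V.smult_l_minus W.smult_l_minus)
  then show ?thesis
    using lin_add[OF assms(3), of x "\<ominus>\<^bsub>V\<^esub> y"] assms(4,5) by (simp add: a_minus_def)
qed

lemma lin_finsum:
  assumes "vspace K V" "vspace K W" "lin K V W f" "\<And>i. i \<in> A \<Longrightarrow> g i \<in> carrier V"
  shows "f (finsum V g A) = finsum W (\<lambda>i. f (g i)) A"
proof -
  interpret V: vspace K V by fact
  interpret W: vspace K W by fact
  show ?thesis
  proof (cases "finite A")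
    case True
    then show ?thesis using assms(4)
      by (induction A) (auto simp: lin_zero[OF assms(1-3)] lin_add[OF assms(3)]
          lin_closed[OF assms(3)] Pi_def)
  next
    case False
    then show ?thesis
      by (simp add: lin_zero[OF assms(1-3)] V.M.finsum_infinite W.M.finsum_infinite)
  qed
qed

lemma lin_plus:
  assumes "vspace K V" "vspace K W" "lin K V W f" "lin K V W g"
  shows "lin K V W (\<lambda>x. f x \<oplus>\<^bsub>W\<^esub> g x)"
proof -
  interpret V: vspace K V by fact
  interpret W: vspace K W by fact
  show ?thesis
    by (rule linI) (simp_all add: lin_closed[OF assms(3)] lin_closed[OF assms(4)]
      lin_add[OF assms(3)] lin_add[OF assms(4)] lin_smult[OF assms(3)] lin_smult[OF assms(4)]
      W.smult_r_distr W.M.a_ac)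
qed

lemma lin_diff:
  assumes "vspace K V" "vspace K W" "lin K V W f" "lin K V W g"
  shows "lin K V W (\<lambda>x. f x \<ominus>\<^bsub>W\<^esub> g x)"
proof -
  interpret V: vspace K V by fact
  interpret W: vspace K W by fact
  show ?thesis
    by (rule linI) (simp_all add: lin_closed[OF assms(3)] lin_closed[OF assms(4)]
      lin_add[OF assms(3)] lin_add[OF assms(4)] lin_smult[OF assms(3)] lin_smult[OF assms(4)]
      W.smult_r_distr W.M.a_ac W.smult_r_minus a_minus_def W.M.minus_add)
qed

lemma lin_scale:
  assumes "vspace K V" "vspace K W" "lin K V W f" "k \<in> carrier K"
  shows "lin K V W (\<lambda>x. k \<odot>\<^bsub>W\<^esub> f x)"
proof -
  interpret K: field K by (rule vspace_field[OF assms(1)])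
  interpret V: vspace K V by fact
  interpret W: vspace K W by fact
  show ?thesis
    by (rule linI) (simp_all add: lin_closed[OF assms(3)] assms(4)
      lin_add[OF assms(3)] lin_smult[OF assms(3)] W.smult_r_distr W.smult_assoc1[symmetric] K.m_comm)
qed

text \<open>
  Negation is multiplication by \<open>-1\<close>, so closure under it follows from closure under scalars.
\<close>

lemma submoduleI_vspace:
  assumes V: "vspace K V" and sub: "H \<subseteq> carrier V" and zero: "\<zero>\<^bsub>V\<^esub> \<in> H"
    and add: "\<And>x y. x \<in> H \<Longrightarrow> y \<in> H \<Longrightarrow> x \<oplus>\<^bsub>V\<^esub> y \<in> H"
    and smult: "\<And>k x. k \<in> carrier K \<Longrightarrow> x \<in> H \<Longrightarrow> k \<odot>\<^bsub>V\<^esub> x \<in> H"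
  shows "submodule H K V"
proof -
  interpret K: field K by (rule vspace_field[OF V])
  interpret V: vspace K V by (rule V)
  show ?thesis
  proof (rule V.submoduleI[OF sub zero _ add smult])
    fix x assume x: "x \<in> H"
    then have "\<ominus>\<^bsub>V\<^esub> x = (\<ominus>\<^bsub>K\<^esub> \<one>\<^bsub>K\<^esub>) \<odot>\<^bsub>V\<^esub> x"
      using V.smult_l_minus[OF K.one_closed, of x] sub by auto
    then show "\<ominus>\<^bsub>V\<^esub> x \<in> H" using smult[OF _ x] K.add.inv_closed[OF K.one_closed] by simp
  qed
qed

lemma submodule_closed:
  assumes "vspace K V" "submodule H K V"
  shows "\<zero>\<^bsub>V\<^esub> \<in> H" "\<And>x. x \<in> H \<Longrightarrow> x \<in> carrier V"
    "\<And>x y. x \<in> H \<Longrightarrow> y \<in> H \<Longrightarrow> x \<oplus>\<^bsub>V\<^esub> y \<in> H"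
    "\<And>x y. x \<in> H \<Longrightarrow> y \<in> H \<Longrightarrow> x \<ominus>\<^bsub>V\<^esub> y \<in> H"
    "\<And>k x. k \<in> carrier K \<Longrightarrow> x \<in> H \<Longrightarrow> k \<odot>\<^bsub>V\<^esub> x \<in> H"
proof -
  interpret V: vspace K V by fact
  note H = V.submoduleE[OF assms(2)]
  show "\<zero>\<^bsub>V\<^esub> \<in> H"
    using H(2) H(1) H(4)[of "\<zero>\<^bsub>K\<^esub>"] by fastforce
  show "\<And>x. x \<in> H \<Longrightarrow> x \<in> carrier V"
    "\<And>x y. x \<in> H \<Longrightarrow> y \<in> H \<Longrightarrow> x \<oplus>\<^bsub>V\<^esub> y \<in> H"
    "\<And>x y. x \<in> H \<Longrightarrow> y \<in> H \<Longrightarrow> x \<ominus>\<^bsub>V\<^esub> y \<in> H"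
    "\<And>k x. k \<in> carrier K \<Longrightarrow> x \<in> H \<Longrightarrow> k \<odot>\<^bsub>V\<^esub> x \<in> H"
    using H by (auto simp: a_minus_def)
qed

lemma submodule_kernel:
  assumes "vspace K V" "vspace K W" "lin K V W f" "submodule H K W"
  shows "submodule {x \<in> carrier V. f x \<in> H} K V"
proof -
  interpret V: vspace K V by fact
  note H = submodule_closed[OF assms(2,4)]
  show ?thesis
    by (rule submoduleI_vspace[OF assms(1)])
       (use H in \<open>auto simp: lin_zero[OF assms(1-3)] lin_add[OF assms(3)] lin_smult[OF assms(3)]\<close>)
qed

lemma submodule_zero: "vspace K V \<Longrightarrow> submodule {\<zero>\<^bsub>V\<^esub>} K V"
proof -
  assume "vspace K V"
  then interpret V: vspace K V .
  show ?thesis by (rule submoduleI_vspace) (auto intro: V.vspace_axioms)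
qed

lemma vspace_sub:
  assumes "vspace K V" "submodule H K V"
  shows "vspace K (sub V H)"
proof -
  interpret V: vspace K V by fact
  show ?thesis
    by (rule vspace.intro[OF V.field_axioms])
       (rule submodule.submodule_is_module[OF assms(2) V.module_axioms])
qed

lemma lin_sub_dom: "lin K V W f \<Longrightarrow> X \<subseteq> carrier V \<Longrightarrow> lin K (sub V X) W f"
  by (simp add: lin_def subset_iff)

lemma lin_sub_codI: "lin K V W f \<Longrightarrow> (\<And>x. x \<in> carrier V \<Longrightarrow> f x \<in> Y) \<Longrightarrow> lin K V (sub W Y) f"
  by (auto simp: lin_def)

lemma lin_sub_cod: "lin K V (sub W Y) f \<Longrightarrow> Y \<subseteq> carrier W \<Longrightarrow> lin K V W f"
  by (auto simp: lin_def)

lemma lin_incl: "submodule X K V \<Longrightarrow> lin K (sub V X) V (idm (sub V X))"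
  using subgroup.mem_carrier[OF submodule.axioms(1)] subgroup.m_closed[OF submodule.axioms(1)]
  by (fastforce simp: lin_def idm_def submodule.smult_closed)

lemma submodule_trans:
  assumes V: "vspace K V" and X: "submodule X K V" and H: "submodule H K (sub V X)"
  shows "submodule H K V"
proof -
  note Hc = submodule_closed[OF vspace_sub[OF V X] H] and Xc = submodule_closed[OF V X]
  show ?thesis
    by (rule submoduleI_vspace[OF V]) (use Hc Xc(2) in auto)
qed

lemma lspan_submodule:
  assumes "vspace K V" "S \<subseteq> carrier V"
  shows "submodule (lspan K V S) K V"
proof -
  interpret V: vspace K V by fact
  have c: "lspan K V S \<subseteq> carrier V"
    unfolding lspan_def using V.carrier_is_submodule assms(2) by blast
  show ?thesis
  proof (rule submoduleI_vspace[OF assms(1) c])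
    show "\<zero>\<^bsub>V\<^esub> \<in> lspan K V S"
      unfolding lspan_def using submodule_closed(1)[OF assms(1)] by blast
    show "a \<oplus>\<^bsub>V\<^esub> b \<in> lspan K V S" if "a \<in> lspan K V S" "b \<in> lspan K V S" for a b
      using that V.submoduleE(5) unfolding lspan_def by blast
    show "k \<odot>\<^bsub>V\<^esub> a \<in> lspan K V S" if "k \<in> carrier K" "a \<in> lspan K V S" for k a
      using that V.submoduleE(4) unfolding lspan_def by blast
  qed
qed

lemma lspan_incl: "x \<in> S \<Longrightarrow> x \<in> lspan K V S"
  by (auto simp: lspan_def)

lemma lspan_least: "submodule H K V \<Longrightarrow> S \<subseteq> H \<Longrightarrow> lspan K V S \<subseteq> H"
  by (auto simp: lspan_def)

lemma lin_lspan:
  assumes "vspace K V" "vspace K W" "lin K V W f" "submodule H K W" "S \<subseteq> carrier V"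
    and "\<And>x. x \<in> S \<Longrightarrow> f x \<in> H" and "z \<in> lspan K V S"
  shows "f z \<in> H"
  using lspan_least[OF submodule_kernel[OF assms(1-4)], of S] assms(5-7) by blast

section \<open>Quotient spaces\<close>

lemma quot_carrier: "carrier (quot V N) = (\<lambda>x. N +>\<^bsub>V\<^esub> x) ` carrier V"
  by (auto simp: quot_def A_RCOSETS_def RCOSETS_def a_r_coset_def)

context
  fixes K :: "('k, 'l) ring_scheme" and V :: "('k, 'v, 'm) module_scheme" (structure) and N
  assumes V: "vspace K V" and N: "submodule N K V"
begin

interpretation V: vspace K V by (rule V)

lemma abelian_subgroup_submodule: "abelian_subgroup N V"
  by (rule abelian_subgroupI3)
     (auto simp: additive_subgroup_def submodule.axioms(1)[OF N] V.M.abelian_group_axioms)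

interpretation N: abelian_subgroup N V by (rule abelian_subgroup_submodule)

lemma coset_eq_iff:
  assumes "x \<in> carrier V" "y \<in> carrier V"
  shows "N +> x = N +> y \<longleftrightarrow> x \<ominus> y \<in> N"
proof
  assume "N +> x = N +> y"
  then have "x \<in> N +> y" using N.a_rcos_self[OF assms(1)] by simp
  then show "x \<ominus> y \<in> N" using N.a_rcos_module_imp[OF assms(2)] by (simp add: a_minus_def)
next
  assume "x \<ominus> y \<in> N"
  then have "x \<in> N +> y" using N.a_rcos_module_rev[OF assms(2,1)] by (simp add: a_minus_def)
  then show "N +> x = N +> y" using N.a_repr_independence'[OF _ assms(2)] by simp
qed

lemma coset_add:
  assumes "x \<in> carrier V" "y \<in> carrier V"
  shows "(N +> x) \<oplus>\<^bsub>quot V N\<^esub> (N +> y) = N +> (x \<oplus> y)"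
  using N.a_rcos_sum[OF assms] by (simp add: quot_def)

lemma coset_smult:
  assumes "k \<in> carrier K" "x \<in> carrier V"
  shows "k \<odot>\<^bsub>quot V N\<^esub> (N +> x) = N +> (k \<odot> x)"
proof -
  have "N +> (k \<odot> y) = N +> (k \<odot> x)" if y: "y \<in> N +> x" for y
  proof -
    have yV: "y \<in> carrier V" using y assms(2) by (rule N.a_elemrcos_carrier[rotated])
    have "y \<ominus> x \<in> N" using N.a_rcos_module_imp[OF assms(2) y] by (simp add: a_minus_def)
    then have "k \<odot> (y \<ominus> x) \<in> N" using assms(1) submodule_closed(5)[OF V N] by blast
    also have "k \<odot> (y \<ominus> x) = k \<odot> y \<ominus> k \<odot> x"
      using assms yV by (simp add: a_minus_def V.smult_r_distr V.smult_r_minus)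
    finally show ?thesis using coset_eq_iff assms yV by simp
  qed
  then have "(\<Union>y\<in>N +> x. N +> (k \<odot> y)) = (\<Union>y\<in>N +> x. N +> (k \<odot> x))"
    by (rule SUP_cong[OF refl])
  also have "\<dots> = N +> (k \<odot> x)"
    using N.a_rcos_self[OF assms(2)] by blast
  finally show ?thesis by (simp add: quot_def)
qed

lemma coset_zero: "\<zero>\<^bsub>quot V N\<^esub> = N +> \<zero>"
  unfolding quot_def using V.M.a_coset_add_zero[OF N.a_subset] by simp

lemma vspace_quot: "vspace K (quot V N)"
proof (rule vspace.intro[OF V.field_axioms], rule moduleI[OF module.axioms(1)[OF V.module_axioms]])
  note [simp] = coset_add coset_smult coset_zero quot_carrier V.M.a_closed V.smult_closed
  show "abelian_group (quot V N)"
  proof (rule abelian_groupI)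
    fix x assume "x \<in> carrier (quot V N)"
    then obtain v where v: "v \<in> carrier V" "x = N +> v" by auto
    show "\<exists>y\<in>carrier (quot V N). y \<oplus>\<^bsub>quot V N\<^esub> x = \<zero>\<^bsub>quot V N\<^esub>"
      by (rule bexI[of _ "N +> (\<ominus> v)"]) (use v in \<open>auto simp: V.M.l_neg\<close>)
  qed (auto simp: V.M.a_ac)
qed (auto simp: coset_add coset_smult quot_carrier V.smult_l_distr V.smult_r_distr V.smult_assoc1)

lemma lin_coset: "lin K V (quot V N) (\<lambda>x. N +> x)"
  by (rule linI) (auto simp: coset_add coset_smult quot_carrier)

lemma coset_eq_zero_iff:
  assumes "x \<in> carrier V"
  shows "N +> x = \<zero>\<^bsub>quot V N\<^esub> \<longleftrightarrow> x \<in> N"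
  unfolding coset_zero coset_eq_iff[OF assms V.M.zero_closed] vspace_diff_zero[OF V assms] ..

text \<open>
  The universal property of the quotient: choosing representatives gives a well-defined map because
  two of them differ by an element of \<open>N\<close>.
\<close>

lemma quot_factor:
  assumes P: "vspace K P" and f: "lin K V P f" and z: "\<And>x. x \<in> N \<Longrightarrow> f x = \<zero>\<^bsub>P\<^esub>"
  shows "\<exists>g. lin K (quot V N) P g \<and> (\<forall>x\<in>carrier V. g (N +> x) = f x)"
proof -
  interpret P: vspace K P by (rule P)
  define g where "g C = f (SOME x. x \<in> carrier V \<and> N +> x = C)" for C
  have g: "g (N +> x) = f x" if x: "x \<in> carrier V" for x
  proof -
    define y where "y = (SOME y. y \<in> carrier V \<and> N +> y = N +> x)"
    have y: "y \<in> carrier V \<and> N +> y = N +> x"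
      unfolding y_def by (rule someI[of _ x]) (use x in auto)
    then have "y \<ominus> x \<in> N" using coset_eq_iff x by blast
    then have "f y \<ominus>\<^bsub>P\<^esub> f x = \<zero>\<^bsub>P\<^esub>" using z lin_minus[OF V P f, of y x] x y by simp
    then have "f y = f x" using lin_closed[OF f] x y by (simp add: minus_eq_zero_iff[OF P])
    then show ?thesis by (simp add: g_def y_def)
  qed
  have "lin K (quot V N) P g"
  proof (rule linI)
    fix C assume "C \<in> carrier (quot V N)"
    then obtain x where x: "x \<in> carrier V" "C = N +> x" by (auto simp: quot_carrier)
    show "g C \<in> carrier P" using x g lin_closed[OF f] by simp
    fix k assume k: "k \<in> carrier K"
    show "g (k \<odot>\<^bsub>quot V N\<^esub> C) = k \<odot>\<^bsub>P\<^esub> g C"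
      using x k by (simp only: coset_smult g V.smult_closed lin_smult[OF f])
  next
    fix C D assume "C \<in> carrier (quot V N)" "D \<in> carrier (quot V N)"
    then obtain x y where x: "x \<in> carrier V" "C = N +> x"
      and y: "y \<in> carrier V" "D = N +> y" by (auto simp: quot_carrier)
    show "g (C \<oplus>\<^bsub>quot V N\<^esub> D) = g C \<oplus>\<^bsub>P\<^esub> g D"
      using x y by (simp only: coset_add g V.M.a_closed lin_add[OF f])
  qed
  then show ?thesis using g by blast
qed

end

section \<open>Complements and quasi-inverses\<close>

text \<open>
  By Zorn's lemma there is a subspace \<open>N\<close> that is maximal among those meeting \<open>X\<close> trivially. If \<open>v\<close>
  were outside \<open>N + X\<close>, then \<open>N + K v\<close> would be larger: a nonzero element \<open>n + k v\<close> of \<open>X\<close> with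
  \<open>n \<in> N\<close> has \<open>k \<noteq> 0\<close>, and dividing by \<open>k\<close> puts \<open>v\<close> into \<open>N + X\<close>.
\<close>

lemma complement_exists:
  fixes K and V (structure)
  assumes V: "vspace K V" and X: "submodule X K V"
  shows "\<exists>N. submodule N K V \<and> N \<inter> X = {\<zero>} \<and>
     (\<forall>v\<in>carrier V. \<exists>n\<in>N. \<exists>x\<in>X. v = n \<oplus> x)"
proof -
  interpret K: field K by (rule vspace_field[OF V])
  interpret V: vspace K V by (rule V)
  define \<A> where "\<A> = {N. submodule N K V \<and> N \<inter> X = {\<zero>}}"
  note Xc = submodule_closed[OF V X]
  have "\<exists>M\<in>\<A>. \<forall>Y\<in>\<A>. M \<subseteq> Y \<longrightarrow> Y = M"
  proof (rule subset_Zorn_nonempty)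
    show "\<A> \<noteq> {}" unfolding \<A>_def using submodule_zero[OF V] Xc(1) by blast
    fix C assume C0: "C \<noteq> {}" and C: "subset.chain \<A> C"
    have sm: "submodule N K V" "N \<inter> X = {\<zero>}" if "N \<in> C" for N
      using C that unfolding subset.chain_def \<A>_def by blast+
    note smc = submodule_closed[OF V sm(1)]
    have "submodule (\<Union>C) K V"
    proof (rule submoduleI_vspace[OF V])
      show "\<Union>C \<subseteq> carrier V" using smc(2) by blast
      show "\<zero> \<in> \<Union>C" using smc(1) C0 by blast
      show "k \<odot> a \<in> \<Union>C" if "k \<in> carrier K" "a \<in> \<Union>C" for k a
        using that smc(5) by blast
      show "a \<oplus> b \<in> \<Union>C" if ab: "a \<in> \<Union>C" "b \<in> \<Union>C" for a b
      proof -
        obtain M N where MN: "a \<in> M" "b \<in> N" "M \<in> C" "N \<in> C" using ab by blast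
        then have "M \<subseteq> N \<or> N \<subseteq> M" using C by (auto simp: subset.chain_def)
        then obtain L where "L \<in> C" "a \<in> L" "b \<in> L" using MN by blast
        then show ?thesis using smc(3) by blast
      qed
    qed
    moreover have "\<Union>C \<inter> X = {\<zero>}"
    proof -
      have "\<Union>C \<inter> X = (\<Union>N\<in>C. N \<inter> X)" by blast
      then show ?thesis using sm(2) C0 by simp
    qed
    ultimately show "\<Union>C \<in> \<A>" by (simp add: \<A>_def)
  qed
  then obtain N where N: "N \<in> \<A>" and max: "\<And>Y. Y \<in> \<A> \<Longrightarrow> N \<subseteq> Y \<Longrightarrow> Y = N" by blast
  have Ns: "submodule N K V" and NX: "N \<inter> X = {\<zero>}" using N by (auto simp: \<A>_def)
  note Nc = submodule_closed[OF V Ns]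
  have "\<exists>n\<in>N. \<exists>x\<in>X. v = n \<oplus> x" if v: "v \<in> carrier V" for v
  proof -
    define N' where "N' = {n \<oplus> k \<odot> v | n k. n \<in> N \<and> k \<in> carrier K}"
    have N'I: "n \<oplus> k \<odot> v \<in> N'" if "n \<in> N" "k \<in> carrier K" for n k
      using that by (auto simp: N'_def)
    have N's: "submodule N' K V"
    proof (rule submoduleI_vspace[OF V])
      show "N' \<subseteq> carrier V" using Nc(2) v by (auto simp: N'_def)
      show "\<zero> \<in> N'" using N'I[OF Nc(1), of "\<zero>\<^bsub>K\<^esub>"] v by simp
      fix a assume "a \<in> N'"
      then obtain n k where nk: "n \<in> N" "k \<in> carrier K" "a = n \<oplus> k \<odot> v" by (auto simp: N'_def)
      show "l \<odot> a \<in> N'" if l: "l \<in> carrier K" for l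
        using N'I[OF Nc(5)[OF l nk(1)] K.m_closed[OF l nk(2)]] nk v l Nc(2)
        by (simp add: V.smult_r_distr V.smult_assoc1)
      fix a' assume "a' \<in> N'"
      then obtain n' k' where nk': "n' \<in> N" "k' \<in> carrier K" "a' = n' \<oplus> k' \<odot> v"
        by (auto simp: N'_def)
      have "a \<oplus> a' = (n \<oplus> n') \<oplus> (k \<oplus>\<^bsub>K\<^esub> k') \<odot> v"
        using nk nk' v Nc(2) by (simp add: V.smult_l_distr V.M.a_ac)
      then show "a \<oplus> a' \<in> N'"
        using N'I[OF Nc(3)[OF nk(1) nk'(1)] K.a_closed[OF nk(2) nk'(2)]] by simp
    qed
    have NN': "N \<subseteq> N'"
    proof
      fix n assume "n \<in> N"
      then show "n \<in> N'" using N'I[of n "\<zero>\<^bsub>K\<^esub>"] v Nc(2) by simp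
    qed
    have vN': "v \<in> N'"
      using N'I[OF Nc(1) K.one_closed] v by simp
    show ?thesis
    proof (cases "N' \<inter> X = {\<zero>}")
      case True
      then have "N' = N" using max NN' N's by (auto simp: \<A>_def)
      then have "v \<in> N" using vN' by simp
      then show ?thesis using Xc(1) v by (intro bexI[of _ v] bexI[of _ "\<zero>"]) auto
    next
      case False
      have "\<zero> \<in> N' \<inter> X" using submodule_closed(1)[OF V N's] Xc(1) by simp
      then obtain y where y: "y \<in> N'" "y \<in> X" "y \<noteq> \<zero>" using False by blast
      then obtain n k where nk: "n \<in> N" "k \<in> carrier K" "y = n \<oplus> k \<odot> v" by (auto simp: N'_def)
      have k0: "k \<noteq> \<zero>\<^bsub>K\<^esub>"
      proof
        assume "k = \<zero>\<^bsub>K\<^esub>"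
        then have "y = n" using nk v Nc(2) by simp
        then have "y \<in> N \<inter> X" using nk(1) y(2) by simp
        then show False using NX y(3) by simp
      qed
      then have ku: "k \<in> Units K" using nk K.field_Units by simp
      define j where "j = inv\<^bsub>K\<^esub> k"
      have j: "j \<in> carrier K" "j \<otimes>\<^bsub>K\<^esub> k = \<one>\<^bsub>K\<^esub>" using ku by (auto simp: j_def)
      have "k \<odot> v = \<ominus> n \<oplus> y"
        unfolding nk(3) using nk(1,2) v Nc(2) by (simp add: V.M.r_neg1)
      then have "j \<odot> (k \<odot> v) = j \<odot> (\<ominus> n) \<oplus> j \<odot> y"
        using nk(1) j Nc(2) Xc(2)[OF y(2)] by (simp add: V.smult_r_distr)
      moreover have "j \<odot> (k \<odot> v) = v"
        using j nk(2) v V.smult_assoc1[of j k v] by simp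
      moreover have "j \<odot> (\<ominus> n) \<in> N" using nk(1) j(1) Nc(5) V.submoduleE(3)[OF Ns] by blast
      moreover have "j \<odot> y \<in> X" using y j(1) Xc(5) by blast
      ultimately show ?thesis by auto
    qed
  qed
  then show ?thesis using Ns NX by blast
qed

text \<open>
  The projection onto \<open>X\<close> along a complement.
\<close>

lemma retraction_exists:
  fixes K and V (structure)
  assumes V: "vspace K V" and X: "submodule X K V"
  shows "\<exists>r. lin K V (sub V X) r \<and> (\<forall>x\<in>X. r x = x)"
proof -
  interpret V: vspace K V by (rule V)
  obtain N where N: "submodule N K V" "N \<inter> X = {\<zero>}"
     "\<And>v. v \<in> carrier V \<Longrightarrow> \<exists>n\<in>N. \<exists>x\<in>X. v = n \<oplus> x"
    using complement_exists[OF V X] by blast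
  note Xc = submodule_closed[OF V X] and Nc = submodule_closed[OF V N(1)]
  define r where "r v = (THE x. x \<in> X \<and> v \<ominus> x \<in> N)" for v
  have r: "r v = x" if "x \<in> X" "v \<ominus> x \<in> N" "v \<in> carrier V" for v x
    unfolding r_def
  proof (rule the_equality)
    fix y assume y: "y \<in> X \<and> v \<ominus> y \<in> N"
    have "(v \<ominus> x) \<ominus> (v \<ominus> y) = y \<ominus> x"
      using that y Xc(2) by (simp add: a_minus_def V.M.minus_add V.M.a_ac V.M.r_neg1 V.M.r_neg2)
    then have "y \<ominus> x \<in> N \<inter> X" using that y Nc(4) Xc(4) by (metis IntI)
    then have "y \<ominus> x = \<zero>" using N(2) by blast
    then show "y = x" using that y Xc(2) by (simp add: minus_eq_zero_iff[OF V])
  qed (use that in auto)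
  have ex: "r v \<in> X \<and> v \<ominus> r v \<in> N" if v: "v \<in> carrier V" for v
  proof -
    obtain n x where nx: "n \<in> N" "x \<in> X" "v = n \<oplus> x" using N(3) v by blast
    have "v \<ominus> x = n" using nx Nc(2) Xc(2) by (simp add: a_minus_def V.M.a_assoc V.M.r_neg)
    then show ?thesis using r[of x v] nx v by simp
  qed
  note rX = ex[THEN conjunct1] and rN = ex[THEN conjunct2]
  have "lin K V (sub V X) r"
  proof (rule linI)
    fix v w assume vw: "v \<in> carrier V" "w \<in> carrier V"
    have "r (v \<oplus> w) = r v \<oplus> r w"
    proof (rule r)
      have "v \<oplus> w \<ominus> (r v \<oplus> r w) = (v \<ominus> r v) \<oplus> (w \<ominus> r w)"
        using vw rX Xc(2) by (simp add: a_minus_def V.M.minus_add V.M.a_ac)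
      then show "v \<oplus> w \<ominus> (r v \<oplus> r w) \<in> N" using Nc(3) rN vw by simp
    qed (use vw rX Xc in auto)
    then show "r (v \<oplus> w) = r v \<oplus>\<^bsub>sub V X\<^esub> r w" by simp
  next
    fix k v assume vw: "k \<in> carrier K" "v \<in> carrier V"
    have "r (k \<odot> v) = k \<odot> r v"
    proof (rule r)
      have "k \<odot> v \<ominus> (k \<odot> r v) = k \<odot> (v \<ominus> r v)"
        using vw rX Xc(2) by (simp add: a_minus_def V.smult_r_distr V.smult_r_minus)
      then show "k \<odot> v \<ominus> (k \<odot> r v) \<in> N" using Nc(5) rN vw by simp
    qed (use vw rX Xc in auto)
    then show "r (k \<odot> v) = k \<odot>\<^bsub>sub V X\<^esub> r v" by simp
  qed (use rX in auto)
  moreover have "r x = x" if "x \<in> X" for x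
    by (rule r) (use that Xc Nc(1) in \<open>auto simp: a_minus_def V.M.r_neg\<close>)
  ultimately show ?thesis by blast
qed

lemma submodule_image:
  assumes V: "vspace K V" and P: "vspace K P" and f: "lin K V P f"
  shows "submodule (f ` carrier V) K P"
proof -
  interpret V: vspace K V by (rule V)
  show ?thesis
  proof (rule submoduleI_vspace[OF P])
    show "f ` carrier V \<subseteq> carrier P" using lin_closed[OF f] by blast
    show "\<zero>\<^bsub>P\<^esub> \<in> f ` carrier V"
      using imageI[OF V.M.zero_closed, of f] by (simp add: lin_zero[OF V P f])
    fix a assume "a \<in> f ` carrier V"
    then obtain v where v: "v \<in> carrier V" "a = f v" by blast
    show "k \<odot>\<^bsub>P\<^esub> a \<in> f ` carrier V" if "k \<in> carrier K" for k
      using imageI[OF V.smult_closed[OF that v(1)], of f] v that by (simp add: lin_smult[OF f])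
    fix a' assume "a' \<in> f ` carrier V"
    then obtain v' where v': "v' \<in> carrier V" "a' = f v'" by blast
    show "a \<oplus>\<^bsub>P\<^esub> a' \<in> f ` carrier V"
      using imageI[OF V.M.a_closed[OF v(1) v'(1)], of f] v v' by (simp add: lin_add[OF f])
  qed
qed

text \<open>
  This takes the place of exactness arguments. Since \<open>v - q (f v)\<close> lies in the kernel of \<open>f\<close>, a
  quasi-inverse computes kernels of tensored maps, and for surjective \<open>f\<close> it is a section.
\<close>

lemma quasi_inverse_exists:
  assumes V: "vspace K V" and P: "vspace K P" and f: "lin K V P f"
  shows "\<exists>q. lin K P V q \<and> (\<forall>v\<in>carrier V. f (q (f v)) = f v)"
proof -
  interpret V: vspace K V by (rule V)
  interpret P: vspace K P by (rule P)
  define X where "X = {v \<in> carrier V. f v \<in> {\<zero>\<^bsub>P\<^esub>}}"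
  have X: "submodule X K V" unfolding X_def
    by (rule submodule_kernel[OF V P f submodule_zero[OF P]])
  note Xc = submodule_closed[OF V X]
  obtain r where r: "lin K V (sub V X) r" "\<And>x. x \<in> X \<Longrightarrow> r x = x"
    using retraction_exists[OF V X] by blast
  have rX: "r v \<in> X" if "v \<in> carrier V" for v using lin_closed[OF r(1) that] by simp
  have rl: "lin K V V r" using lin_sub_cod[OF r(1)] Xc by blast
  note im = submodule_image[OF V P f]
  obtain \<rho> where \<rho>: "lin K P (sub P (f ` carrier V)) \<rho>" "\<And>x. x \<in> f ` carrier V \<Longrightarrow> \<rho> x = x"
    using retraction_exists[OF P im] by blast
  have \<rho>l: "lin K P P \<rho>" using lin_sub_cod[OF \<rho>(1)] lin_closed[OF f] by blast
  have \<rho>i: "\<rho> p \<in> f ` carrier V" if "p \<in> carrier P" for p using lin_closed[OF \<rho>(1) that] by simp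
  \<comment> \<open>Subtracting the part in the kernel makes the result depend on \<open>f v\<close> only, so that \<open>s\<close> inverts \<open>f\<close> on its image.\<close>
  define s where "s v = v \<ominus>\<^bsub>V\<^esub> r v" for v
  have sl: "lin K V V s" unfolding s_def by (rule lin_diff[OF V V lin_ident rl])
  have s: "s v = s w" if vw: "v \<in> carrier V" "w \<in> carrier V" "f v = f w" for v w
  proof -
    have "v \<ominus>\<^bsub>V\<^esub> w \<in> X" unfolding X_def
      using vw lin_minus[OF V P f vw(1,2)] lin_closed[OF f] by (simp add: minus_eq_zero_iff[OF P])
    then have "s (v \<ominus>\<^bsub>V\<^esub> w) = \<zero>\<^bsub>V\<^esub>" using r(2) Xc(2) by (simp add: s_def a_minus_def V.M.r_neg)
    then show ?thesis using lin_minus[OF V V sl vw(1,2)] lin_closed[OF sl] vw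
      by (simp add: minus_eq_zero_iff[OF V])
  qed
  have fs: "f (s v) = f v" if v: "v \<in> carrier V" for v
  proof -
    have "f (r v) = \<zero>\<^bsub>P\<^esub>" using rX[OF v] by (simp add: X_def)
    then show ?thesis unfolding s_def
      using lin_minus[OF V P f v lin_closed[OF rl v]] vspace_diff_zero[OF P lin_closed[OF f v]] by simp
  qed
  define q where "q p = s (SOME v. v \<in> carrier V \<and> f v = \<rho> p)" for p
  have q: "q p = s v" if "p \<in> carrier P" "v \<in> carrier V" "f v = \<rho> p" for p v
  proof -
    define w where "w = (SOME v. v \<in> carrier V \<and> f v = \<rho> p)"
    have "w \<in> carrier V \<and> f w = \<rho> p" unfolding w_def by (rule someI[of _ v]) (use that in auto)
    then have "s w = s v" using that by (intro s) auto
    then show ?thesis by (simp add: q_def w_def)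
  qed
  have qe: "\<exists>v\<in>carrier V. f v = \<rho> p \<and> q p = s v" if "p \<in> carrier P" for p
    using \<rho>i[OF that] q[OF that] by (metis imageE)
  have "lin K P V q"
  proof (rule linI)
    fix p assume p: "p \<in> carrier P"
    obtain v where v: "v\<in>carrier V" "f v = \<rho> p" "q p = s v" using qe[OF p] by blast
    show "q p \<in> carrier V" using v lin_closed[OF sl] by simp
    fix k assume k: "k \<in> carrier K"
    show "q (k \<odot>\<^bsub>P\<^esub> p) = k \<odot>\<^bsub>V\<^esub> q p"
      using q[of "k \<odot>\<^bsub>P\<^esub> p" "k \<odot>\<^bsub>V\<^esub> v"] v k p
      by (simp add: lin_smult[OF sl] lin_smult[OF f] lin_smult[OF \<rho>l])
  next
    fix p p' assume p: "p \<in> carrier P" "p' \<in> carrier P"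
    obtain v where v: "v\<in>carrier V" "f v = \<rho> p" "q p = s v" using qe[OF p(1)] by blast
    obtain v' where v': "v'\<in>carrier V" "f v' = \<rho> p'" "q p' = s v'" using qe[OF p(2)] by blast
    show "q (p \<oplus>\<^bsub>P\<^esub> p') = q p \<oplus>\<^bsub>V\<^esub> q p'"
      using q[of "p \<oplus>\<^bsub>P\<^esub> p'" "v \<oplus>\<^bsub>V\<^esub> v'"] v v' p
      by (simp add: lin_add[OF sl] lin_add[OF f] lin_add[OF \<rho>l])
  qed
  moreover have "f (q (f v)) = f v" if v: "v \<in> carrier V" for v
    using q[of "f v" v] v \<rho>(2)[of "f v"] lin_closed[OF f v] fs[OF v] by simp
  ultimately show ?thesis by blast
qed

section \<open>Free spaces\<close>

lemma free_carrier: "f \<in> carrier (free_space K X) \<longleftrightarrow>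
    (\<forall>x. f x \<in> carrier K) \<and> finite {x. f x \<noteq> \<zero>\<^bsub>K\<^esub>} \<and> {x. f x \<noteq> \<zero>\<^bsub>K\<^esub>} \<subseteq> X"
  by (simp add: free_space_def)

lemma free_simps:
  "(f \<oplus>\<^bsub>free_space K X\<^esub> g) = (\<lambda>x. f x \<oplus>\<^bsub>K\<^esub> g x)"
  "(k \<odot>\<^bsub>free_space K X\<^esub> f) = (\<lambda>x. k \<otimes>\<^bsub>K\<^esub> f x)"
  "\<zero>\<^bsub>free_space K X\<^esub> = (\<lambda>x. \<zero>\<^bsub>K\<^esub>)"
  by (simp_all add: free_space_def)

lemma vspace_free:
  assumes "field K"
  shows "vspace K (free_space K X)"
proof -
  interpret field K by fact
  have cl: "f \<oplus>\<^bsub>free_space K X\<^esub> g \<in> carrier (free_space K X)"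
    if "f \<in> carrier (free_space K X)" "g \<in> carrier (free_space K X)" for f g
  proof -
    have "{x. f x \<oplus>\<^bsub>K\<^esub> g x \<noteq> \<zero>\<^bsub>K\<^esub>} \<subseteq> {x. f x \<noteq> \<zero>\<^bsub>K\<^esub>} \<union> {x. g x \<noteq> \<zero>\<^bsub>K\<^esub>}"
      by auto
    then show ?thesis using that
      by (auto simp: free_carrier free_simps intro: finite_subset)
  qed
  have sm: "k \<odot>\<^bsub>free_space K X\<^esub> f \<in> carrier (free_space K X)"
    if "f \<in> carrier (free_space K X)" "k \<in> carrier K" for f k
  proof -
    have "{x. k \<otimes>\<^bsub>K\<^esub> f x \<noteq> \<zero>\<^bsub>K\<^esub>} \<subseteq> {x. f x \<noteq> \<zero>\<^bsub>K\<^esub>}"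
      using that by auto
    then show ?thesis using that
      by (auto simp: free_carrier free_simps intro: finite_subset)
  qed
  show ?thesis
  proof (rule vspace.intro[OF field_axioms], rule moduleI[OF is_cring])
    show "abelian_group (free_space K X)"
    proof (rule abelian_groupI)
      fix f assume f: "f \<in> carrier (free_space K X)"
      show "\<exists>g\<in>carrier (free_space K X). g \<oplus>\<^bsub>free_space K X\<^esub> f = \<zero>\<^bsub>free_space K X\<^esub>"
      proof (rule bexI)
        show "(\<ominus>\<^bsub>K\<^esub> \<one>\<^bsub>K\<^esub>) \<odot>\<^bsub>free_space K X\<^esub> f \<in> carrier (free_space K X)" by (rule sm[OF f]) simp
        show "(\<ominus>\<^bsub>K\<^esub> \<one>\<^bsub>K\<^esub>) \<odot>\<^bsub>free_space K X\<^esub> f \<oplus>\<^bsub>free_space K X\<^esub> f = \<zero>\<^bsub>free_space K X\<^esub>"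
          using f by (auto simp: free_simps free_carrier l_minus l_neg)
      qed
    qed (use cl in \<open>auto simp: free_simps free_carrier a_ac\<close>)
  qed (use sm in \<open>auto simp: free_simps free_carrier l_distr r_distr m_assoc\<close>)
qed

lemma free_gen_closed:
  assumes "field K" "x \<in> X"
  shows "free_gen K x \<in> carrier (free_space K X)"
proof -
  interpret field K by fact
  show ?thesis using assms(2) by (auto simp: free_carrier free_gen_def)
qed

lemma free_induct [consumes 2, case_names zero gen add]:
  assumes K: "field K" and f: "f \<in> carrier (free_space K X)"
    and 0: "Q \<zero>\<^bsub>free_space K X\<^esub>"
    and gen: "\<And>k x. k \<in> carrier K \<Longrightarrow> x \<in> X \<Longrightarrow> Q (k \<odot>\<^bsub>free_space K X\<^esub> free_gen K x)"
    and add: "\<And>f g. f \<in> carrier (free_space K X) \<Longrightarrow> g \<in> carrier (free_space K X) \<Longrightarrow> Q f \<Longrightarrow> Q g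
       \<Longrightarrow> Q (f \<oplus>\<^bsub>free_space K X\<^esub> g)"
  shows "Q f"
proof -
  interpret field K by fact
  interpret F: vspace K "free_space K X" by (rule vspace_free[OF K])
  have "\<forall>f. f \<in> carrier (free_space K X) \<and> {x. f x \<noteq> \<zero>\<^bsub>K\<^esub>} \<subseteq> A \<longrightarrow> Q f" if "finite A" for A
    using that
  proof (induction A)
    case empty
    have "f = \<zero>\<^bsub>free_space K X\<^esub>" if "{x. f x \<noteq> \<zero>\<^bsub>K\<^esub>} \<subseteq> {}" for f
      using that by (auto simp: free_simps)
    then show ?case using 0 by blast
  next
    case (insert a A)
    show ?case
    proof (intro allI impI, elim conjE)
      fix f assume f: "f \<in> carrier (free_space K X)" "{x. f x \<noteq> \<zero>\<^bsub>K\<^esub>} \<subseteq> insert a A"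
      show "Q f"
      proof (cases "f a = \<zero>\<^bsub>K\<^esub>")
        case True
        then have "{x. f x \<noteq> \<zero>\<^bsub>K\<^esub>} \<subseteq> A" using f(2) by blast
        then show ?thesis using insert.IH f(1) by blast
      next
        case False
        have aX: "a \<in> X" using False f(1) by (auto simp: free_carrier)
        have fa: "f a \<in> carrier K" using f(1) by (auto simp: free_carrier)
        define g where "g = f(a := \<zero>\<^bsub>K\<^esub>)"
        have "{x. g x \<noteq> \<zero>\<^bsub>K\<^esub>} \<subseteq> {x. f x \<noteq> \<zero>\<^bsub>K\<^esub>}" by (auto simp: g_def)
        then have g: "g \<in> carrier (free_space K X)" using f(1)
          unfolding free_carrier by (auto simp: g_def intro: finite_subset)
        have "{x. g x \<noteq> \<zero>\<^bsub>K\<^esub>} \<subseteq> A" using f(2) by (auto simp: g_def)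
        then have "Q g" using insert.IH g by blast
        moreover have "f = f a \<odot>\<^bsub>free_space K X\<^esub> free_gen K a \<oplus>\<^bsub>free_space K X\<^esub> g"
          using f(1) by (auto simp: free_simps free_gen_def g_def free_carrier)
        ultimately show ?thesis
          using add[OF _ g gen[OF fa aX]] F.smult_closed[OF fa free_gen_closed[OF K aX]] by metis
      qed
    qed
  qed
  then show ?thesis using f by (auto simp: free_carrier)
qed

lemma free_extend:
  assumes K: "field K" and P: "vspace K P" and \<beta>: "\<And>x. x \<in> X \<Longrightarrow> \<beta> x \<in> carrier P"
  shows "\<exists>g. lin K (free_space K X) P g \<and> (\<forall>x\<in>X. g (free_gen K x) = \<beta> x)"
proof -
  interpret P: vspace K P by (rule P)
  interpret F: vspace K "free_space K X" by (rule vspace_free[OF K])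
  define g where "g f = finsum P (\<lambda>x. f x \<odot>\<^bsub>P\<^esub> \<beta> x) {x. f x \<noteq> \<zero>\<^bsub>K\<^esub>}" for f
  \<comment> \<open>Enlarging the index set allows the supports of two summands to be replaced by their union.\<close>
  have g: "g f = finsum P (\<lambda>x. f x \<odot>\<^bsub>P\<^esub> \<beta> x) A"
    if "f \<in> carrier (free_space K X)" "finite A" "A \<subseteq> X" "{x. f x \<noteq> \<zero>\<^bsub>K\<^esub>} \<subseteq> A" for f A
    unfolding g_def
    by (rule P.M.add.finprod_mono_neutral_cong_left)
       (use that \<beta> in \<open>auto simp: free_carrier\<close>)
  have "lin K (free_space K X) P g"
  proof (rule linI)
    fix f assume f: "f \<in> carrier (free_space K X)"
    let ?A = "{x. f x \<noteq> \<zero>\<^bsub>K\<^esub>}"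
    have A: "finite ?A" "?A \<subseteq> X" "\<And>x. f x \<in> carrier K" using f by (auto simp: free_carrier)
    show "g f \<in> carrier P" unfolding g_def
      by (rule P.M.finsum_closed) (use A \<beta> in auto)
    fix k assume k: "k \<in> carrier K"
    have sub: "{x. k \<otimes>\<^bsub>K\<^esub> f x \<noteq> \<zero>\<^bsub>K\<^esub>} \<subseteq> ?A" using k by auto
    have "g (k \<odot>\<^bsub>free_space K X\<^esub> f) = finsum P (\<lambda>x. (k \<otimes>\<^bsub>K\<^esub> f x) \<odot>\<^bsub>P\<^esub> \<beta> x) ?A"
      using g[OF F.smult_closed[OF k f] A(1,2)] sub by (simp add: free_simps)
    also have "\<dots> = finsum P (\<lambda>x. k \<odot>\<^bsub>P\<^esub> (f x \<odot>\<^bsub>P\<^esub> \<beta> x)) ?A"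
      by (rule P.M.finsum_cong') (use A \<beta> k in \<open>auto simp: P.smult_assoc1 subset_iff\<close>)
    also have "\<dots> = k \<odot>\<^bsub>P\<^esub> g f" unfolding g_def
      by (rule P.finsum_smult_ldistr[symmetric]) (use A \<beta> k in auto)
    finally show "g (k \<odot>\<^bsub>free_space K X\<^esub> f) = k \<odot>\<^bsub>P\<^esub> g f" .
  next
    fix f f' assume f: "f \<in> carrier (free_space K X)" "f' \<in> carrier (free_space K X)"
    let ?A = "{x. f x \<noteq> \<zero>\<^bsub>K\<^esub>} \<union> {x. f' x \<noteq> \<zero>\<^bsub>K\<^esub>}"
    have A: "finite ?A" "?A \<subseteq> X" "\<And>x. f x \<in> carrier K" "\<And>x. f' x \<in> carrier K"
      using f by (auto simp: free_carrier)
    have sub: "{x. f x \<oplus>\<^bsub>K\<^esub> f' x \<noteq> \<zero>\<^bsub>K\<^esub>} \<subseteq> ?A" by auto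
    have "g (f \<oplus>\<^bsub>free_space K X\<^esub> f') = finsum P (\<lambda>x. (f x \<oplus>\<^bsub>K\<^esub> f' x) \<odot>\<^bsub>P\<^esub> \<beta> x) ?A"
      using g[OF F.M.a_closed[OF f] A(1,2)] sub by (simp add: free_simps)
    also have "\<dots> = finsum P (\<lambda>x. f x \<odot>\<^bsub>P\<^esub> \<beta> x \<oplus>\<^bsub>P\<^esub> f' x \<odot>\<^bsub>P\<^esub> \<beta> x) ?A"
      by (rule P.M.finsum_cong') (use A \<beta> in \<open>auto simp: P.smult_l_distr subset_iff\<close>)
    also have "\<dots> = finsum P (\<lambda>x. f x \<odot>\<^bsub>P\<^esub> \<beta> x) ?A \<oplus>\<^bsub>P\<^esub> finsum P (\<lambda>x. f' x \<odot>\<^bsub>P\<^esub> \<beta> x) ?A"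
      by (rule P.M.finsum_addf) (use A \<beta> in auto)
    also have "\<dots> = g f \<oplus>\<^bsub>P\<^esub> g f'"
      using g[OF f(1) A(1,2)] g[OF f(2) A(1,2)] by auto
    finally show "g (f \<oplus>\<^bsub>free_space K X\<^esub> f') = g f \<oplus>\<^bsub>P\<^esub> g f'" .
  qed
  moreover have "g (free_gen K x) = \<beta> x" if x: "x \<in> X" for x
  proof -
    have "g (free_gen K x) = finsum P (\<lambda>y. free_gen K x y \<odot>\<^bsub>P\<^esub> \<beta> y) {x}"
      by (rule g[OF free_gen_closed[OF K x]]) (use x in \<open>auto simp: free_gen_def\<close>)
    then show ?thesis using \<beta>[OF x] by (simp add: free_gen_def)
  qed
  ultimately show ?thesis by blast
qed

section \<open>Tensor products\<close>

definition bilin :: "('k, 'l) ring_scheme \<Rightarrow> ('k, 'v, 'm) module_scheme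
    \<Rightarrow> ('k, 'w, 'n) module_scheme \<Rightarrow> ('k, 'p, 'q) module_scheme \<Rightarrow> ('v \<Rightarrow> 'w \<Rightarrow> 'p) \<Rightarrow> bool" where
  "bilin K V W P \<beta> \<longleftrightarrow> (\<forall>v\<in>carrier V. lin K W P (\<beta> v)) \<and> (\<forall>w\<in>carrier W. lin K V P (\<lambda>v. \<beta> v w))"

context
  fixes K :: "('k, 'l) ring_scheme" and V :: "('k, 'v, 'm) module_scheme"
    and W :: "('k, 'w, 'n) module_scheme"
  assumes V: "vspace K V" and W: "vspace K W"
begin

interpretation V: vspace K V by (rule V)
interpretation W: vspace K W by (rule W)

lemma vspace_tensor_free: "vspace K (tensor_free K V W)"
  unfolding tensor_free_def by (rule vspace_free) (rule V.field_axioms)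

interpretation F: vspace K "tensor_free K V W" by (rule vspace_tensor_free)

lemma gen_closed: "v \<in> carrier V \<Longrightarrow> w \<in> carrier W \<Longrightarrow> free_gen K (v, w) \<in> carrier (tensor_free K V W)"
  unfolding tensor_free_def by (rule free_gen_closed[OF V.field_axioms]) simp

lemma tensor_rels_closed: "tensor_rels K V W \<subseteq> carrier (tensor_free K V W)"
  unfolding tensor_rels_def Let_def by (auto intro!: F.M.minus_closed F.M.a_closed F.smult_closed gen_closed)

lemma submodule_tensor_null: "submodule (tensor_null K V W) K (tensor_free K V W)"
  unfolding tensor_null_def by (rule lspan_submodule[OF vspace_tensor_free tensor_rels_closed])

lemma vspace_tens: "vspace K (tens K V W)"
  unfolding tens_def by (rule vspace_quot[OF vspace_tensor_free submodule_tensor_null])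

text \<open>
  Each generator of the relations is one instance of additivity or homogeneity in one argument.
\<close>

lemma bilin_pure: "bilin K V W (tens K V W) (pure K V W)"
proof -
  note N = vspace_tensor_free submodule_tensor_null
  have rel: "r \<in> tensor_null K V W" if "r \<in> tensor_rels K V W" for r
    unfolding tensor_null_def by (rule lspan_incl[OF that])
  show ?thesis unfolding bilin_def tens_def pure_def
  proof (intro conjI ballI linI)
    fix v w assume vw: "v \<in> carrier V" "w \<in> carrier W"
    show "tensor_null K V W +>\<^bsub>(tensor_free K V W)\<^esub> free_gen K (v, w) \<in> carrier (quot (tensor_free K V W) (tensor_null K V W))"
      "tensor_null K V W +>\<^bsub>(tensor_free K V W)\<^esub> free_gen K (v, w) \<in> carrier (quot (tensor_free K V W) (tensor_null K V W))"
      using gen_closed[OF vw] by (auto simp: quot_carrier)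
    { fix v' assume v': "v' \<in> carrier V"
      show "tensor_null K V W +>\<^bsub>(tensor_free K V W)\<^esub> free_gen K (v \<oplus>\<^bsub>V\<^esub> v', w) =
         (tensor_null K V W +>\<^bsub>(tensor_free K V W)\<^esub> free_gen K (v, w)) \<oplus>\<^bsub>quot (tensor_free K V W) (tensor_null K V W)\<^esub>
         (tensor_null K V W +>\<^bsub>(tensor_free K V W)\<^esub> free_gen K (v', w))"
        unfolding coset_add[OF N gen_closed[OF vw] gen_closed[OF v' vw(2)]]
        by (subst coset_eq_iff[OF N]; (intro rel gen_closed F.M.a_closed V.M.a_closed vw v')?)
           (use vw v' in \<open>auto simp: tensor_rels_def Let_def\<close>) }
    { fix w' assume w': "w' \<in> carrier W"
      show "tensor_null K V W +>\<^bsub>(tensor_free K V W)\<^esub> free_gen K (v, w \<oplus>\<^bsub>W\<^esub> w') =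
         (tensor_null K V W +>\<^bsub>(tensor_free K V W)\<^esub> free_gen K (v, w)) \<oplus>\<^bsub>quot (tensor_free K V W) (tensor_null K V W)\<^esub>
         (tensor_null K V W +>\<^bsub>(tensor_free K V W)\<^esub> free_gen K (v, w'))"
        unfolding coset_add[OF N gen_closed[OF vw] gen_closed[OF vw(1) w']]
        by (subst coset_eq_iff[OF N]; (intro rel gen_closed F.M.a_closed W.M.a_closed vw w')?)
           (use vw w' in \<open>auto simp: tensor_rels_def Let_def\<close>) }
    fix k assume k: "k \<in> carrier K"
    show "tensor_null K V W +>\<^bsub>(tensor_free K V W)\<^esub> free_gen K (k \<odot>\<^bsub>V\<^esub> v, w) =
       k \<odot>\<^bsub>quot (tensor_free K V W) (tensor_null K V W)\<^esub> (tensor_null K V W +>\<^bsub>(tensor_free K V W)\<^esub> free_gen K (v, w))"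
      unfolding coset_smult[OF N k gen_closed[OF vw]]
      by (subst coset_eq_iff[OF N]; (intro rel gen_closed F.smult_closed V.smult_closed vw k)?)
         (use vw k in \<open>auto simp: tensor_rels_def Let_def\<close>)
    show "tensor_null K V W +>\<^bsub>(tensor_free K V W)\<^esub> free_gen K (v, k \<odot>\<^bsub>W\<^esub> w) =
       k \<odot>\<^bsub>quot (tensor_free K V W) (tensor_null K V W)\<^esub> (tensor_null K V W +>\<^bsub>(tensor_free K V W)\<^esub> free_gen K (v, w))"
      unfolding coset_smult[OF N k gen_closed[OF vw]]
      by (subst coset_eq_iff[OF N]; (intro rel gen_closed F.smult_closed W.smult_closed vw k)?)
         (use vw k in \<open>auto simp: tensor_rels_def Let_def\<close>)
  qed
qed

lemma pure_closed: "v \<in> carrier V \<Longrightarrow> w \<in> carrier W \<Longrightarrow> pure K V W v w \<in> carrier (tens K V W)"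
  using bilin_pure lin_closed unfolding bilin_def by metis

lemma lin_pure_right: "v \<in> carrier V \<Longrightarrow> lin K W (tens K V W) (\<lambda>w. pure K V W v w)"
  using bilin_pure unfolding bilin_def by simp

lemma lin_pure_left: "w \<in> carrier W \<Longrightarrow> lin K V (tens K V W) (\<lambda>v. pure K V W v w)"
  using bilin_pure unfolding bilin_def by simp

text \<open>
  The zero tensor is pure, and scalars are absorbed into the left factor of a pure tensor, so sums
  are the only operation to be considered.
\<close>

lemma tens_induct [consumes 1, case_names pure add]:
  assumes z: "z \<in> carrier (tens K V W)"
    and p: "\<And>v w. v \<in> carrier V \<Longrightarrow> w \<in> carrier W \<Longrightarrow> Q (pure K V W v w)"
    and a: "\<And>x y. x \<in> carrier (tens K V W) \<Longrightarrow> y \<in> carrier (tens K V W) \<Longrightarrow> Q x \<Longrightarrow> Q y \<Longrightarrow>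
       Q (x \<oplus>\<^bsub>tens K V W\<^esub> y)"
  shows "Q z"
proof -
  note N = vspace_tensor_free submodule_tensor_null
  interpret T: vspace K "tens K V W" by (rule vspace_tens)
  let ?c = "\<lambda>f. tensor_null K V W +>\<^bsub>(tensor_free K V W)\<^esub> f"
  obtain f where f: "f \<in> carrier (tensor_free K V W)" "z = ?c f"
    using z by (auto simp: tens_def quot_carrier)
  have lc: "lin K (tensor_free K V W) (tens K V W) ?c" unfolding tens_def by (rule lin_coset[OF N])
  have "Q (?c f)"
    using V.field_axioms f(1)[unfolded tensor_free_def]
  proof (induction f rule: free_induct)
    case zero
    have "?c \<zero>\<^bsub>(tensor_free K V W)\<^esub> = \<zero>\<^bsub>tens K V W\<^esub>" by (rule lin_zero[OF vspace_tensor_free vspace_tens lc])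
    moreover have "pure K V W \<zero>\<^bsub>V\<^esub> \<zero>\<^bsub>W\<^esub> = \<zero>\<^bsub>tens K V W\<^esub>"
      by (rule lin_zero[OF W vspace_tens lin_pure_right]) simp
    ultimately show ?case using p[of "\<zero>\<^bsub>V\<^esub>" "\<zero>\<^bsub>W\<^esub>"] by (simp add: tensor_free_def)
  next
    case (gen k x)
    obtain v w where x: "x = (v, w)" "v \<in> carrier V" "w \<in> carrier W" using gen by auto
    have "?c (k \<odot>\<^bsub>(tensor_free K V W)\<^esub> free_gen K x) = k \<odot>\<^bsub>tens K V W\<^esub> pure K V W v w"
      using lin_smult[OF lc gen(1) gen_closed[OF x(2,3)]] x(1) by (simp add: pure_def)
    also have "\<dots> = pure K V W (k \<odot>\<^bsub>V\<^esub> v) w"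
      using lin_smult[OF lin_pure_left[OF x(3)] gen(1) x(2)] by simp
    finally show ?case using p[of "k \<odot>\<^bsub>V\<^esub> v" w] x gen(1) by (simp add: tensor_free_def)
  next
    case (add f g)
    then show ?case
      using a[OF lin_closed[OF lc] lin_closed[OF lc], of f g] lin_add[OF lc, of f g]
      by (simp add: tensor_free_def)
  qed
  then show ?thesis using f by simp
qed

lemma tens_ext:
  assumes "lin K (tens K V W) P f" "lin K (tens K V W) P g"
    and "\<And>v w. v \<in> carrier V \<Longrightarrow> w \<in> carrier W \<Longrightarrow> f (pure K V W v w) = g (pure K V W v w)"
    and "z \<in> carrier (tens K V W)"
  shows "f z = g z"
  using assms(4)
  by (induction rule: tens_induct) (simp_all add: assms(3) lin_add[OF assms(1)] lin_add[OF assms(2)])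

lemma tlift_exists:
  assumes P: "vspace K P" and b: "bilin K V W P \<beta>"
  shows "\<exists>h. lin K (tens K V W) P h \<and>
     (\<forall>v\<in>carrier V. \<forall>w\<in>carrier W. h (pure K V W v w) = \<beta> v w)"
proof -
  interpret P: vspace K P by (rule P)
  note N = vspace_tensor_free submodule_tensor_null
  have b1: "lin K W P (\<beta> v)" if "v \<in> carrier V" for v using b that by (simp add: bilin_def)
  have b2: "lin K V P (\<lambda>v. \<beta> v w)" if "w \<in> carrier W" for w using b that by (simp add: bilin_def)
  have bc: "\<beta> v w \<in> carrier P" if "v \<in> carrier V" "w \<in> carrier W" for v w
    using lin_closed[OF b1] that by simp
  obtain g0 where g0: "lin K (tensor_free K V W) P g0" "\<forall>x\<in>carrier V \<times> carrier W. g0 (free_gen K x) = case_prod \<beta> x"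
    unfolding tensor_free_def
    using free_extend[OF V.field_axioms P, of "carrier V \<times> carrier W" "case_prod \<beta>"] bc by auto
  have g: "g0 (free_gen K (v, w)) = \<beta> v w" if "v \<in> carrier V" "w \<in> carrier W" for v w
    using g0(2) that by auto
  note ga = lin_minus[OF vspace_tensor_free P g0(1)] lin_add[OF g0(1)] lin_smult[OF g0(1)]
  have "g0 r = \<zero>\<^bsub>P\<^esub>" if "r \<in> tensor_rels K V W" for r
    using that unfolding tensor_rels_def Let_def
    by (auto simp: ga gen_closed g lin_add[OF b1] lin_add[OF b2] lin_smult[OF b1] lin_smult[OF b2]
       bc minus_eq_zero_iff[OF P])
  then have z: "g0 r = \<zero>\<^bsub>P\<^esub>" if "r \<in> tensor_null K V W" for r
    using lin_lspan[OF vspace_tensor_free P g0(1) submodule_zero[OF P] tensor_rels_closed] that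
    unfolding tensor_null_def by blast
  obtain h where "lin K (tens K V W) P h" "\<forall>x\<in>carrier (tensor_free K V W). h (tensor_null K V W +>\<^bsub>(tensor_free K V W)\<^esub> x) = g0 x"
    using quot_factor[OF N P g0(1) z] unfolding tens_def by blast
  then show ?thesis using g gen_closed unfolding pure_def by metis
qed

text \<open>
  Uniqueness on pure tensors identifies the definite description behind \<^const>\<open>tlift\<close> with any
  linear map that has the prescribed values.
\<close>

lemma tens_map_the:
  assumes h: "lin K (tens K V W) P h"
     "\<And>v w. v \<in> carrier V \<Longrightarrow> w \<in> carrier W \<Longrightarrow> h (pure K V W v w) = \<beta> v w"
  shows "tlift K V W P \<beta> = restrict h (carrier (tens K V W))"
  unfolding tlift_def
proof (rule the_equality)
  show "restrict h (carrier (tens K V W)) \<in> Lin K (tens K V W) P \<and>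
    (\<forall>v\<in>carrier V. \<forall>w\<in>carrier W. restrict h (carrier (tens K V W)) (pure K V W v w) = \<beta> v w)"
    using h by (simp add: Lin_restrict[OF vspace_tens] pure_closed)
  fix g assume g: "g \<in> Lin K (tens K V W) P \<and>
    (\<forall>v\<in>carrier V. \<forall>w\<in>carrier W. g (pure K V W v w) = \<beta> v w)"
  show "g = restrict h (carrier (tens K V W))"
  proof (rule Lin_eqI[OF g[THEN conjunct1] Lin_restrict[OF vspace_tens h(1)]])
    fix z assume z: "z \<in> carrier (tens K V W)"
    then show "g z = restrict h (carrier (tens K V W)) z"
      using tens_ext[OF Lin_lin[OF g[THEN conjunct1]] h(1) _ z] g h(2) by auto
  qed
qed

lemma tlift_Lin:
  assumes P: "vspace K P" and b: "bilin K V W P \<beta>"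
  shows "tlift K V W P \<beta> \<in> Lin K (tens K V W) P"
  using tlift_exists[OF P b] tens_map_the Lin_restrict[OF vspace_tens] by metis

lemma tlift_pure:
  assumes P: "vspace K P" and b: "bilin K V W P \<beta>" and vw: "v \<in> carrier V" "w \<in> carrier W"
  shows "tlift K V W P \<beta> (pure K V W v w) = \<beta> v w"
proof -
  obtain h where h: "lin K (tens K V W) P h"
     "\<And>v w. v \<in> carrier V \<Longrightarrow> w \<in> carrier W \<Longrightarrow> h (pure K V W v w) = \<beta> v w"
    using tlift_exists[OF P b] by blast
  have "tlift K V W P \<beta> = restrict h (carrier (tens K V W))"
    using tens_map_the[OF h] by blast
  then show ?thesis using h(2)[OF vw] pure_closed[OF vw] by simp
qed

end

lemma bilinI:
  assumes "\<And>v. v \<in> carrier V \<Longrightarrow> lin K W P (\<lambda>w. \<beta> v w)" "\<And>w. w \<in> carrier W \<Longrightarrow> lin K V P (\<lambda>v. \<beta> v w)"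
  shows "bilin K V W P \<beta>"
  using assms by (simp add: bilin_def)

context
  fixes K :: "('k, 'l) ring_scheme" and V :: "('k, 'v, 'm) module_scheme"
    and W :: "('k, 'w, 'n) module_scheme" and V' :: "('k, 'v', 'm') module_scheme"
    and W' :: "('k, 'w', 'n') module_scheme" and f g
  assumes V: "vspace K V" and W: "vspace K W" and V': "vspace K V'" and W': "vspace K W'"
    and f: "lin K V V' f" and g: "lin K W W' g"
begin

lemma bilin_tmap: "bilin K V W (tens K V' W') (\<lambda>v w. pure K V' W' (f v) (g w))"
  by (intro bilinI lin_comp[OF lin_pure_left f] lin_comp[OF lin_pure_right g] V' W'
        lin_closed[OF f] lin_closed[OF g])

lemma tmap_Lin: "tmap K V W V' W' f g \<in> Lin K (tens K V W) (tens K V' W')"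
  unfolding tmap_def by (rule tlift_Lin[OF V W vspace_tens[OF V' W'] bilin_tmap])

lemma lin_tmap: "lin K (tens K V W) (tens K V' W') (tmap K V W V' W' f g)"
  by (rule Lin_lin[OF tmap_Lin])

lemma tmap_pure: "v \<in> carrier V \<Longrightarrow> w \<in> carrier W \<Longrightarrow>
   tmap K V W V' W' f g (pure K V W v w) = pure K V' W' (f v) (g w)"
  unfolding tmap_def by (rule tlift_pure[OF V W vspace_tens[OF V' W'] bilin_tmap])

end

text \<open>
  Naturality in pointwise form: commuting squares for both factors give a commuting square of tensor
  products. No composite has to be formed as an extensional map.
\<close>

lemma tmap_square:
  assumes sp: "vspace K V" "vspace K W" "vspace K V1" "vspace K W1" "vspace K V2" "vspace K W2"
      "vspace K V3" "vspace K W3"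
    and f: "lin K V V1 f" and g: "lin K W W1 g" and f': "lin K V1 V3 f'" and g': "lin K W1 W3 g'"
    and h: "lin K V V2 h" and k: "lin K W W2 k" and h': "lin K V2 V3 h'" and k': "lin K W2 W3 k'"
    and "\<And>v. v \<in> carrier V \<Longrightarrow> f' (f v) = h' (h v)"
    and "\<And>w. w \<in> carrier W \<Longrightarrow> g' (g w) = k' (k w)"
    and z: "z \<in> carrier (tens K V W)"
  shows "tmap K V1 W1 V3 W3 f' g' (tmap K V W V1 W1 f g z) =
         tmap K V2 W2 V3 W3 h' k' (tmap K V W V2 W2 h k z)"
  by (rule tens_ext[OF sp(1,2) lin_comp[OF lin_tmap lin_tmap] lin_comp[OF lin_tmap lin_tmap] _ z];
      (rule assms)?)
     (simp add: tmap_pure[OF sp(1,2,3,4) f g] tmap_pure[OF sp(1,2,5,6) h k]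
       tmap_pure[OF sp(3,4,7,8) f' g'] tmap_pure[OF sp(5,6,7,8) h' k'] lin_closed[OF f]
       lin_closed[OF g] lin_closed[OF h] lin_closed[OF k] assms(17,18))

lemma tmap_comp:
  assumes sp: "vspace K V" "vspace K W" "vspace K V1" "vspace K W1" 
      "vspace K V3" "vspace K W3"
    and f: "lin K V V1 f" and g: "lin K W W1 g" and f': "lin K V1 V3 f'" and g': "lin K W1 W3 g'"
    and h: "lin K V V3 h" and k: "lin K W W3 k" 
    and "\<And>v. v \<in> carrier V \<Longrightarrow> f' (f v) = h v"
    and "\<And>w. w \<in> carrier W \<Longrightarrow> g' (g w) = k w"
    and z: "z \<in> carrier (tens K V W)"
  shows "tmap K V1 W1 V3 W3 f' g' (tmap K V W V1 W1 f g z) = tmap K V W V3 W3 h k z"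
  by (rule tens_ext[OF sp(1,2) lin_comp[OF lin_tmap lin_tmap] lin_tmap _ z];
      (rule assms)?)
     (simp add: tmap_pure[OF sp(1,2,3,4) f g] tmap_pure[OF sp(1,2,5,6) h k]
       tmap_pure[OF sp(3,4,5,6) f' g'] lin_closed[OF f]
       lin_closed[OF g] assms(13,14))

lemma tmap_id:
  assumes V: "vspace K V" and W: "vspace K W" and f: "lin K V V f" and g: "lin K W W g"
    and e: "\<And>v. v \<in> carrier V \<Longrightarrow> f v = v" "\<And>w. w \<in> carrier W \<Longrightarrow> g w = w"
    and z: "z \<in> carrier (tens K V W)"
  shows "tmap K V W V W f g z = z"
  by (rule tens_ext[OF V W lin_tmap[OF V W V W f g] lin_ident _ z])
     (simp add: tmap_pure[OF V W V W f g] e)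

lemma tmap_surj:
  assumes sp: "vspace K V" "vspace K W" "vspace K V1" "vspace K W1"
    and f: "lin K V V1 f" and g: "lin K W W1 g"
    and fs: "f ` carrier V = carrier V1" and gs: "g ` carrier W = carrier W1"
  shows "tmap K V W V1 W1 f g ` carrier (tens K V W) = carrier (tens K V1 W1)"
proof
  note lt = lin_tmap[OF sp f g]
  show "tmap K V W V1 W1 f g ` carrier (tens K V W) \<subseteq> carrier (tens K V1 W1)"
    using lin_closed[OF lt] by blast
  show "carrier (tens K V1 W1) \<subseteq> tmap K V W V1 W1 f g ` carrier (tens K V W)"
  proof
    interpret T: vspace K "tens K V W" by (rule vspace_tens[OF sp(1,2)])
    fix z assume "z \<in> carrier (tens K V1 W1)"
    then show "z \<in> tmap K V W V1 W1 f g ` carrier (tens K V W)"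
    proof (induction rule: tens_induct[OF sp(3,4), consumes 1, case_names pure add])
      case (pure v w)
      then obtain v0 w0 where "v0 \<in> carrier V" "w0 \<in> carrier W" "v = f v0" "w = g w0"
        using fs gs by blast
      then show ?case using tmap_pure[OF sp f g] pure_closed[OF sp(1,2)] by (metis imageI)
    next
      case (add x y)
      then obtain x0 y0 where "x0 \<in> carrier (tens K V W)" "y0 \<in> carrier (tens K V W)"
         "x = tmap K V W V1 W1 f g x0" "y = tmap K V W V1 W1 f g y0" by blast
      then show ?case using lin_add[OF lt, of x0 y0] T.M.a_closed by (metis imageI)
    qed
  qed
qed

section \<open>Associativity and unit isomorphisms\<close>

lemma tens_ext3_left:
  assumes U: "vspace K U" and V: "vspace K V" and W: "vspace K W"
    and f: "lin K (tens K (tens K U V) W) P f" and g: "lin K (tens K (tens K U V) W) P g"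
    and e: "\<And>u v w. u \<in> carrier U \<Longrightarrow> v \<in> carrier V \<Longrightarrow> w \<in> carrier W \<Longrightarrow>
       f (pure K (tens K U V) W (pure K U V u v) w) = g (pure K (tens K U V) W (pure K U V u v) w)"
    and z: "z \<in> carrier (tens K (tens K U V) W)"
  shows "f z = g z"
proof (rule tens_ext[OF vspace_tens[OF U V] W f g _ z])
  fix x w assume x: "x \<in> carrier (tens K U V)" and w: "w \<in> carrier W"
  note l = lin_pure_left[OF vspace_tens[OF U V] W w]
  show "f (pure K (tens K U V) W x w) = g (pure K (tens K U V) W x w)"
    by (rule tens_ext[OF U V lin_comp[OF f l] lin_comp[OF g l] _ x]) (rule e[OF _ _ w])
qed

lemma tens_ext3_right:
  assumes U: "vspace K U" and V: "vspace K V" and W: "vspace K W"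
    and f: "lin K (tens K U (tens K V W)) P f" and g: "lin K (tens K U (tens K V W)) P g"
    and e: "\<And>u v w. u \<in> carrier U \<Longrightarrow> v \<in> carrier V \<Longrightarrow> w \<in> carrier W \<Longrightarrow>
       f (pure K U (tens K V W) u (pure K V W v w)) = g (pure K U (tens K V W) u (pure K V W v w))"
    and z: "z \<in> carrier (tens K U (tens K V W))"
  shows "f z = g z"
proof (rule tens_ext[OF U vspace_tens[OF V W] f g _ z])
  fix u x assume u: "u \<in> carrier U" and x: "x \<in> carrier (tens K V W)"
  note l = lin_pure_right[OF U vspace_tens[OF V W] u]
  show "f (pure K U (tens K V W) u x) = g (pure K U (tens K V W) u x)"
    by (rule tens_ext[OF V W lin_comp[OF f l] lin_comp[OF g l] _ x]) (rule e[OF u])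
qed

context
  fixes K :: "('k, 'l) ring_scheme" and U :: "('k, 'u, 'm) module_scheme"
    and V :: "('k, 'v, 'n) module_scheme" and W :: "('k, 'w, 'p) module_scheme"
  assumes U: "vspace K U" and V: "vspace K V" and W: "vspace K W"
begin

lemma vspace_tens_left: "vspace K (tens K (tens K U V) W)" and vspace_tens_right: "vspace K (tens K U (tens K V W))"
  by (intro vspace_tens U V W)+

text \<open>
  For fixed \<open>w\<close>, the bilinear map \<open>(u, v) \<mapsto> u \<otimes> (v \<otimes> w)\<close> lifts to \<open>U \<otimes> V\<close>. The lifts depend
  linearly on \<open>w\<close>, so that they form a bilinear map on \<open>U \<otimes> V\<close> and \<open>W\<close>, which lifts again.
\<close>

lemma asc_exists: "\<exists>h. lin K (tens K (tens K U V) W) (tens K U (tens K V W)) h \<and>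
     (\<forall>u\<in>carrier U. \<forall>v\<in>carrier V. \<forall>w\<in>carrier W.
        h (pure K (tens K U V) W (pure K U V u v) w) =
        pure K U (tens K V W) u (pure K V W v w))"
proof -
  note VW = vspace_tens[OF V W] and UV = vspace_tens[OF U V]
  define \<gamma> where "\<gamma> w u v = pure K U (tens K V W) u (pure K V W v w)" for w u v
  have b: "bilin K U V (tens K U (tens K V W)) (\<gamma> w)" if w: "w \<in> carrier W" for w
    unfolding \<gamma>_def
    by (intro bilinI lin_comp[OF lin_pure_right[OF U VW] lin_pure_left[OF V W w]]
        lin_pure_left[OF U VW] pure_closed[OF V W] w)
  define \<beta> where "\<beta> z w = tlift K U V (tens K U (tens K V W)) (\<gamma> w) z" for z w
  note l = Lin_lin[OF tlift_Lin[OF U V vspace_tens_right b]]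
  note pr = tlift_pure[OF U V vspace_tens_right b]
  have gw: "lin K W (tens K U (tens K V W)) (\<lambda>w. \<gamma> w u v)" if "u \<in> carrier U" "v \<in> carrier V" for u v
    unfolding \<gamma>_def
    by (intro lin_comp[OF lin_pure_right[OF U VW] lin_pure_right[OF V W]] that)
  have "bilin K (tens K U V) W (tens K U (tens K V W)) \<beta>"
  proof (rule bilinI)
    fix w assume w: "w \<in> carrier W"
    show "lin K (tens K U V) (tens K U (tens K V W)) (\<lambda>z. \<beta> z w)" unfolding \<beta>_def by (rule l[OF w])
  next
    interpret R: vspace K "tens K U (tens K V W)" by (rule vspace_tens_right)
    interpret W: vspace K W by (rule W)
    fix z assume z: "z \<in> carrier (tens K U V)"
    show "lin K W (tens K U (tens K V W)) (\<lambda>w. \<beta> z w)"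
    proof (rule linI)
      fix w assume w: "w \<in> carrier W"
      show "\<beta> z w \<in> carrier (tens K U (tens K V W))" unfolding \<beta>_def by (rule lin_closed[OF l[OF w] z])
      fix k assume k: "k \<in> carrier K"
      show "\<beta> z (k \<odot>\<^bsub>W\<^esub> w) = k \<odot>\<^bsub>(tens K U (tens K V W))\<^esub> \<beta> z w" unfolding \<beta>_def
        by (rule tens_ext[OF U V l[OF W.smult_closed[OF k w]]
              lin_scale[OF UV vspace_tens_right l[OF w] k] _ z])
           (simp add: pr w k lin_smult[OF gw])
    next
      fix w w' assume w: "w \<in> carrier W" and w': "w' \<in> carrier W"
      show "\<beta> z (w \<oplus>\<^bsub>W\<^esub> w') = \<beta> z w \<oplus>\<^bsub>(tens K U (tens K V W))\<^esub> \<beta> z w'" unfolding \<beta>_def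
        by (rule tens_ext[OF U V l[OF W.M.a_closed[OF w w']]
              lin_plus[OF UV vspace_tens_right l[OF w] l[OF w']] _ z])
           (simp add: pr w w' lin_add[OF gw])
    qed
  qed
  from tlift_exists[OF UV W vspace_tens_right this]
  obtain h where h: "lin K (tens K (tens K U V) W) (tens K U (tens K V W)) h" "\<And>z w. z \<in> carrier (tens K U V) \<Longrightarrow> w \<in> carrier W \<Longrightarrow>
       h (pure K (tens K U V) W z w) = \<beta> z w" by blast
  show ?thesis
    by (rule exI[of _ h]) (simp add: h(1) h(2)[OF pure_closed[OF U V]] \<beta>_def pr \<gamma>_def)
qed

text \<open>
  The same double lift, starting from the right.
\<close>

lemma asc_inv_exists: "\<exists>h. lin K (tens K U (tens K V W)) (tens K (tens K U V) W) h \<and>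
     (\<forall>u\<in>carrier U. \<forall>v\<in>carrier V. \<forall>w\<in>carrier W.
        h (pure K U (tens K V W) u (pure K V W v w)) =
        pure K (tens K U V) W (pure K U V u v) w)"
proof -
  note VW = vspace_tens[OF V W] and UV = vspace_tens[OF U V]
  define \<gamma> where "\<gamma> u v w = pure K (tens K U V) W (pure K U V u v) w" for w u v
  have b: "bilin K V W (tens K (tens K U V) W) (\<gamma> u)" if w: "u \<in> carrier U" for u
    unfolding \<gamma>_def
    by (intro bilinI lin_comp[OF lin_pure_left[OF UV W] lin_pure_right[OF U V w]]
        lin_pure_right[OF UV W] pure_closed[OF U V] w)
  define \<beta> where "\<beta> u z = tlift K V W (tens K (tens K U V) W) (\<gamma> u) z" for z u
  note l = Lin_lin[OF tlift_Lin[OF V W vspace_tens_left b]]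
  note pr = tlift_pure[OF V W vspace_tens_left b]
  have gw: "lin K U (tens K (tens K U V) W) (\<lambda>u. \<gamma> u v w)" if "v \<in> carrier V" "w \<in> carrier W" for v w
    unfolding \<gamma>_def
    by (intro lin_comp[OF lin_pure_left[OF UV W] lin_pure_left[OF U V]] that)
  have "bilin K U (tens K V W) (tens K (tens K U V) W) \<beta>"
  proof (rule bilinI)
    fix w assume w: "w \<in> carrier U"
    show "lin K (tens K V W) (tens K (tens K U V) W) (\<lambda>z. \<beta> w z)" unfolding \<beta>_def by (rule l[OF w])
  next
    interpret R: vspace K "tens K (tens K U V) W" by (rule vspace_tens_left)
    interpret W: vspace K U by (rule U)
    fix z assume z: "z \<in> carrier (tens K V W)"
    show "lin K U (tens K (tens K U V) W) (\<lambda>w. \<beta> w z)"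
    proof (rule linI)
      fix w assume w: "w \<in> carrier U"
      show "\<beta> w z \<in> carrier (tens K (tens K U V) W)" unfolding \<beta>_def by (rule lin_closed[OF l[OF w] z])
      fix k assume k: "k \<in> carrier K"
      show "\<beta> (k \<odot>\<^bsub>U\<^esub> w) z = k \<odot>\<^bsub>(tens K (tens K U V) W)\<^esub> \<beta> w z" unfolding \<beta>_def
        by (rule tens_ext[OF V W l[OF W.smult_closed[OF k w]]
              lin_scale[OF VW vspace_tens_left l[OF w] k] _ z])
           (simp add: pr w k lin_smult[OF gw])
    next
      fix w w' assume w: "w \<in> carrier U" and w': "w' \<in> carrier U"
      show "\<beta> (w \<oplus>\<^bsub>U\<^esub> w') z = \<beta> w z \<oplus>\<^bsub>(tens K (tens K U V) W)\<^esub> \<beta> w' z" unfolding \<beta>_def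
        by (rule tens_ext[OF V W l[OF W.M.a_closed[OF w w']]
              lin_plus[OF VW vspace_tens_left l[OF w] l[OF w']] _ z])
           (simp add: pr w w' lin_add[OF gw])
    qed
  qed
  from tlift_exists[OF U VW vspace_tens_left this]
  obtain h where h: "lin K (tens K U (tens K V W)) (tens K (tens K U V) W) h" "\<And>u z. u \<in> carrier U \<Longrightarrow> z \<in> carrier (tens K V W) \<Longrightarrow>
       h (pure K U (tens K V W) u z) = \<beta> u z" by blast
  show ?thesis
    by (rule exI[of _ h]) (simp add: h(1) h(2)[OF _ pure_closed[OF V W]] \<beta>_def pr \<gamma>_def)
qed

lemma asc_Lin: "asc K U V W \<in> Lin K (tens K (tens K U V) W) (tens K U (tens K V W))" (is ?A)
  and asc_pure: "u \<in> carrier U \<Longrightarrow> v \<in> carrier V \<Longrightarrow> w \<in> carrier W \<Longrightarrow>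
        asc K U V W (pure K (tens K U V) W (pure K U V u v) w) =
        pure K U (tens K V W) u (pure K V W v w)" (is "PROP ?B")
proof -
  let ?Q = "\<lambda>h. h \<in> Lin K (tens K (tens K U V) W) (tens K U (tens K V W)) \<and> (\<forall>u\<in>carrier U. \<forall>v\<in>carrier V. \<forall>w\<in>carrier W.
        h (pure K (tens K U V) W (pure K U V u v) w) = pure K U (tens K V W) u (pure K V W v w))"
  obtain h where h: "lin K (tens K (tens K U V) W) (tens K U (tens K V W)) h" "\<forall>u\<in>carrier U. \<forall>v\<in>carrier V. \<forall>w\<in>carrier W.
        h (pure K (tens K U V) W (pure K U V u v) w) = pure K U (tens K V W) u (pure K V W v w)"
    using asc_exists by blast
  have q: "?Q (restrict h (carrier (tens K (tens K U V) W)))"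
    using h(2) by (simp add: Lin_restrict[OF vspace_tens_left h(1)] pure_closed[OF vspace_tens[OF U V] W]
       pure_closed[OF U V])
  have "asc K U V W = restrict h (carrier (tens K (tens K U V) W))" unfolding asc_def
  proof (rule the_equality[of ?Q, OF q])
    fix g assume g: "?Q g"
    show "g = restrict h (carrier (tens K (tens K U V) W))"
      by (rule Lin_eqI[OF conjunct1[OF g] conjunct1[OF q]], rule tens_ext3_left[OF U V W
          Lin_lin[OF conjunct1[OF g]] Lin_lin[OF conjunct1[OF q]]])
         (use conjunct2[OF g] conjunct2[OF q] in auto)
  qed
  then show ?A "PROP ?B" using q by auto
qed

lemma lin_asc: "lin K (tens K (tens K U V) W) (tens K U (tens K V W)) (asc K U V W)"
  by (rule Lin_lin[OF asc_Lin])

lemma asc_inv_Lin: "asc_inv K U V W \<in> Lin K (tens K U (tens K V W)) (tens K (tens K U V) W)" (is ?A)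
  and asc_inv_pure: "u \<in> carrier U \<Longrightarrow> v \<in> carrier V \<Longrightarrow> w \<in> carrier W \<Longrightarrow>
        asc_inv K U V W (pure K U (tens K V W) u (pure K V W v w)) =
        pure K (tens K U V) W (pure K U V u v) w" (is "PROP ?B")
proof -
  let ?Q = "\<lambda>h. h \<in> Lin K (tens K U (tens K V W)) (tens K (tens K U V) W) \<and> (\<forall>u\<in>carrier U. \<forall>v\<in>carrier V. \<forall>w\<in>carrier W.
        h (pure K U (tens K V W) u (pure K V W v w)) = pure K (tens K U V) W (pure K U V u v) w)"
  obtain h where h: "lin K (tens K U (tens K V W)) (tens K (tens K U V) W) h" "\<forall>u\<in>carrier U. \<forall>v\<in>carrier V. \<forall>w\<in>carrier W.
        h (pure K U (tens K V W) u (pure K V W v w)) = pure K (tens K U V) W (pure K U V u v) w"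
    using asc_inv_exists by blast
  have q: "?Q (restrict h (carrier (tens K U (tens K V W))))"
    using h(2) by (simp add: Lin_restrict[OF vspace_tens_right h(1)] pure_closed[OF U vspace_tens[OF V W]]
       pure_closed[OF V W])
  have "asc_inv K U V W = restrict h (carrier (tens K U (tens K V W)))" unfolding asc_inv_def
  proof (rule the_equality[of ?Q, OF q])
    fix g assume g: "?Q g"
    show "g = restrict h (carrier (tens K U (tens K V W)))"
      by (rule Lin_eqI[OF conjunct1[OF g] conjunct1[OF q]], rule tens_ext3_right[OF U V W
          Lin_lin[OF conjunct1[OF g]] Lin_lin[OF conjunct1[OF q]]])
         (use conjunct2[OF g] conjunct2[OF q] in auto)
  qed
  then show ?A "PROP ?B" using q by auto
qed

lemma lin_asc_inv: "lin K (tens K U (tens K V W)) (tens K (tens K U V) W) (asc_inv K U V W)"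
  by (rule Lin_lin[OF asc_inv_Lin])

lemma asc_inv_asc: "z \<in> carrier (tens K (tens K U V) W) \<Longrightarrow> asc_inv K U V W (asc K U V W z) = z"
  by (rule tens_ext3_left[OF U V W lin_comp[OF lin_asc_inv lin_asc] lin_ident])
     (simp_all add: asc_pure asc_inv_pure)

lemma asc_asc_inv: "z \<in> carrier (tens K U (tens K V W)) \<Longrightarrow> asc K U V W (asc_inv K U V W z) = z"
  by (rule tens_ext3_right[OF U V W lin_comp[OF lin_asc lin_asc_inv] lin_ident])
     (simp_all add: asc_pure asc_inv_pure)

end

lemma asc_natural:
  assumes sp: "vspace K U" "vspace K V" "vspace K W" "vspace K U1" "vspace K V1" "vspace K W1"
    and f: "lin K U U1 f" and g: "lin K V V1 g" and h: "lin K W W1 h"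
    and z: "z \<in> carrier (tens K (tens K U V) W)"
  shows "asc K U1 V1 W1 (tmap K (tens K U V) W (tens K U1 V1) W1 (tmap K U V U1 V1 f g) h z) =
     tmap K U (tens K V W) U1 (tens K V1 W1) f (tmap K V W V1 W1 g h) (asc K U V W z)"
proof -
  note t = vspace_tens[OF sp(1,2)] vspace_tens[OF sp(4,5)] vspace_tens[OF sp(2,3)] vspace_tens[OF sp(5,6)]
  note fg = lin_tmap[OF sp(1,2,4,5) f g] and gh = lin_tmap[OF sp(2,3,5,6) g h]
  show ?thesis
    by (rule tens_ext3_left[OF sp(1,2,3) lin_comp[OF lin_asc[OF sp(4,5,6)] lin_tmap[OF t(1) sp(3) t(2) sp(6) fg h]]
         lin_comp[OF lin_tmap[OF sp(1) t(3) sp(4) t(4) f gh] lin_asc[OF sp(1,2,3)]] _ z])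
       (simp add: tmap_pure[OF t(1) sp(3) t(2) sp(6) fg h] tmap_pure[OF sp(1) t(3) sp(4) t(4) f gh]
         tmap_pure[OF sp(1,2,4,5) f g] tmap_pure[OF sp(2,3,5,6) g h] pure_closed sp
         asc_pure lin_closed[OF f] lin_closed[OF g] lin_closed[OF h])
qed

lemma asc_inv_natural:
  assumes sp: "vspace K U" "vspace K V" "vspace K W" "vspace K U1" "vspace K V1" "vspace K W1"
    and f: "lin K U U1 f" and g: "lin K V V1 g" and h: "lin K W W1 h"
    and z: "z \<in> carrier (tens K U (tens K V W))"
  shows "asc_inv K U1 V1 W1 (tmap K U (tens K V W) U1 (tens K V1 W1) f (tmap K V W V1 W1 g h) z) =
     tmap K (tens K U V) W (tens K U1 V1) W1 (tmap K U V U1 V1 f g) h (asc_inv K U V W z)"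
proof -
  note t = vspace_tens[OF sp(1,2)] vspace_tens[OF sp(4,5)] vspace_tens[OF sp(2,3)] vspace_tens[OF sp(5,6)]
  note fg = lin_tmap[OF sp(1,2,4,5) f g] and gh = lin_tmap[OF sp(2,3,5,6) g h]
  show ?thesis
    by (rule tens_ext3_right[OF sp(1,2,3) lin_comp[OF lin_asc_inv[OF sp(4,5,6)] lin_tmap[OF sp(1) t(3) sp(4) t(4) f gh]]
         lin_comp[OF lin_tmap[OF t(1) sp(3) t(2) sp(6) fg h] lin_asc_inv[OF sp(1,2,3)]] _ z])
       (simp add: tmap_pure[OF t(1) sp(3) t(2) sp(6) fg h] tmap_pure[OF sp(1) t(3) sp(4) t(4) f gh]
         tmap_pure[OF sp(1,2,4,5) f g] tmap_pure[OF sp(2,3,5,6) g h] pure_closed sp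
         asc_inv_pure lin_closed[OF f] lin_closed[OF g] lin_closed[OF h])
qed

lemma self_simps:
  "carrier (self K) = carrier K" "add (self K) = add K" "smult (self K) = mult K" "zero (self K) = zero K"
  by (simp_all add: self_def)

lemma vspace_self: assumes "field K" shows "vspace K (self K)"
proof -
  interpret field K by fact
  show ?thesis
  proof (rule vspace.intro[OF field_axioms], rule moduleI[OF is_cring])
    show "abelian_group (self K)"
    proof (rule abelian_groupI)
      fix x assume "x \<in> carrier (self K)"
      then show "\<exists>y\<in>carrier (self K). y \<oplus>\<^bsub>self K\<^esub> x = \<zero>\<^bsub>self K\<^esub>"
        by (intro bexI[of _ "\<ominus>\<^bsub>K\<^esub> x"]) (auto simp: self_simps l_neg)
    qed (auto simp: self_simps a_ac)
  qed (auto simp: self_simps l_distr r_distr m_assoc)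
qed

context
  fixes K :: "('k, 'l) ring_scheme" and V :: "('k, 'v, 'n) module_scheme"
  assumes V: "vspace K V"
begin

interpretation K: field K by (rule vspace_field[OF V])
interpretation V: vspace K V by (rule V)

lemma vspace_selfK: "vspace K (self K)"
  by (rule vspace_self[OF K.field_axioms])

lemma bilin_lunit: "bilin K (self K) V V (\<lambda>k v. k \<odot>\<^bsub>V\<^esub> v)"
  by (intro bilinI linI) (auto simp: self_simps V.smult_l_distr V.smult_r_distr
     V.smult_assoc1[symmetric] K.m_comm)

lemma bilin_runit: "bilin K V (self K) V (\<lambda>v k. k \<odot>\<^bsub>V\<^esub> v)"
  by (intro bilinI linI) (auto simp: self_simps V.smult_l_distr V.smult_r_distr
     V.smult_assoc1[symmetric] K.m_comm)

lemma lin_lunit: "lin K (tens K (self K) V) V (lunit K V)"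
  unfolding lunit_def by (rule Lin_lin[OF tlift_Lin[OF vspace_selfK V V bilin_lunit]])

lemma lin_runit: "lin K (tens K V (self K)) V (runit K V)"
  unfolding runit_def by (rule Lin_lin[OF tlift_Lin[OF V vspace_selfK V bilin_runit]])

lemma lunit_pure: "k \<in> carrier K \<Longrightarrow> v \<in> carrier V \<Longrightarrow> lunit K V (pure K (self K) V k v) = k \<odot>\<^bsub>V\<^esub> v"
  unfolding lunit_def by (rule tlift_pure[OF vspace_selfK V V bilin_lunit]) (simp_all add: self_simps)

lemma runit_pure: "k \<in> carrier K \<Longrightarrow> v \<in> carrier V \<Longrightarrow> runit K V (pure K V (self K) v k) = k \<odot>\<^bsub>V\<^esub> v"
  unfolding runit_def by (rule tlift_pure[OF V vspace_selfK V bilin_runit]) (simp_all add: self_simps)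

end

text \<open>
  The map \<open>x \<otimes> y \<mapsto> e(x) y\<close> is natural with respect to \<open>f\<close> if \<open>f\<close> preserves the functional \<open>e\<close>;
  for counits this transfers the counit axioms.
\<close>

lemma lunit_natural:
  assumes V: "vspace K V" and W: "vspace K W" and f: "lin K V W f"
    and e: "lin K V (self K) e" and e': "lin K W (self K) e'" and ee: "\<And>v. v \<in> carrier V \<Longrightarrow> e' (f v) = e v"
    and z: "z \<in> carrier (tens K V V)"
  shows "lunit K W (tmap K W W (self K) W e' (idm W) (tmap K V V W W f f z)) =
         f (lunit K V (tmap K V V (self K) V e (idm V) z))"
proof -
  note s = vspace_selfK[OF V] and lw = lin_idm[OF W] and lv = lin_idm[OF V]
  show ?thesis
    by (rule tens_ext[OF V V lin_comp[OF lin_lunit[OF W] lin_comp[OF lin_tmap[OF W W s W e' lw] lin_tmap[OF V V W W f f]]]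
       lin_comp[OF f lin_comp[OF lin_lunit[OF V] lin_tmap[OF V V s V e lv]]] _ z])
     (use lin_closed[OF e] lin_closed[OF f] in \<open>simp add: tmap_pure[OF W W s W e' lw] tmap_pure[OF V V W W f f]
        tmap_pure[OF V V s V e lv] lunit_pure[OF V] lunit_pure[OF W] idm_apply ee self_simps lin_smult[OF f]\<close>)
qed

lemma runit_natural:
  assumes V: "vspace K V" and W: "vspace K W" and f: "lin K V W f"
    and e: "lin K V (self K) e" and e': "lin K W (self K) e'" and ee: "\<And>v. v \<in> carrier V \<Longrightarrow> e' (f v) = e v"
    and z: "z \<in> carrier (tens K V V)"
  shows "runit K W (tmap K W W W (self K) (idm W) e' (tmap K V V W W f f z)) =
         f (runit K V (tmap K V V V (self K) (idm V) e z))"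
proof -
  note s = vspace_selfK[OF V] and lw = lin_idm[OF W] and lv = lin_idm[OF V]
  show ?thesis
    by (rule tens_ext[OF V V lin_comp[OF lin_runit[OF W] lin_comp[OF lin_tmap[OF W W W s lw e'] lin_tmap[OF V V W W f f]]]
       lin_comp[OF f lin_comp[OF lin_runit[OF V] lin_tmap[OF V V V s lv e]]] _ z])
     (use lin_closed[OF e] lin_closed[OF f] in \<open>simp add: tmap_pure[OF W W W s lw e'] tmap_pure[OF V V W W f f]
        tmap_pure[OF V V V s lv e] runit_pure[OF V] runit_pure[OF W] idm_apply ee self_simps lin_smult[OF f]\<close>)
qed

section \<open>Subspaces of tensor products\<close>

text \<open>
  The image of \<open>X \<otimes> Y\<close> in \<open>V \<otimes> W\<close>, presented by generators so that linear maps can be followed on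
  pure tensors; see \<open>tsub_tspan\<close> for the comparison with \<^const>\<open>tsub\<close>.
\<close>

definition tspan :: "('k, 'l) ring_scheme \<Rightarrow> ('k, 'v, 'm) module_scheme
    \<Rightarrow> ('k, 'w, 'n) module_scheme \<Rightarrow> 'v set \<Rightarrow> 'w set \<Rightarrow> ('v \<times> 'w \<Rightarrow> 'k) set set" where
  "tspan K V W X Y = lspan K (tens K V W) {pure K V W x y | x y. x \<in> X \<and> y \<in> Y}"

lemma tspan_gens_closed:
  assumes "vspace K V" "vspace K W" "X \<subseteq> carrier V" "Y \<subseteq> carrier W"
  shows "{pure K V W x y | x y. x \<in> X \<and> y \<in> Y} \<subseteq> carrier (tens K V W)"
  by (auto intro!: pure_closed[OF assms(1,2)] subsetD[OF assms(3)] subsetD[OF assms(4)])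

lemma submodule_tspan:
  "vspace K V \<Longrightarrow> vspace K W \<Longrightarrow> X \<subseteq> carrier V \<Longrightarrow> Y \<subseteq> carrier W \<Longrightarrow>
    submodule (tspan K V W X Y) K (tens K V W)"
  unfolding tspan_def by (rule lspan_submodule[OF vspace_tens tspan_gens_closed])

lemma pure_tspan: "x \<in> X \<Longrightarrow> y \<in> Y \<Longrightarrow> pure K V W x y \<in> tspan K V W X Y"
  unfolding tspan_def by (rule lspan_incl) blast

lemma lin_tspan:
  assumes "vspace K V" "vspace K W" "vspace K P" "X \<subseteq> carrier V" "Y \<subseteq> carrier W"
    and "lin K (tens K V W) P f" "submodule H K P"
    and "\<And>x y. x \<in> X \<Longrightarrow> y \<in> Y \<Longrightarrow> f (pure K V W x y) \<in> H"
    and "z \<in> tspan K V W X Y"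
  shows "f z \<in> H"
  by (rule lin_lspan[OF vspace_tens[OF assms(1,2)] assms(3,6,7) tspan_gens_closed[OF assms(1,2,4,5)]
        _ assms(9)[unfolded tspan_def]]) (use assms(8) in blast)

lemma lin_tens_into:
  assumes "vspace K V" "vspace K W"
    and "lin K (tens K V W) P f" "vspace K P" "submodule H K P"
    and "\<And>x y. x \<in> carrier V \<Longrightarrow> y \<in> carrier W \<Longrightarrow> f (pure K V W x y) \<in> H"
    and "z \<in> carrier (tens K V W)"
  shows "f z \<in> H"
  using assms(7)
  by (induction rule: tens_induct[OF assms(1,2), consumes 1])
     (simp_all add: assms(6) lin_add[OF assms(3)] submodule_closed(3)[OF assms(4,5)])

lemma tspan_subset:
  assumes "vspace K V" "vspace K W" "X \<subseteq> carrier V" "Y \<subseteq> carrier W" "submodule H K (tens K V W)"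
    and "\<And>x y. x \<in> X \<Longrightarrow> y \<in> Y \<Longrightarrow> pure K V W x y \<in> H"
  shows "tspan K V W X Y \<subseteq> H"
  unfolding tspan_def by (rule lspan_least[OF assms(5)]) (use assms(6) in blast)

lemma tspan_mono:
  assumes "vspace K V" "vspace K W" "X \<subseteq> X'" "Y \<subseteq> Y'" "X' \<subseteq> carrier V" "Y' \<subseteq> carrier W"
  shows "tspan K V W X Y \<subseteq> tspan K V W X' Y'"
proof (rule tspan_subset[OF assms(1,2) _ _ submodule_tspan[OF assms(1,2,5,6)]])
  show "X \<subseteq> carrier V" "Y \<subseteq> carrier W" using assms by auto
  show "pure K V W x y \<in> tspan K V W X' Y'" if "x \<in> X" "y \<in> Y" for x y
    by (rule pure_tspan) (use that assms(3,4) in auto)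
qed

lemma tspan_closed:
  assumes "vspace K V" "vspace K W" "X \<subseteq> carrier V" "Y \<subseteq> carrier W" "z \<in> tspan K V W X Y"
  shows "z \<in> carrier (tens K V W)"
  using submodule_closed(2)[OF vspace_tens[OF assms(1,2)] submodule_tspan[OF assms(1-4)] assms(5)] .

lemma tspan_ext:
  assumes V: "vspace K V" and W: "vspace K W" and P: "vspace K P" and X: "X \<subseteq> carrier V" "Y \<subseteq> carrier W"
    and f: "lin K (tens K V W) P f" and g: "lin K (tens K V W) P g"
    and e: "\<And>x y. x \<in> X \<Longrightarrow> y \<in> Y \<Longrightarrow> f (pure K V W x y) = g (pure K V W x y)"
    and z: "z \<in> tspan K V W X Y"
  shows "f z = g z"
proof -
  note T = vspace_tens[OF V W]
  have cl: "pure K V W x y \<in> carrier (tens K V W)" if "x \<in> X" "y \<in> Y" for x y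
    by (intro pure_closed[OF V W] subsetD[OF X(1)] subsetD[OF X(2)] that)
  have "f z \<ominus>\<^bsub>P\<^esub> g z \<in> {\<zero>\<^bsub>P\<^esub>}"
    by (rule lin_tspan[OF V W P X lin_diff[OF T P f g] submodule_zero[OF P] _ z])
       (simp add: e minus_eq_zero_iff[OF P] lin_closed[OF g] cl)
  then show ?thesis
    using tspan_closed[OF V W X z] by (simp add: minus_eq_zero_iff[OF P] lin_closed[OF f] lin_closed[OF g])
qed

context
  fixes K :: "('k, 'l) ring_scheme" and V :: "('k, 'v, 'm) module_scheme"
    and W :: "('k, 'w, 'n) module_scheme" and X Y
  assumes V: "vspace K V" and W: "vspace K W" and X: "submodule X K V" and Y: "submodule Y K W"
begin

lemma sub_carrier: "X \<subseteq> carrier V" "Y \<subseteq> carrier W"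
  using submodule_closed(2)[OF V X] submodule_closed(2)[OF W Y] by auto

lemma lin_tincl: "lin K (tens K (sub V X) (sub W Y)) (tens K V W) (tincl K (sub V X) (sub W Y) V W)"
  unfolding tincl_def
  by (rule lin_tmap[OF vspace_sub[OF V X] vspace_sub[OF W Y] V W lin_incl[OF X] lin_incl[OF Y]])

lemma tincl_pure: "x \<in> X \<Longrightarrow> y \<in> Y \<Longrightarrow>
    tincl K (sub V X) (sub W Y) V W (pure K (sub V X) (sub W Y) x y) = pure K V W x y"
  unfolding tincl_def
  by (subst tmap_pure[OF vspace_sub[OF V X] vspace_sub[OF W Y] V W lin_incl[OF X] lin_incl[OF Y]])
     (simp_all add: idm_apply)

text \<open>
  Retractions onto \<open>X\<close> and \<open>Y\<close> tensor to a left inverse.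
\<close>

lemma tincl_inj: "inj_on (tincl K (sub V X) (sub W Y) V W) (carrier (tens K (sub V X) (sub W Y)))"
proof -
  obtain r where r: "lin K V (sub V X) r" "\<forall>x\<in>X. r x = x" using retraction_exists[OF V X] by blast
  obtain s where s: "lin K W (sub W Y) s" "\<forall>x\<in>Y. s x = x" using retraction_exists[OF W Y] by blast
  note sX = vspace_sub[OF V X] and sY = vspace_sub[OF W Y]
  have "tmap K V W (sub V X) (sub W Y) r s (tincl K (sub V X) (sub W Y) V W z) = z"
    if "z \<in> carrier (tens K (sub V X) (sub W Y))" for z
    by (rule tens_ext[OF sX sY lin_comp[OF lin_tmap[OF V W sX sY r(1) s(1)] lin_tincl] lin_ident _ that])
       (use r(2) s(2) sub_carrier in \<open>simp add: tincl_pure tmap_pure[OF V W sX sY r(1) s(1)] subset_iff\<close>)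
  then show ?thesis by (rule inj_on_inverseI)
qed

lemma tincl_image: "tincl K (sub V X) (sub W Y) V W ` carrier (tens K (sub V X) (sub W Y)) = tspan K V W X Y"
proof
  note sX = vspace_sub[OF V X] and sY = vspace_sub[OF W Y]
  show "tincl K (sub V X) (sub W Y) V W ` carrier (tens K (sub V X) (sub W Y)) \<subseteq> tspan K V W X Y"
  proof (rule image_subsetI)
    fix z assume z: "z \<in> carrier (tens K (sub V X) (sub W Y))"
    show "tincl K (sub V X) (sub W Y) V W z \<in> tspan K V W X Y"
      by (rule lin_tens_into[OF sX sY lin_tincl vspace_tens[OF V W] submodule_tspan[OF V W sub_carrier] _ z])
         (simp add: tincl_pure pure_tspan)
  qed
  show "tspan K V W X Y \<subseteq> tincl K (sub V X) (sub W Y) V W ` carrier (tens K (sub V X) (sub W Y))"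
    by (rule tspan_subset[OF V W sub_carrier submodule_image[OF vspace_tens[OF sX sY] vspace_tens[OF V W] lin_tincl]])
       (simp add: tincl_pure[symmetric] pure_closed[OF sX sY])
qed

text \<open>
  Let \<open>q\<close> be a quasi-inverse of the restriction of \<open>f\<close> to \<open>X\<close>. The map \<open>z \<mapsto> z - (q f \<otimes> W) z\<close> sends
  \<open>x \<otimes> y\<close> to \<open>(x - q (f x)) \<otimes> y\<close>, hence \<open>X \<otimes> Y\<close> into \<open>(X \<inter> ker f) \<otimes> Y\<close>, and it fixes every tensor
  that \<open>f \<otimes> W\<close> kills.
\<close>

lemma tspan_kernel_left:
  assumes P: "vspace K P" and f: "lin K V P f" and z: "z \<in> tspan K V W X Y"
    and 0: "tmap K V W P W f (idm W) z = \<zero>\<^bsub>tens K P W\<^esub>"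
  shows "z \<in> tspan K V W {x \<in> X. f x = \<zero>\<^bsub>P\<^esub>} Y"
proof -
  note sX = vspace_sub[OF V X] and T = vspace_tens[OF V W] and TP = vspace_tens[OF P W]
  have fX: "lin K (sub V X) P f" by (rule lin_sub_dom[OF f sub_carrier(1)])
  obtain q where q: "lin K P (sub V X) q" "\<And>v. v \<in> X \<Longrightarrow> f (q (f v)) = f v"
    using quasi_inverse_exists[OF sX P fX] by auto
  have ql: "lin K P V q" by (rule lin_sub_cod[OF q(1) sub_carrier(1)])
  have qX: "q p \<in> X" if "p \<in> carrier P" for p using lin_closed[OF q(1) that] by simp
  let ?X0 = "{x \<in> X. f x = \<zero>\<^bsub>P\<^esub>}"
  have X0: "?X0 \<subseteq> carrier V" using sub_carrier by blast
  note lW = lin_idm[OF W]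
  let ?h = "\<lambda>z. tmap K P W V W q (idm W) (tmap K V W P W f (idm W) z)"
  note lq = lin_tmap[OF P W V W ql lW] and lf = lin_tmap[OF V W P W f lW]
  have h: "lin K (tens K V W) (tens K V W) ?h" by (rule lin_comp[OF lq lf])
  have "z \<ominus>\<^bsub>tens K V W\<^esub> ?h z \<in> tspan K V W ?X0 Y"
  proof (rule lin_tspan[OF V W T sub_carrier lin_diff[OF T T lin_ident h]
       submodule_tspan[OF V W X0 sub_carrier(2)] _ z])
    fix x y assume x: "x \<in> X" and y: "y \<in> Y"
    have xc: "x \<in> carrier V" and yc: "y \<in> carrier W" using x y sub_carrier by auto
    note fx = lin_closed[OF f xc]
    have "pure K V W x y \<ominus>\<^bsub>tens K V W\<^esub> ?h (pure K V W x y) = pure K V W (x \<ominus>\<^bsub>V\<^esub> q (f x)) y"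
      using xc yc fx lin_minus[OF V T lin_pure_left[OF V W yc] xc lin_closed[OF ql fx]]
      by (simp add: tmap_pure[OF V W P W f lW] tmap_pure[OF P W V W ql lW] idm_apply)
    also have "\<dots> \<in> tspan K V W ?X0 Y"
    proof (rule pure_tspan[OF _ y])
      have "f (x \<ominus>\<^bsub>V\<^esub> q (f x)) = \<zero>\<^bsub>P\<^esub>"
        using lin_minus[OF V P f xc lin_closed[OF ql fx]] q(2)[OF x] fx by (simp add: minus_eq_zero_iff[OF P])
      then show "x \<ominus>\<^bsub>V\<^esub> q (f x) \<in> ?X0" using submodule_closed(4)[OF V X x qX[OF fx]] by simp
    qed
    finally show "pure K V W x y \<ominus>\<^bsub>tens K V W\<^esub> ?h (pure K V W x y) \<in> tspan K V W ?X0 Y" .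
  qed
  then show ?thesis
    using lin_zero[OF TP T lq] 0 vspace_diff_zero[OF T tspan_closed[OF V W sub_carrier z]] by simp
qed

lemma tspan_kernel_right:
  assumes P: "vspace K P" and f: "lin K W P f" and z: "z \<in> tspan K V W X Y"
    and 0: "tmap K V W V P (idm V) f z = \<zero>\<^bsub>tens K V P\<^esub>"
  shows "z \<in> tspan K V W X {y \<in> Y. f y = \<zero>\<^bsub>P\<^esub>}"
proof -
  note sY = vspace_sub[OF W Y] and T = vspace_tens[OF V W] and TP = vspace_tens[OF V P]
  have fY: "lin K (sub W Y) P f" by (rule lin_sub_dom[OF f sub_carrier(2)])
  obtain q where q: "lin K P (sub W Y) q" "\<And>v. v \<in> Y \<Longrightarrow> f (q (f v)) = f v"
    using quasi_inverse_exists[OF sY P fY] by auto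
  have ql: "lin K P W q" by (rule lin_sub_cod[OF q(1) sub_carrier(2)])
  have qY: "q p \<in> Y" if "p \<in> carrier P" for p using lin_closed[OF q(1) that] by simp
  let ?Y0 = "{x \<in> Y. f x = \<zero>\<^bsub>P\<^esub>}"
  have Y0: "?Y0 \<subseteq> carrier W" using sub_carrier by blast
  note lV = lin_idm[OF V]
  let ?h = "\<lambda>z. tmap K V P V W (idm V) q (tmap K V W V P (idm V) f z)"
  note lq = lin_tmap[OF V P V W lV ql] and lf = lin_tmap[OF V W V P lV f]
  have h: "lin K (tens K V W) (tens K V W) ?h" by (rule lin_comp[OF lq lf])
  have "z \<ominus>\<^bsub>tens K V W\<^esub> ?h z \<in> tspan K V W X ?Y0"
  proof (rule lin_tspan[OF V W T sub_carrier lin_diff[OF T T lin_ident h]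
       submodule_tspan[OF V W sub_carrier(1) Y0] _ z])
    fix x y assume x: "x \<in> X" and y: "y \<in> Y"
    have xc: "x \<in> carrier V" and yc: "y \<in> carrier W" using x y sub_carrier by auto
    note fy = lin_closed[OF f yc]
    have "pure K V W x y \<ominus>\<^bsub>tens K V W\<^esub> ?h (pure K V W x y) = pure K V W x (y \<ominus>\<^bsub>W\<^esub> q (f y))"
      using xc yc fy lin_minus[OF W T lin_pure_right[OF V W xc] yc lin_closed[OF ql fy]]
      by (simp add: tmap_pure[OF V W V P lV f] tmap_pure[OF V P V W lV ql] idm_apply)
    also have "\<dots> \<in> tspan K V W X ?Y0"
    proof (rule pure_tspan[OF x])
      have "f (y \<ominus>\<^bsub>W\<^esub> q (f y)) = \<zero>\<^bsub>P\<^esub>"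
        using lin_minus[OF W P f yc lin_closed[OF ql fy]] q(2)[OF y] fy by (simp add: minus_eq_zero_iff[OF P])
      then show "y \<ominus>\<^bsub>W\<^esub> q (f y) \<in> ?Y0" using submodule_closed(4)[OF W Y y qY[OF fy]] by simp
    qed
    finally show "pure K V W x y \<ominus>\<^bsub>tens K V W\<^esub> ?h (pure K V W x y) \<in> tspan K V W X ?Y0" .
  qed
  then show ?thesis
    using lin_zero[OF TP T lq] 0 vspace_diff_zero[OF T tspan_closed[OF V W sub_carrier z]] by simp
qed

end

lemma tsub_tspan:
  assumes "vspace K V" "submodule X K V" "submodule Y K V"
  shows "tsub K V X Y = tspan K V V X Y"
  unfolding tsub_def by (rule tincl_image[OF assms(1,1,2,3)])

section \<open>Braidings on threefold and fourfold tensor powers\<close>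

context
  fixes K :: "('k, 'l) ring_scheme" and V :: "('k, 'v, 'm) module_scheme" and c
  assumes V: "vspace K V" and c: "lin K (tens K V V) (tens K V V) c"
begin

lemma vspace_VV: "vspace K (tens K V V)"
  by (rule vspace_tens[OF V V])

lemma lin_br12: "lin K (tens K (tens K V V) V) (tens K (tens K V V) V) (br12 K V c)"
  unfolding br12_def by (rule lin_tmap[OF vspace_VV V vspace_VV V c lin_idm[OF V]])

lemma br12_pure: "z \<in> carrier (tens K V V) \<Longrightarrow> v \<in> carrier V \<Longrightarrow>
    br12 K V c (pure K (tens K V V) V z v) = pure K (tens K V V) V (c z) v"
  unfolding br12_def by (simp add: tmap_pure[OF vspace_VV V vspace_VV V c lin_idm[OF V]] idm_apply)

lemma lin_id_c: "lin K (tens K V (tens K V V)) (tens K V (tens K V V)) (tmap K V (tens K V V) V (tens K V V) (idm V) c)"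
  by (rule lin_tmap[OF V vspace_VV V vspace_VV lin_idm[OF V] c])

lemma lin_br23: "lin K (tens K (tens K V V) V) (tens K (tens K V V) V) (br23 K V c)"
  unfolding br23_def o_def
  by (intro lin_comp[OF lin_asc_inv[OF V V V]] lin_comp[OF lin_id_c] lin_asc V)

text \<open>
  The braiding of a pure tensor need not be pure, so the inverse associativity map stays in the
  formula; it is resolved by linearity where the lemma is used.
\<close>

lemma br23_pure: "x \<in> carrier V \<Longrightarrow> y \<in> carrier V \<Longrightarrow> z \<in> carrier V \<Longrightarrow>
    br23 K V c (pure K (tens K V V) V (pure K V V x y) z) = asc_inv K V V V (pure K V (tens K V V) x (c (pure K V V y z)))"
  unfolding br23_def
  by (simp add: asc_pure[OF V V V] tmap_pure[OF V vspace_VV V vspace_VV lin_idm[OF V] c] idm_apply pure_closed[OF V V])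

lemma lin_mid: "lin K (tens K V (tens K V V)) (tens K V (tens K V V)) (\<lambda>z. asc K V V V (br12 K V c (asc_inv K V V V z)))"
  by (intro lin_comp[OF lin_asc[OF V V V]] lin_comp[OF lin_br12] lin_asc_inv V)

lemma lin_id_mid: "lin K (tens K V (tens K V (tens K V V))) (tens K V (tens K V (tens K V V)))
    (tmap K V (tens K V (tens K V V)) V (tens K V (tens K V V)) (idm V) (\<lambda>z. asc K V V V (br12 K V c (asc_inv K V V V z))))"
  by (rule lin_tmap[OF V vspace_tens[OF V vspace_VV] V vspace_tens[OF V vspace_VV] lin_idm[OF V] lin_mid])

lemma br_mid_eq: "br_mid K V c z = asc_inv K V V (tens K V V) (tmap K V (tens K V (tens K V V)) V (tens K V (tens K V V)) (idm V)
    (\<lambda>z. asc K V V V (br12 K V c (asc_inv K V V V z))) (asc K V V (tens K V V) z))"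
  by (simp add: br_mid_def Let_def comp_def)

lemma lin_br_mid: "lin K (tens K (tens K V V) (tens K V V)) (tens K (tens K V V) (tens K V V)) (br_mid K V c)"
  unfolding br_mid_eq[abs_def]
  by (intro lin_comp[OF lin_asc_inv[OF V V vspace_VV]] lin_comp[OF lin_id_mid] lin_asc V vspace_VV)

lemma br_mid_pure: "p \<in> carrier V \<Longrightarrow> q \<in> carrier V \<Longrightarrow> r \<in> carrier V \<Longrightarrow> s \<in> carrier V \<Longrightarrow>
    br_mid K V c (pure K (tens K V V) (tens K V V) (pure K V V p q) (pure K V V r s)) =
    asc_inv K V V (tens K V V) (pure K V (tens K V (tens K V V)) p (asc K V V V (pure K (tens K V V) V (c (pure K V V q r)) s)))"
  unfolding br_mid_eq
  by (simp add: asc_pure[OF V V vspace_VV] tmap_pure[OF V vspace_tens[OF V vspace_VV] V vspace_tens[OF V vspace_VV] lin_idm[OF V] lin_mid]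
       idm_apply pure_closed[OF V V] pure_closed[OF V vspace_VV] asc_inv_pure[OF V V V] br12_pure)

end

context
  fixes K :: "('k, 'l) ring_scheme" and V :: "('k, 'v, 'm) module_scheme"
    and W :: "('k, 'w, 'n) module_scheme" and c d p
  assumes V: "vspace K V" and W: "vspace K W" and c: "lin K (tens K V V) (tens K V V) c"
    and d: "lin K (tens K W W) (tens K W W) d" and p: "lin K V W p"
    and compat: "\<And>z. z \<in> carrier (tens K V V) \<Longrightarrow>
       d (tmap K V V W W p p z) = tmap K V V W W p p (c z)"
begin

lemmas vspace_sqV = vspace_tens[OF V V] and vspace_sqW = vspace_tens[OF W W]
  and lin_sq_map = lin_tmap[OF V V W W p p]
lemmas lin_cube_map = lin_tmap[OF V vspace_sqV W vspace_sqW p lin_sq_map]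

lemma idm_compat: "v \<in> carrier V \<Longrightarrow> idm W (p v) = p (idm V v)"
  by (simp add: idm_apply lin_closed[OF p])

lemma br12_natural: "z \<in> carrier (tens K (tens K V V) V) \<Longrightarrow> br12 K W d ((tmap K (tens K V V) V (tens K W W) W (tmap K V V W W p p) p) z) = (tmap K (tens K V V) V (tens K W W) W (tmap K V V W W p p) p) (br12 K V c z)"
  unfolding br12_def
  by (rule tmap_square[OF vspace_sqV V vspace_sqW W vspace_sqV V vspace_sqW W lin_sq_map p d lin_idm[OF W] c lin_idm[OF V] lin_sq_map p compat idm_compat])

lemma br23_natural: assumes z: "z \<in> carrier (tens K (tens K V V) V)"
  shows "br23 K W d ((tmap K (tens K V V) V (tens K W W) W (tmap K V V W W p p) p) z) = (tmap K (tens K V V) V (tens K W W) W (tmap K V V W W p p) p) (br23 K V c z)"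
proof -
  note az = lin_closed[OF lin_asc[OF V V V] z]
  have "br23 K W d ((tmap K (tens K V V) V (tens K W W) W (tmap K V V W W p p) p) z) = asc_inv K W W W (tmap K W (tens K W W) W (tens K W W) (idm W) d ((tmap K V (tens K V V) W (tens K W W) p (tmap K V V W W p p)) (asc K V V V z)))"
    by (simp add: br23_def asc_natural[OF V V V W W W p p p z])
  also have "tmap K W (tens K W W) W (tens K W W) (idm W) d ((tmap K V (tens K V V) W (tens K W W) p (tmap K V V W W p p)) (asc K V V V z)) = (tmap K V (tens K V V) W (tens K W W) p (tmap K V V W W p p)) (tmap K V (tens K V V) V (tens K V V) (idm V) c (asc K V V V z))"
    by (rule tmap_square[OF V vspace_sqV W vspace_sqW V vspace_sqV W vspace_sqW p lin_sq_map lin_idm[OF W] d lin_idm[OF V] c p lin_sq_map idm_compat compat az])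
  finally show ?thesis
    by (simp add: br23_def asc_inv_natural[OF V V V W W W p p p] lin_closed[OF lin_id_c[OF V c] az])
qed

lemma br_mid_natural: assumes z: "z \<in> carrier (tens K (tens K V V) (tens K V V))"
  shows "br_mid K W d ((tmap K (tens K V V) (tens K V V) (tens K W W) (tens K W W) (tmap K V V W W p p) (tmap K V V W W p p)) z) = (tmap K (tens K V V) (tens K V V) (tens K W W) (tens K W W) (tmap K V V W W p p) (tmap K V V W W p p)) (br_mid K V c z)"
proof -
  note az = lin_closed[OF lin_asc[OF V V vspace_sqV] z]
  note V3 = vspace_tens[OF V vspace_sqV] and W3 = vspace_tens[OF W vspace_sqW]
  define mv where "mv = (\<lambda>z. asc K V V V (br12 K V c (asc_inv K V V V z)))"
  define mw where "mw = (\<lambda>z. asc K W W W (br12 K W d (asc_inv K W W W z)))"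
  have lmv: "lin K (tens K V (tens K V V)) (tens K V (tens K V V)) mv" and lmw: "lin K (tens K W (tens K W W)) (tens K W (tens K W W)) mw"
    unfolding mv_def mw_def by (rule lin_mid[OF V c] lin_mid[OF W d])+
  have mid: "mw ((tmap K V (tens K V V) W (tens K W W) p (tmap K V V W W p p)) y) = (tmap K V (tens K V V) W (tens K W W) p (tmap K V V W W p p)) (mv y)" if y: "y \<in> carrier (tens K V (tens K V V))" for y
  proof -
    note a = lin_closed[OF lin_asc_inv[OF V V V] y]
    show ?thesis unfolding mv_def mw_def
      by (simp add: asc_inv_natural[OF V V V W W W p p p y] br12_natural[OF a]
          asc_natural[OF V V V W W W p p p] lin_closed[OF lin_br12[OF V c] a])
  qed
  let ?mw = "tmap K W (tens K W (tens K W W)) W (tens K W (tens K W W)) (idm W) mw"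
  let ?mv = "tmap K V (tens K V (tens K V V)) V (tens K V (tens K V V)) (idm V) mv"
  let ?q = "tmap K V (tens K V (tens K V V)) W (tens K W (tens K W W)) p (tmap K V (tens K V V) W (tens K W W) p (tmap K V V W W p p))"
  have 1: "br_mid K W d ((tmap K (tens K V V) (tens K V V) (tens K W W) (tens K W W) (tmap K V V W W p p) (tmap K V V W W p p)) z) = asc_inv K W W (tens K W W) (?mw (?q (asc K V V (tens K V V) z)))"
    unfolding br_mid_eq[OF W d] mw_def[symmetric]
    by (simp add: asc_natural[OF V V vspace_sqV W W vspace_sqW p p lin_sq_map z])
  have 2: "?mw (?q (asc K V V (tens K V V) z)) = ?q (?mv (asc K V V (tens K V V) z))"
    by (rule tmap_square[where f' = "idm W" and h = "idm V" and g' = mw and k = mv,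
        OF V V3 W W3 V V3 W W3 p lin_cube_map lin_idm[OF W] lmw lin_idm[OF V] lmv p lin_cube_map _ _ az])
       (simp_all add: idm_compat mid)
  have "?mv (asc K V V (tens K V V) z) \<in> carrier (tens K V (tens K V (tens K V V)))"
    by (rule lin_closed[OF lin_tmap[OF V V3 V V3 lin_idm[OF V] lmv] az])
  from asc_inv_natural[OF V V vspace_sqV W W vspace_sqW p p lin_sq_map this]
  show ?thesis unfolding 1 2 br_mid_eq[OF V c] mv_def[symmetric] .
qed

end

section \<open>Transport of the structure along a surjection\<close>

lemma image_obtain: "z \<in> f ` A \<Longrightarrow> (\<And>x. x \<in> A \<Longrightarrow> z = f x \<Longrightarrow> P) \<Longrightarrow> P"
  by blast

text \<open>
  Every axiom equates two composites of structure maps, identities and the associativity and unit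
  isomorphisms, tensored with each other. All of them commute with the tensor powers of \<open>p\<close>, so
  that the two sides at the image of \<open>y\<close> are the images of the two sides at \<open>y\<close>; and the tensor
  powers of \<open>p\<close> are surjective.
\<close>

theorem braided_bialgebra_transfer:
  assumes BB: "braided_bialgebra K B S" and U: "vspace K U" and surj: "p ` carrier B = carrier U"
    and T: "mul T \<in> Lin K (tens K U U) U" "unt T \<in> Lin K (self K) U"
      "comul T \<in> Lin K U (tens K U U)" "counit T \<in> Lin K U (self K)"
      "braid T \<in> Lin K (tens K U U) (tens K U U)"
    and hom: "braided_bialgebra_hom K B S U T p"
  shows "braided_bialgebra K U T"
proof -
  interpret B: braided_bialgebra K B S by (rule BB)
  note V = B.vspace_axioms
  note p = Lin_lin[OF hom[unfolded braided_bialgebra_hom_def, THEN conjunct1]]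
  note lm = Lin_lin[OF B.mul_Lin] and lu = Lin_lin[OF B.unit_Lin] and lD = Lin_lin[OF B.comul_Lin]
    and le = Lin_lin[OF B.counit_Lin] and lc = Lin_lin[OF B.braid_Lin]
  note tm = Lin_lin[OF T(1)] and tu = Lin_lin[OF T(2)] and tD = Lin_lin[OF T(3)]
    and te = Lin_lin[OF T(4)] and tc = Lin_lin[OF T(5)]
  let ?V2 = "tens K B B" and ?W2 = "tens K U U"
  let ?p2 = "tmap K B B U U p p"
  let ?p3 = "tmap K ?V2 B ?W2 U ?p2 p"
  let ?p3' = "tmap K B ?V2 U ?W2 p ?p2"
  let ?p4 = "tmap K ?V2 ?V2 ?W2 ?W2 ?p2 ?p2"
  have h_mul: "mul T (?p2 z) = p (mul S z)" if "z \<in> carrier ?V2" for z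
    using hom that by (simp add: braided_bialgebra_hom_def)
  have h_unt: "unt T k = p (unt S k)" if "k \<in> carrier K" for k
    using hom that by (simp add: braided_bialgebra_hom_def)
  have h_comul: "comul T (p x) = ?p2 (comul S x)" if "x \<in> carrier B" for x
    using hom that by (simp add: braided_bialgebra_hom_def)
  have h_counit: "counit T (p x) = counit S x" if "x \<in> carrier B" for x
    using hom that by (simp add: braided_bialgebra_hom_def)
  have h_braid: "braid T (?p2 z) = ?p2 (braid S z)" if "z \<in> carrier ?V2" for z
    using hom that by (simp add: braided_bialgebra_hom_def)
  note V2 = vspace_tens[OF V V] and W2 = vspace_tens[OF U U]
  note lp2 = lin_tmap[OF V V U U p p] and iB = lin_idm[OF V] and iU = lin_idm[OF U]
  have id_c: "idm U (p v) = p (idm B v)" if "v \<in> carrier B" for v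
    using that lin_closed[OF p] by (simp add: idm_apply)
  note n12 = br12_natural[OF V U lc tc p h_braid] and n23 = br23_natural[OF V U lc tc p h_braid]
    and nmid = br_mid_natural[OF V U lc tc p h_braid]
  note c12 = lin_closed[OF lin_br12[OF V lc]] and c23 = lin_closed[OF lin_br23[OF V lc]]
    and cmid = lin_closed[OF lin_br_mid[OF V lc]]
  note nasc = asc_natural[OF V V V U U U p p p] and nasci = asc_inv_natural[OF V V V U U U p p p]
  note casc = lin_closed[OF lin_asc[OF V V V]] and casci = lin_closed[OF lin_asc_inv[OF V V V]]
  note nm1 = tmap_square[OF V2 V W2 U V V U U lp2 p tm iU lm iB p p h_mul id_c]
    and nm2 = tmap_square[OF V V2 U W2 V V U U p lp2 iU tm iB lm p p id_c h_mul]
    and nD1 = tmap_square[OF V V U U V2 V W2 U p p tD iU lD iB lp2 p h_comul id_c]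
    and nD2 = tmap_square[OF V V U U V V2 U W2 p p iU tD iB lD p lp2 id_c h_comul]
    and nDD = tmap_square[OF V V U U V2 V2 W2 W2 p p tD tD lD lD lp2 lp2 h_comul h_comul]
    and nmm = tmap_square[OF V2 V2 W2 W2 V V U U lp2 lp2 tm tm lm lm p p h_mul h_mul]
  note cm1 = lin_closed[OF lin_tmap[OF V2 V V V lm iB]] and cm2 = lin_closed[OF lin_tmap[OF V V2 V V iB lm]]
    and cD1 = lin_closed[OF lin_tmap[OF V V V2 V lD iB]] and cD2 = lin_closed[OF lin_tmap[OF V V V V2 iB lD]]
    and cDD = lin_closed[OF lin_tmap[OF V V V2 V2 lD lD]] and cmm = lin_closed[OF lin_tmap[OF V2 V2 V V lm lm]]
  note cm = lin_closed[OF lm] and cD = lin_closed[OF lD] and cc = lin_closed[OF lc] 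
  note nat = n12 n23 nmid nasc nasci nm1 nm2 nD1 nD2 nDD nmm h_mul h_comul h_counit h_braid
  note cl = c12 c23 cmid casc casci cm1 cm2 cD1 cD2 cDD cmm cm cD cc
  note nlu = lunit_natural[OF V U p le te h_counit] and nru = runit_natural[OF V U p le te h_counit]
  have s2: "?p2 ` carrier ?V2 = carrier ?W2" by (rule tmap_surj[OF V V U U p p surj surj])
  have s3: "?p3 ` carrier (tens K ?V2 B) = carrier (tens K ?W2 U)"
    by (rule tmap_surj[OF V2 V W2 U lp2 p s2 surj])
  note e1 = image_obtain[of _ p "carrier B", unfolded surj]
    and e2 = image_obtain[of _ ?p2 "carrier ?V2", unfolded s2]
    and e3 = image_obtain[of _ ?p3 "carrier (tens K ?V2 B)", unfolded s3]
  interpret K: field K by (rule vspace_field[OF V])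
  have one: "\<one>\<^bsub>K\<^esub> \<in> carrier K" by simp
  have u1: "unt S \<one>\<^bsub>K\<^esub> \<in> carrier B" using lin_closed[OF lu] one by (simp add: self_simps)
  have tu1: "unt T \<one>\<^bsub>K\<^esub> = p (unt S \<one>\<^bsub>K\<^esub>)" by (rule h_unt[OF one])
  have pp: "pure K U U (p x) (p y) = ?p2 (pure K B B x y)" if "x \<in> carrier B" "y \<in> carrier B" for x y
    using tmap_pure[OF V V U U p p that] by simp
  note pc = pure_closed[OF V V]
  have bvs: "braided_vector_space K U (braid T)"
  proof (intro braided_vector_space.intro braided_vector_space_axioms.intro U T)
    fix z assume "z \<in> carrier (tens K ?W2 U)"
    then obtain y where y: "y \<in> carrier (tens K ?V2 B)" "z = ?p3 y" by (rule e3)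
    show "br12 K U (braid T) (br23 K U (braid T) (br12 K U (braid T) z)) =
      br23 K U (braid T) (br12 K U (braid T) (br23 K U (braid T) z))"
      using B.braid_eq[OF y(1)] by (simp add: y nat cl)
  qed
  have ba: "braided_algebra K U (mul T) (unt T) (braid T)"
  proof (intro braided_algebra.intro bvs braided_algebra_axioms.intro T)
    fix z assume "z \<in> carrier (tens K ?W2 U)"
    then obtain y where y: "y \<in> carrier (tens K ?V2 B)" "z = ?p3 y" by (rule e3)
    show "mul T (tmap K ?W2 U U U (mul T) (idm U) z) =
         mul T (tmap K U ?W2 U U (idm U) (mul T) (asc K U U U z))"
      using B.mul_assoc[OF y(1)] by (simp add: y nat cl)
    show "braid T (tmap K ?W2 U U U (mul T) (idm U) z) =
         tmap K U ?W2 U U (idm U) (mul T)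
          (asc K U U U (br12 K U (braid T) (br23 K U (braid T) z)))"
      using B.braid_mul_left[OF y(1)] by (simp add: y nat cl)
    show "braid T (tmap K U ?W2 U U (idm U) (mul T) (asc K U U U z)) =
         tmap K ?W2 U U U (mul T) (idm U) (br23 K U (braid T) (br12 K U (braid T) z))"
      using B.braid_mul_right[OF y(1)] by (simp add: y nat cl)
  next
    fix a assume "a \<in> carrier U"
    then obtain y where y: "y \<in> carrier B" "a = p y" by (rule e1)
    show "mul T (pure K U U (unt T \<one>\<^bsub>K\<^esub>) a) = a"
      using B.unit_left[OF y(1)] by (simp add: y tu1 pp u1 pc nat)
    show "mul T (pure K U U a (unt T \<one>\<^bsub>K\<^esub>)) = a"
      using B.unit_right[OF y(1)] by (simp add: y tu1 pp u1 pc nat)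
    show "braid T (pure K U U (unt T \<one>\<^bsub>K\<^esub>) a) = pure K U U a (unt T \<one>\<^bsub>K\<^esub>)"
      using B.braid_unit_left[OF y(1)] by (simp add: y tu1 pp u1 pc nat)
    show "braid T (pure K U U a (unt T \<one>\<^bsub>K\<^esub>)) = pure K U U (unt T \<one>\<^bsub>K\<^esub>) a"
      using B.braid_unit_right[OF y(1)] by (simp add: y tu1 pp u1 pc nat)
  qed
  have bc: "braided_coalgebra K U (comul T) (counit T) (braid T)"
  proof (intro braided_coalgebra.intro bvs braided_coalgebra_axioms.intro T)
    fix a assume "a \<in> carrier U"
    then obtain y where y: "y \<in> carrier B" "a = p y" by (rule e1)
    show "asc K U U U (tmap K U U ?W2 U (comul T) (idm U) (comul T a)) =
         tmap K U U U ?W2 (idm U) (comul T) (comul T a)"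
      using B.comul_coassoc[OF y(1)] by (simp add: y nat cl)
    show "lunit K U (tmap K U U (self K) U (counit T) (idm U) (comul T a)) = a"
      using B.counit_left[OF y(1)] by (simp add: y h_comul nlu cl)
    show "runit K U (tmap K U U U (self K) (idm U) (counit T) (comul T a)) = a"
      using B.counit_right[OF y(1)] by (simp add: y h_comul nru cl)
  next
    fix z assume "z \<in> carrier ?W2"
    then obtain y where y: "y \<in> carrier ?V2" "z = ?p2 y" by (rule e2)
    show "tmap K U U ?W2 U (comul T) (idm U) (braid T z) =
         br23 K U (braid T) (br12 K U (braid T) (asc_inv K U U U
            (tmap K U U U ?W2 (idm U) (comul T) z)))"
      using B.braid_comul_left[OF y(1)] by (simp add: y nat cl)
    show "asc_inv K U U U (tmap K U U U ?W2 (idm U) (comul T) (braid T z)) =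
         br12 K U (braid T) (br23 K U (braid T) (tmap K U U ?W2 U (comul T) (idm U) z))"
      using B.braid_comul_right[OF y(1)] by (simp add: y nat cl)
    show "lunit K U (tmap K U U (self K) U (counit T) (idm U) (braid T z)) =
         runit K U (tmap K U U U (self K) (idm U) (counit T) z)"
      using B.braid_counit_left[OF y(1)] by (simp add: y h_braid nlu nru cl)
    show "runit K U (tmap K U U U (self K) (idm U) (counit T) (braid T z)) =
         lunit K U (tmap K U U (self K) U (counit T) (idm U) z)"
      using B.braid_counit_right[OF y(1)] by (simp add: y h_braid nlu nru cl)
  qed
  show ?thesis
  proof (intro braided_bialgebra.intro ba bc braided_bialgebra_axioms.intro)
    fix z assume "z \<in> carrier ?W2"
    then obtain y where y: "y \<in> carrier ?V2" "z = ?p2 y" by (rule e2)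
    show "comul T (mul T z) = tmap K ?W2 ?W2 U U (mul T) (mul T)
          (br_mid K U (braid T) (tmap K U U ?W2 ?W2 (comul T) (comul T) z))"
      using B.comul_mul[OF y(1)] by (simp add: y nat cl)
  next
    show "comul T (unt T \<one>\<^bsub>K\<^esub>) = pure K U U (unt T \<one>\<^bsub>K\<^esub>) (unt T \<one>\<^bsub>K\<^esub>)"
      using B.comul_unit by (simp add: tu1 pp u1 h_comul)
    show "counit T (unt T \<one>\<^bsub>K\<^esub>) = \<one>\<^bsub>K\<^esub>"
      using B.counit_unit by (simp add: tu1 u1 h_counit)
  next
    fix a a' assume a: "a \<in> carrier U" "a' \<in> carrier U"
    obtain y where y: "y \<in> carrier B" "a = p y" by (rule e1[OF a(1)])
    obtain y' where y': "y' \<in> carrier B" "a' = p y'" by (rule e1[OF a(2)])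
    show "counit T (mul T (pure K U U a a')) = counit T a \<otimes>\<^bsub>K\<^esub> counit T a'"
      using B.counit_mul[OF y(1) y'(1)] by (simp add: y y' pp pc h_mul h_counit cm)
  qed
qed

text \<open>
  A linear map that vanishes on \<open>ker p \<otimes> V\<close> and \<open>V \<otimes> ker p\<close> factors through \<open>p \<otimes> p\<close>: for a section
  \<open>s\<close> of \<open>p\<close>, the elements \<open>s (p x)\<close> and \<open>x\<close> differ by an element of \<open>ker p\<close>, so that
  \<open>f \<circ> (s \<otimes> s)\<close> is the factor.
\<close>

lemma tens_factor:
  assumes V: "vspace K V" and U: "vspace K U" and p: "lin K V U p" and s: "lin K U V s"
    and ps: "\<And>X. X \<in> carrier U \<Longrightarrow> p (s X) = X"
    and P: "vspace K P" and f: "lin K (tens K V V) P f"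
    and k1: "\<And>x y. x \<in> carrier V \<Longrightarrow> y \<in> carrier V \<Longrightarrow> p x = \<zero>\<^bsub>U\<^esub> \<Longrightarrow> f (pure K V V x y) = \<zero>\<^bsub>P\<^esub>"
    and k2: "\<And>x y. x \<in> carrier V \<Longrightarrow> y \<in> carrier V \<Longrightarrow> p y = \<zero>\<^bsub>U\<^esub> \<Longrightarrow> f (pure K V V x y) = \<zero>\<^bsub>P\<^esub>"
    and z: "z \<in> carrier (tens K V V)"
  shows "f (tmap K U U V V s s (tmap K V V U U p p z)) = f z"
proof (rule tens_ext[OF V V lin_comp[OF f lin_comp[OF lin_tmap[OF U U V V s s] lin_tmap[OF V V U U p p]]] f _ z])
  fix x y assume x: "x \<in> carrier V" and y: "y \<in> carrier V"
  interpret V: vspace K V by (rule V)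
  define x' where "x' = s (p x)"
  define y' where "y' = s (p y)"
  have x': "x' \<in> carrier V" "p x' = p x" and y': "y' \<in> carrier V" "p y' = p y"
    using x y lin_closed[OF s] lin_closed[OF p] ps by (auto simp: x'_def y'_def)
  note pc = pure_closed[OF V V] and T = vspace_tens[OF V V]
  have "p (x' \<ominus>\<^bsub>V\<^esub> x) = \<zero>\<^bsub>U\<^esub>"
    using lin_minus[OF V U p x'(1) x] x' x lin_closed[OF p] by (simp add: minus_eq_zero_iff[OF U])
  then have "f (pure K V V (x' \<ominus>\<^bsub>V\<^esub> x) y') = \<zero>\<^bsub>P\<^esub>" using k1 x x' y' by simp
  then have 1: "f (pure K V V x' y') = f (pure K V V x y')"
    using lin_minus[OF V P lin_comp[OF f lin_pure_left[OF V V y'(1)]] x'(1) x] x x' y'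
    by (simp add: minus_eq_zero_iff[OF P] lin_closed[OF f] pc)
  have "p (y' \<ominus>\<^bsub>V\<^esub> y) = \<zero>\<^bsub>U\<^esub>"
    using lin_minus[OF V U p y'(1) y] y' y lin_closed[OF p] by (simp add: minus_eq_zero_iff[OF U])
  then have "f (pure K V V x (y' \<ominus>\<^bsub>V\<^esub> y)) = \<zero>\<^bsub>P\<^esub>" using k2 x y y' by simp
  then have 2: "f (pure K V V x y') = f (pure K V V x y)"
    using lin_minus[OF V P lin_comp[OF f lin_pure_right[OF V V x]] y'(1) y] x y y'
    by (simp add: minus_eq_zero_iff[OF P] lin_closed[OF f] pc)
  show "f (tmap K U U V V s s (tmap K V V U U p p (pure K V V x y))) = f (pure K V V x y)"
    using 1 2 by (simp add: tmap_pure[OF V V U U p p] tmap_pure[OF U U V V s s] x y lin_closed[OF p] x'_def y'_def)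
qed

lemma lin_factor:
  assumes V: "vspace K V" and U: "vspace K U" and p: "lin K V U p" and s: "lin K U V s"
    and ps: "\<And>X. X \<in> carrier U \<Longrightarrow> p (s X) = X"
    and P: "vspace K P" and f: "lin K V P f"
    and k: "\<And>x. x \<in> carrier V \<Longrightarrow> p x = \<zero>\<^bsub>U\<^esub> \<Longrightarrow> f x = \<zero>\<^bsub>P\<^esub>" and x: "x \<in> carrier V"
  shows "f (s (p x)) = f x"
proof -
  interpret V: vspace K V by (rule V)
  note px = lin_closed[OF p x]
  note sp = lin_closed[OF s px]
  have "p (s (p x) \<ominus>\<^bsub>V\<^esub> x) = \<zero>\<^bsub>U\<^esub>"
    using lin_minus[OF V U p sp x] ps[OF px] px by (simp add: minus_eq_zero_iff[OF U])
  then have "f (s (p x) \<ominus>\<^bsub>V\<^esub> x) = \<zero>\<^bsub>P\<^esub>" using k sp x by simp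
  then show ?thesis using lin_minus[OF V P f sp x] lin_closed[OF f] sp x by (simp add: minus_eq_zero_iff[OF P])
qed

text \<open>
  The structure maps of \<open>U\<close> are those of \<open>B\<close> precomposed with a linear section of \<open>p\<close> and followed by
  \<open>p\<close>; the conditions on the kernel of \<open>p\<close> say that \<open>p\<close> preserves them. They are determined by this,
  since \<open>p\<close> and \<open>p \<otimes> p\<close> are surjective and the maps are extensional.
\<close>

theorem quotient_bialgebra:
  fixes K :: "('k, 'l) ring_scheme" and B :: "('k, 'b, 'm) module_scheme"
    and U :: "('k, 'u, 'n) module_scheme" and S :: "('k, 'b) bb_data"
  assumes BB: "braided_bialgebra K B S" and U: "vspace K U" and pL: "p \<in> Lin K B U"
    and surj: "p ` carrier B = carrier U"
    and ker: "\<And>x y. x \<in> carrier B \<Longrightarrow> y \<in> carrier B \<Longrightarrow> p x = \<zero>\<^bsub>U\<^esub> \<Longrightarrow>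
        p (mul S (pure K B B x y)) = \<zero>\<^bsub>U\<^esub> \<and> p (mul S (pure K B B y x)) = \<zero>\<^bsub>U\<^esub> \<and>
        tmap K B B U U p p (braid S (pure K B B x y)) = \<zero>\<^bsub>tens K U U\<^esub> \<and>
        tmap K B B U U p p (braid S (pure K B B y x)) = \<zero>\<^bsub>tens K U U\<^esub>"
    and kerD: "\<And>x. x \<in> carrier B \<Longrightarrow> p x = \<zero>\<^bsub>U\<^esub> \<Longrightarrow> tmap K B B U U p p (comul S x) = \<zero>\<^bsub>tens K U U\<^esub>"
    and kere: "\<And>x. x \<in> carrier B \<Longrightarrow> p x = \<zero>\<^bsub>U\<^esub> \<Longrightarrow> counit S x = \<zero>\<^bsub>K\<^esub>"
  shows "\<exists>!T :: ('k, 'u) bb_data. braided_bialgebra K U T \<and> braided_bialgebra_hom K B S U T p"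
proof -
  interpret B: braided_bialgebra K B S by (rule BB)
  note V = B.vspace_axioms
  note p = Lin_lin[OF pL]
  note lm = Lin_lin[OF B.mul_Lin] and lu = Lin_lin[OF B.unit_Lin] and lD = Lin_lin[OF B.comul_Lin]
    and le = Lin_lin[OF B.counit_Lin] and lc = Lin_lin[OF B.braid_Lin]
  note V2 = vspace_tens[OF V V] and W2 = vspace_tens[OF U U] and sK = vspace_selfK[OF V]
  let ?V2 = "tens K B B" and ?W2 = "tens K U U"
  let ?p2 = "tmap K B B U U p p"
  note lp2 = lin_tmap[OF V V U U p p]
  have s2: "?p2 ` carrier ?V2 = carrier ?W2" by (rule tmap_surj[OF V V U U p p surj surj])
  obtain s where s: "lin K U B s" "\<And>v. v \<in> carrier B \<Longrightarrow> p (s (p v)) = p v"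
    using quasi_inverse_exists[OF V U p] by blast
  have ps: "p (s X) = X" if "X \<in> carrier U" for X using s(2) that surj by (metis imageE)
  note ls2 = lin_tmap[OF U U B.vspace_axioms B.vspace_axioms s(1) s(1)]
  let ?s2 = "tmap K U U B B s s"
  define T where "T = \<lparr>mul = restrict (\<lambda>z. p (mul S (?s2 z))) (carrier ?W2),
     unt = restrict (\<lambda>k. p (unt S k)) (carrier (self K)),
     comul = restrict (\<lambda>X. ?p2 (comul S (s X))) (carrier U),
     counit = restrict (\<lambda>X. counit S (s X)) (carrier U),
     braid = restrict (\<lambda>z. ?p2 (braid S (?s2 z))) (carrier ?W2)\<rparr>"
  have TL: "mul T \<in> Lin K (tens K U U) U" "unt T \<in> Lin K (self K) U"
      "comul T \<in> Lin K U (tens K U U)" "counit T \<in> Lin K U (self K)"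
      "braid T \<in> Lin K (tens K U U) (tens K U U)"
    unfolding T_def bb_data.simps
    by (rule Lin_restrict[OF W2 lin_comp[OF p lin_comp[OF lm ls2]]]
        Lin_restrict[OF sK lin_comp[OF p lu]] Lin_restrict[OF U lin_comp[OF lp2 lin_comp[OF lD s(1)]]]
        Lin_restrict[OF U lin_comp[OF le s(1)]] Lin_restrict[OF W2 lin_comp[OF lp2 lin_comp[OF lc ls2]]])+
  have km1: "p (mul S (pure K B B x y)) = \<zero>\<^bsub>U\<^esub>"
    and kc1: "?p2 (braid S (pure K B B x y)) = \<zero>\<^bsub>?W2\<^esub>"
    if "x \<in> carrier B" "y \<in> carrier B" "p x = \<zero>\<^bsub>U\<^esub>" for x y
    using ker[OF that] by blast+
  have km2: "p (mul S (pure K B B x y)) = \<zero>\<^bsub>U\<^esub>"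
    and kc2: "?p2 (braid S (pure K B B x y)) = \<zero>\<^bsub>?W2\<^esub>"
    if "x \<in> carrier B" "y \<in> carrier B" "p y = \<zero>\<^bsub>U\<^esub>" for x y
    using ker[OF that(2,1,3)] by blast+
  have ke: "counit S x = \<zero>\<^bsub>self K\<^esub>" if "x \<in> carrier B" "p x = \<zero>\<^bsub>U\<^esub>" for x
    using kere[OF that] by (simp add: self_simps)
  have hom: "braided_bialgebra_hom K B S U T p"
    unfolding braided_bialgebra_hom_def
  proof (intro conjI ballI)
    fix z assume z: "z \<in> carrier ?V2"
    have "p (mul S (?s2 (?p2 z))) = p (mul S z)"
      by (rule tens_factor[OF V U p s(1) ps U lin_comp[OF p lm]]) (simp_all add: km1 km2 z)
    moreover have "mul T (?p2 z) = p (mul S (?s2 (?p2 z)))"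
      unfolding T_def bb_data.simps by (rule restrict_apply'[OF lin_closed[OF lp2 z]])
    ultimately show "p (mul S z) = mul T (?p2 z)" by (simp only:)
    have "?p2 (braid S (?s2 (?p2 z))) = ?p2 (braid S z)"
      by (rule tens_factor[OF V U p s(1) ps W2 lin_comp[OF lp2 lc]]) (simp_all add: kc1 kc2 z)
    moreover have "braid T (?p2 z) = ?p2 (braid S (?s2 (?p2 z)))"
      unfolding T_def bb_data.simps by (rule restrict_apply'[OF lin_closed[OF lp2 z]])
    ultimately show "braid T (?p2 z) = ?p2 (braid S z)" by (simp only:)
  next
    fix x assume x: "x \<in> carrier B"
    have "?p2 (comul S (s (p x))) = ?p2 (comul S x)"
      by (rule lin_factor[OF V U p s(1) ps W2 lin_comp[OF lp2 lD]]) (simp_all add: kerD x)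
    moreover have "comul T (p x) = ?p2 (comul S (s (p x)))"
      unfolding T_def bb_data.simps by (rule restrict_apply'[OF lin_closed[OF p x]])
    ultimately show "comul T (p x) = ?p2 (comul S x)" by (simp only:)
  next
    fix x assume x: "x \<in> carrier B"
    have "counit S (s (p x)) = counit S x"
      by (rule lin_factor[OF V U p s(1) ps sK le]) (simp_all add: ke x)
    moreover have "counit T (p x) = counit S (s (p x))"
      unfolding T_def bb_data.simps by (rule restrict_apply'[OF lin_closed[OF p x]])
    ultimately show "counit T (p x) = counit S x" by (simp only:)
  next
    show "p \<in> Lin K B U" by (rule pL)
  next
    fix k assume "k \<in> carrier K"
    then have "k \<in> carrier (self K)" by (simp only: self_simps)
    then show "p (unt S k) = unt T k"
      unfolding T_def bb_data.simps by (rule restrict_apply'[symmetric])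
  qed
  have ex: "braided_bialgebra K U T"
    by (rule braided_bialgebra_transfer[OF BB U surj TL hom])
  show ?thesis
  proof (rule ex1I[of _ T])
    show "braided_bialgebra K U T \<and> braided_bialgebra_hom K B S U T p" using ex hom by blast
    fix T' :: "('k, 'u) bb_data"
    assume T': "braided_bialgebra K U T' \<and> braided_bialgebra_hom K B S U T' p"
    interpret T': braided_bialgebra K U T' by (rule conjunct1[OF T'])
    note h = hom[unfolded braided_bialgebra_hom_def, THEN conjunct2]
      and h' = conjunct2[OF T', unfolded braided_bialgebra_hom_def, THEN conjunct2]
    note hm = h[THEN conjunct1] h'[THEN conjunct1]
      and hu = h[THEN conjunct2, THEN conjunct1] h'[THEN conjunct2, THEN conjunct1]
      and hD = h[THEN conjunct2, THEN conjunct2, THEN conjunct1]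
        h'[THEN conjunct2, THEN conjunct2, THEN conjunct1]
      and he = h[THEN conjunct2, THEN conjunct2, THEN conjunct2, THEN conjunct1]
        h'[THEN conjunct2, THEN conjunct2, THEN conjunct2, THEN conjunct1]
      and hc = h[THEN conjunct2, THEN conjunct2, THEN conjunct2, THEN conjunct2]
        h'[THEN conjunct2, THEN conjunct2, THEN conjunct2, THEN conjunct2]
    have on1: "f X = g X" if X: "X \<in> carrier U" and e: "\<And>x. x \<in> carrier B \<Longrightarrow> f (p x) = g (p x)"
      for f g :: "'u \<Rightarrow> 'q" and X
    proof -
      obtain x where "x \<in> carrier B" "X = p x" using X surj by blast
      then show ?thesis using e by simp
    qed
    have on2: "f X = g X" if X: "X \<in> carrier ?W2" and e: "\<And>x. x \<in> carrier ?V2 \<Longrightarrow> f (?p2 x) = g (?p2 x)"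
      for f g :: "('u \<times> 'u \<Rightarrow> 'k) set \<Rightarrow> 'q" and X
    proof -
      obtain x where "x \<in> carrier ?V2" "X = ?p2 x" using X s2 by blast
      then show ?thesis using e by simp
    qed
    have "mul T' = mul T"
    proof (rule Lin_eqI[OF T'.mul_Lin TL(1)])
      fix X assume X: "X \<in> carrier ?W2"
      then show "mul T' X = mul T X"
        by (rule on2) (use bspec[OF hm(1)] bspec[OF hm(2)] in metis)
    qed
    moreover have "unt T' = unt T"
    proof (rule Lin_eqI[OF T'.unit_Lin TL(2)])
      fix X assume X: "X \<in> carrier (self K)"
      then have "X \<in> carrier K" by (simp only: self_simps)
      then show "unt T' X = unt T X" using bspec[OF hu(1)] bspec[OF hu(2)] by metis
    qed
    moreover have "comul T' = comul T"
    proof (rule Lin_eqI[OF T'.comul_Lin TL(3)])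
      fix X assume X: "X \<in> carrier U"
      then show "comul T' X = comul T X"
        by (rule on1) (use bspec[OF hD(1)] bspec[OF hD(2)] in metis)
    qed
    moreover have "counit T' = counit T"
    proof (rule Lin_eqI[OF T'.counit_Lin TL(4)])
      fix X assume X: "X \<in> carrier U"
      then show "counit T' X = counit T X"
        by (rule on1) (use bspec[OF he(1)] bspec[OF he(2)] in metis)
    qed
    moreover have "braid T' = braid T"
    proof (rule Lin_eqI[OF T'.braid_Lin TL(5)])
      fix X assume X: "X \<in> carrier ?W2"
      then show "braid T' X = braid T X"
        by (rule on2) (use bspec[OF hc(1)] bspec[OF hc(2)] in metis)
    qed
    ultimately show "T' = T" by simp
  qed
qed

section \<open>Compatibility of braiding and comultiplication with products\<close>

lemma submodule_Inter_kernel: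
  assumes V: "vspace K V" and W: "vspace K W" and H: "submodule H K W"
    and f: "\<And>y. y \<in> Y \<Longrightarrow> lin K V W (f y)"
  shows "submodule {x \<in> carrier V. \<forall>y\<in>Y. f y x \<in> H} K V"
proof -
  interpret V: vspace K V by (rule V)
  note Hc = submodule_closed[OF W H]
  show ?thesis
    by (rule submoduleI_vspace[OF V])
       (use Hc in \<open>auto simp: lin_zero[OF V W f] lin_add[OF f] lin_smult[OF f]\<close>)
qed

lemma lin_pure_zero:
  assumes "vspace K V" "vspace K W"
  shows "y \<in> carrier W \<Longrightarrow> pure K V W \<zero>\<^bsub>V\<^esub> y = \<zero>\<^bsub>tens K V W\<^esub>"
    and "x \<in> carrier V \<Longrightarrow> pure K V W x \<zero>\<^bsub>W\<^esub> = \<zero>\<^bsub>tens K V W\<^esub>"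
  using lin_zero[OF assms(1) vspace_tens[OF assms] lin_pure_left[OF assms]]
    lin_zero[OF assms(2) vspace_tens[OF assms] lin_pure_right[OF assms]] by auto

text \<open>
  The subspace \<open>F \<otimes> V + V \<otimes> F\<close> of \<open>V \<otimes> V\<close>.
\<close>

definition tsum :: "('k, 'l) ring_scheme \<Rightarrow> ('k, 'v, 'm) module_scheme \<Rightarrow> 'v set \<Rightarrow> ('v \<times> 'v \<Rightarrow> 'k) set set" where
  "tsum K V F = lspan K (tens K V V)
     {pure K V V x y | x y. x \<in> carrier V \<and> y \<in> carrier V \<and> (x \<in> F \<or> y \<in> F)}"

context
  fixes K :: "('k, 'l) ring_scheme" and V :: "('k, 'v, 'm) module_scheme"
  assumes V: "vspace K V"
begin

lemma tsum_gens: "{pure K V V x y | x y. x \<in> carrier V \<and> y \<in> carrier V \<and> (x \<in> F \<or> y \<in> F)}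
    \<subseteq> carrier (tens K V V)"
  by (auto intro!: pure_closed[OF V V])

lemma submodule_tsum: "submodule (tsum K V F) K (tens K V V)"
  unfolding tsum_def by (rule lspan_submodule[OF vspace_tens[OF V V] tsum_gens])

lemma pure_tsum: "x \<in> carrier V \<Longrightarrow> y \<in> carrier V \<Longrightarrow> x \<in> F \<or> y \<in> F \<Longrightarrow> pure K V V x y \<in> tsum K V F"
  unfolding tsum_def by (rule lspan_incl) blast

lemma lin_tsum:
  assumes "vspace K P" "lin K (tens K V V) P f" "submodule H K P"
    and e: "\<And>x y. x \<in> carrier V \<Longrightarrow> y \<in> carrier V \<Longrightarrow> x \<in> F \<or> y \<in> F \<Longrightarrow> f (pure K V V x y) \<in> H"
    and "z \<in> tsum K V F"
  shows "f z \<in> H"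
proof (rule lin_lspan[OF vspace_tens[OF V V] assms(1-3) tsum_gens _ assms(5)[unfolded tsum_def]])
  fix x assume "x \<in> {pure K V V x y | x y. x \<in> carrier V \<and> y \<in> carrier V \<and> (x \<in> F \<or> y \<in> F)}"
  then show "f x \<in> H" using e by auto
qed

lemma tsum_mono: "F \<subseteq> F' \<Longrightarrow> tsum K V F \<subseteq> tsum K V F'"
  unfolding tsum_def by (rule lspan_least[OF lspan_submodule[OF vspace_tens[OF V V] tsum_gens]])
    (auto intro!: lspan_incl)

end

context braided_bialgebra
begin

abbreviation (input) "BB \<equiv> tens K B B"
abbreviation (input) "pr \<equiv> pure K B B"
abbreviation (input) "tm \<equiv> tmap K B B B B"
abbreviation (input) "tsp \<equiv> tspan K B B"
abbreviation (input) "prd x y \<equiv> mul S (pure K B B x y)"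

lemmas vsB = vspace_axioms and vsBB = vspace_tens[OF vspace_axioms vspace_axioms]
lemmas lin_mul = Lin_lin[OF mul_Lin] and lin_comul = Lin_lin[OF comul_Lin]
  and lin_counit = Lin_lin[OF counit_Lin] and lin_braid = Lin_lin[OF braid_Lin]
  and lin_unit = Lin_lin[OF unit_Lin] and lin_id = lin_idm[OF vsB]
lemmas lin_tm = lin_tmap[OF vsB vsB vsB vsB] and tm_pure = tmap_pure[OF vsB vsB vsB vsB]
  and tm_comp = tmap_comp[OF vsB vsB vsB vsB vsB vsB]
  and submodule_tsp = submodule_tspan[OF vsB vsB] and tsp_closed = tspan_closed[OF vsB vsB]
  and lin_tinclB = lin_tincl[OF vsB vsB] and tincl_pureB = tincl_pure[OF vsB vsB]
  and lin_pr_left = lin_pure_left[OF vsB vsB] and lin_pr_right = lin_pure_right[OF vsB vsB]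

lemma pr_closed: "x \<in> carrier B \<Longrightarrow> y \<in> carrier B \<Longrightarrow> pr x y \<in> carrier BB"
  by (rule pure_closed[OF vsB vsB])

lemma prd_closed: "x \<in> carrier B \<Longrightarrow> y \<in> carrier B \<Longrightarrow> prd x y \<in> carrier B"
  by (rule lin_closed[OF lin_mul pr_closed])

lemma unit_closed: "unt S \<one>\<^bsub>K\<^esub> \<in> carrier B"
  using lin_closed[OF lin_unit, of "\<one>\<^bsub>K\<^esub>"] by (simp add: self_simps)

lemma lin_prd_left: "y \<in> carrier B \<Longrightarrow> lin K B B (\<lambda>x. prd x y)"
  by (rule lin_comp[OF lin_mul lin_pr_left])

lemma lin_prd_right: "x \<in> carrier B \<Longrightarrow> lin K B B (\<lambda>y. prd x y)"
  by (rule lin_comp[OF lin_mul lin_pr_right])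

lemma prd_assoc:
  assumes "x \<in> carrier B" "y \<in> carrier B" "z \<in> carrier B"
  shows "prd (prd x y) z = prd x (prd y z)"
  using mul_assoc[OF pure_closed[OF vsBB vsB pr_closed[OF assms(1,2)] assms(3)]] assms
  by (simp add: tmap_pure[OF vsBB vsB vsB vsB lin_mul lin_idm[OF vsB]] tmap_pure[OF vsB vsBB vsB vsB lin_idm[OF vsB] lin_mul]
      asc_pure[OF vsB vsB vsB] idm_apply pr_closed)

lemma ring_underlying: "ring (underlying_ring K B S)"
proof (rule ringI)
  show "abelian_group (underlying_ring K B S)"
  proof (rule abelian_groupI)
    fix x assume "x \<in> carrier (underlying_ring K B S)"
    then show "\<exists>y\<in>carrier (underlying_ring K B S). y \<oplus>\<^bsub>underlying_ring K B S\<^esub> x = \<zero>\<^bsub>underlying_ring K B S\<^esub>"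
      by (intro bexI[of _ "\<ominus>\<^bsub>B\<^esub> x"]) (auto simp: underlying_ring_def M.l_neg)
  qed (auto simp: underlying_ring_def M.a_ac)
  show "monoid (underlying_ring K B S)"
    by (rule monoidI) (auto simp: underlying_ring_def prd_closed unit_closed prd_assoc unit_left unit_right)
qed (auto simp: underlying_ring_def lin_add[OF lin_prd_left] lin_add[OF lin_prd_right])

lemma ideal_underlying:
  assumes J: "submodule J K B"
    and l: "\<And>a x. a \<in> carrier B \<Longrightarrow> x \<in> J \<Longrightarrow> prd a x \<in> J"
    and r: "\<And>a x. a \<in> carrier B \<Longrightarrow> x \<in> J \<Longrightarrow> prd x a \<in> J"
  shows "ideal J (underlying_ring K B S)"
proof (rule idealI[OF ring_underlying])
  interpret R: ring "underlying_ring K B S" by (rule ring_underlying)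
  note Jc = submodule_closed[OF vsB J]
  show "subgroup J (add_monoid (underlying_ring K B S))"
  proof (rule R.add.subgroupI)
    show "J \<subseteq> carrier (underlying_ring K B S)" using Jc(2) by (auto simp: underlying_ring_def)
    show "J \<noteq> {}" using Jc(1) by blast
    fix a assume a: "a \<in> J"
    have "\<ominus>\<^bsub>underlying_ring K B S\<^esub> a = \<ominus>\<^bsub>B\<^esub> a"
      by (simp add: a_inv_def m_inv_def underlying_ring_def)
    then show "\<ominus>\<^bsub>underlying_ring K B S\<^esub> a \<in> J" using submoduleE(3)[OF J a] by simp
    fix b assume "b \<in> J"
    then show "a \<oplus>\<^bsub>underlying_ring K B S\<^esub> b \<in> J" using Jc(3)[OF a] by (simp add: underlying_ring_def)
  qed
qed (use l r in \<open>simp_all add: underlying_ring_def\<close>)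

lemma genideal_subset:
  assumes "submodule J K B" "F \<subseteq> J"
    and "\<And>a x. a \<in> carrier B \<Longrightarrow> x \<in> J \<Longrightarrow> prd a x \<in> J"
    and "\<And>a x. a \<in> carrier B \<Longrightarrow> x \<in> J \<Longrightarrow> prd x a \<in> J"
  shows "Idl\<^bsub>underlying_ring K B S\<^esub> F \<subseteq> J"
  by (rule ring.genideal_minimal[OF ring_underlying ideal_underlying[OF assms(1,3,4)] assms(2)])

lemma genideal_props:
  assumes F: "F \<subseteq> carrier B"
  defines "I \<equiv> Idl\<^bsub>underlying_ring K B S\<^esub> F"
  shows "F \<subseteq> I" "submodule I K B"
    "\<And>a x. a \<in> carrier B \<Longrightarrow> x \<in> I \<Longrightarrow> prd a x \<in> I"
    "\<And>a x. a \<in> carrier B \<Longrightarrow> x \<in> I \<Longrightarrow> prd x a \<in> I"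
proof -
  interpret R: ring "underlying_ring K B S" by (rule ring_underlying)
  have F': "F \<subseteq> carrier (underlying_ring K B S)" using F by (simp add: underlying_ring_def)
  show "F \<subseteq> I" unfolding I_def by (rule R.genideal_self[OF F'])
  interpret I: ideal I "underlying_ring K B S" unfolding I_def by (rule R.genideal_ideal[OF F'])
  show l: "prd a x \<in> I" if "a \<in> carrier B" "x \<in> I" for a x
    using I.I_l_closed[of x a] that by (simp add: underlying_ring_def)
  show "prd x a \<in> I" if "a \<in> carrier B" "x \<in> I" for a x
    using I.I_r_closed[of x a] that by (simp add: underlying_ring_def)
  have sub: "I \<subseteq> carrier B" using I.a_subset by (simp add: underlying_ring_def)
  \<comment> \<open>A scalar acts as the multiplication by a multiple of the unit.\<close>
  have sc: "k \<odot>\<^bsub>B\<^esub> x \<in> I" if k: "k \<in> carrier K" and x: "x \<in> I" for k x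
  proof -
    have xc: "x \<in> carrier B" using x sub by blast
    have "prd (k \<odot>\<^bsub>B\<^esub> unt S \<one>\<^bsub>K\<^esub>) x = k \<odot>\<^bsub>B\<^esub> x"
      using lin_smult[OF lin_prd_left[OF xc] k unit_closed] unit_left[OF xc] by simp
    moreover have "prd (k \<odot>\<^bsub>B\<^esub> unt S \<one>\<^bsub>K\<^esub>) x \<in> I"
      by (rule l[OF smult_closed[OF k unit_closed] x])
    ultimately show ?thesis by simp
  qed
  have ad: "x \<oplus>\<^bsub>B\<^esub> y \<in> I" if "x \<in> I" "y \<in> I" for x y
    using I.a_closed[OF that] by (simp add: underlying_ring_def)
  have ze: "\<zero>\<^bsub>B\<^esub> \<in> I" using I.zero_closed by (simp add: underlying_ring_def)
  show "submodule I K B" by (rule submoduleI_vspace[OF vsB sub ze ad sc])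
qed

text \<open>
  The composites that occur in the braiding of a product. For \<open>w = p \<otimes> q\<close> the first is
  \<open>p \<otimes> q s\<close> and the third is \<open>r p \<otimes> q\<close>. For \<open>w = c(x \<otimes> y)\<close> the second is
  \<open>c(a x \<otimes> y)\<close> and the fourth is \<open>c(x \<otimes> y a)\<close>.
\<close>

definition "mul_leg_right w s = tmap K B BB B B (idm B) (mul S) (asc K B B B (pure K BB B w s))"
definition "pass_left a w = tmap K B BB B B (idm B) (mul S) (asc K B B B (br12 K B (braid S) (asc_inv K B B B (pure K B BB a w))))"
definition "mul_leg_left r w = tmap K BB B B B (mul S) (idm B) (asc_inv K B B B (pure K B BB r w))"
definition "pass_right w a = tmap K BB B B B (mul S) (idm B) (br23 K B (braid S) (pure K BB B w a))"

lemmas tm_r = tmap_pure[OF vsB vsBB vsB vsB lin_idm[OF vsB] lin_mul]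
  and tm_l = tmap_pure[OF vsBB vsB vsB vsB lin_mul lin_idm[OF vsB]]
  and ltm_r = lin_tmap[OF vsB vsBB vsB vsB lin_idm[OF vsB] lin_mul] and ltm_l = lin_tmap[OF vsBB vsB vsB vsB lin_mul lin_idm[OF vsB]]
  and lasc = lin_asc[OF vsB vsB vsB] and lasci = lin_asc_inv[OF vsB vsB vsB]
  and l12 = lin_br12[OF vsB lin_braid] and l23 = lin_br23[OF vsB lin_braid]

lemma lin_mul_leg_right: "s \<in> carrier B \<Longrightarrow> lin K BB BB (\<lambda>w. mul_leg_right w s)"
  unfolding mul_leg_right_def by (intro lin_comp[OF ltm_r] lin_comp[OF lasc] lin_pure_left vsB vsBB)

lemma mul_leg_right_pure: "p \<in> carrier B \<Longrightarrow> q \<in> carrier B \<Longrightarrow> s \<in> carrier B \<Longrightarrow> mul_leg_right (pr p q) s = pr p (prd q s)"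
  unfolding mul_leg_right_def by (simp add: asc_pure[OF vsB vsB vsB] tm_r idm_apply pr_closed)

lemma lin_pass_left: "a \<in> carrier B \<Longrightarrow> lin K BB BB (pass_left a)"
  unfolding pass_left_def[abs_def]
  by (intro lin_comp[OF ltm_r] lin_comp[OF lasc] lin_comp[OF l12] lin_comp[OF lasci] lin_pure_right vsB vsBB)

lemma pass_left_pure: "a \<in> carrier B \<Longrightarrow> r \<in> carrier B \<Longrightarrow> s \<in> carrier B \<Longrightarrow> pass_left a (pr r s) = mul_leg_right (braid S (pr a r)) s"
  unfolding pass_left_def mul_leg_right_def by (simp add: asc_inv_pure[OF vsB vsB vsB] br12_pure[OF vsB lin_braid] pr_closed)

lemma braid_prd_left:
  assumes "a \<in> carrier B" "x \<in> carrier B" "y \<in> carrier B"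
  shows "braid S (pr (prd a x) y) = pass_left a (braid S (pr x y))"
  using braid_mul_left[OF pure_closed[OF vsBB vsB pr_closed[OF assms(1,2)] assms(3)]] assms
  by (simp add: tm_l idm_apply pr_closed br23_pure[OF vsB lin_braid] pass_left_def)

lemma lin_mul_leg_left: "r \<in> carrier B \<Longrightarrow> lin K BB BB (mul_leg_left r)"
  unfolding mul_leg_left_def[abs_def] by (intro lin_comp[OF ltm_l] lin_comp[OF lasci] lin_pure_right vsB vsBB)

lemma mul_leg_left_pure: "r \<in> carrier B \<Longrightarrow> p \<in> carrier B \<Longrightarrow> q \<in> carrier B \<Longrightarrow> mul_leg_left r (pr p q) = pr (prd r p) q"
  unfolding mul_leg_left_def by (simp add: asc_inv_pure[OF vsB vsB vsB] tm_l idm_apply pr_closed)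

lemma lin_pass_right: "a \<in> carrier B \<Longrightarrow> lin K BB BB (\<lambda>w. pass_right w a)"
  unfolding pass_right_def by (intro lin_comp[OF ltm_l] lin_comp[OF l23] lin_pure_left vsB vsBB)

lemma pass_right_pure: "r \<in> carrier B \<Longrightarrow> s \<in> carrier B \<Longrightarrow> a \<in> carrier B \<Longrightarrow> pass_right (pr r s) a = mul_leg_left r (braid S (pr s a))"
  unfolding pass_right_def mul_leg_left_def by (simp add: br23_pure[OF vsB lin_braid])

lemma braid_prd_right:
  assumes "x \<in> carrier B" "y \<in> carrier B" "a \<in> carrier B"
  shows "braid S (pr x (prd y a)) = pass_right (braid S (pr x y)) a"
  using braid_mul_right[OF pure_closed[OF vsBB vsB pr_closed[OF assms(1,2)] assms(3)]] assms
  by (simp add: tm_r idm_apply pr_closed br12_pure[OF vsB lin_braid] pass_right_def asc_pure[OF vsB vsB vsB])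

text \<open>
  The second map is the braided product of \<open>B \<otimes> B\<close>. On pure tensors it is expressed by the first
  map, which sends \<open>a \<otimes> b\<close> to \<open>p a \<otimes> b s\<close>.
\<close>

definition "mul_legs p w s = tmap K BB BB B B (mul S) (mul S)
    (asc_inv K B B BB (pure K B (tens K B BB) p (asc K B B B (pure K BB B w s))))"
definition "tens_mul w w' = tmap K BB BB B B (mul S) (mul S) (br_mid K B (braid S) (pure K BB BB w w'))"

lemmas ltmm = lin_tmap[OF vsBB vsBB vsB vsB lin_mul lin_mul]

lemma lin_mul_legs: "p \<in> carrier B \<Longrightarrow> s \<in> carrier B \<Longrightarrow> lin K BB BB (\<lambda>w. mul_legs p w s)"
  unfolding mul_legs_def
  by (intro lin_comp[OF ltmm] lin_comp[OF lin_asc_inv[OF vsB vsB vsBB]]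
      lin_comp[OF lin_pure_right[OF vsB vspace_tens[OF vsB vsBB]]] lin_comp[OF lasc] lin_pure_left vsB vsBB)

lemma mul_legs_pure: "p \<in> carrier B \<Longrightarrow> a \<in> carrier B \<Longrightarrow> b \<in> carrier B \<Longrightarrow> s \<in> carrier B \<Longrightarrow>
    mul_legs p (pr a b) s = pr (prd p a) (prd b s)"
  unfolding mul_legs_def
  by (simp add: asc_pure[OF vsB vsB vsB] asc_inv_pure[OF vsB vsB vsBB] tmap_pure[OF vsBB vsBB vsB vsB lin_mul lin_mul] pr_closed)

lemma lin_tens_mul_left: "w' \<in> carrier BB \<Longrightarrow> lin K BB BB (\<lambda>w. tens_mul w w')"
  unfolding tens_mul_def by (intro lin_comp[OF ltmm] lin_comp[OF lin_br_mid[OF vsB lin_braid]] lin_pure_left vsBB)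

lemma lin_tens_mul_right: "w \<in> carrier BB \<Longrightarrow> lin K BB BB (tens_mul w)"
  unfolding tens_mul_def[abs_def] by (intro lin_comp[OF ltmm] lin_comp[OF lin_br_mid[OF vsB lin_braid]] lin_pure_right vsBB)

lemma tens_mul_pure: "p \<in> carrier B \<Longrightarrow> q \<in> carrier B \<Longrightarrow> r \<in> carrier B \<Longrightarrow> s \<in> carrier B \<Longrightarrow>
    tens_mul (pr p q) (pr r s) = mul_legs p (braid S (pr q r)) s"
  unfolding tens_mul_def mul_legs_def by (simp add: br_mid_pure[OF vsB lin_braid])

lemma comul_prd: "x \<in> carrier B \<Longrightarrow> y \<in> carrier B \<Longrightarrow> comul S (prd x y) = tens_mul (comul S x) (comul S y)"
  using comul_mul[OF pr_closed] by (simp add: tmap_pure[OF vsB vsB vsBB vsBB lin_comul lin_comul] tens_mul_def)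

section \<open>Quotients by generated ideals\<close>

context
  fixes F
  assumes F: "F \<subseteq> carrier B"
    and F1: "\<And>x y. x \<in> F \<Longrightarrow> y \<in> carrier B \<Longrightarrow> braid S (pr x y) \<in> tsp (carrier B) F"
    and F2: "\<And>x y. x \<in> F \<Longrightarrow> y \<in> carrier B \<Longrightarrow> braid S (pr y x) \<in> tsp F (carrier B)"
    and F3: "\<And>x. x \<in> F \<Longrightarrow> comul S x \<in> tsum K B F"
    and F4: "\<And>x. x \<in> F \<Longrightarrow> counit S x = \<zero>\<^bsub>K\<^esub>"
begin

definition "gen_ideal = Idl\<^bsub>underlying_ring K B S\<^esub> F"

lemmas gen_ideal_props = genideal_props[OF F, folded gen_ideal_def]
lemmas gen_ideal_sub = submodule_closed[OF vsB gen_ideal_props(2)]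

lemma gen_ideal_subset: "gen_ideal \<subseteq> carrier B" using gen_ideal_sub(2) by blast

abbreviation (input) "Hr \<equiv> tsp (carrier B) gen_ideal"
abbreviation (input) "Hl \<equiv> tsp gen_ideal (carrier B)"

lemma sHr: "submodule Hr K BB" and sHl: "submodule Hl K BB"
  by (rule submodule_tsp[OF subset_refl gen_ideal_subset] submodule_tsp[OF gen_ideal_subset subset_refl])+

lemmas tens_into = lin_tens_into[OF vsB vsB _ vsBB]
lemmas Hr_into = lin_tspan[OF vsB vsB vsBB subset_refl gen_ideal_subset]
lemmas Hl_into = lin_tspan[OF vsB vsB vsBB gen_ideal_subset subset_refl]

text \<open>
  The elements \<open>x\<close> with \<open>c(x \<otimes> B) \<subseteq> B \<otimes> I\<close> form a two-sided ideal: in \<open>c(a x \<otimes> y)\<close> the tensor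
  \<open>c(x \<otimes> y)\<close> has its right leg in \<open>I\<close>, and this leg is not braided again but multiplied from the left;
  in \<open>c(x a \<otimes> y)\<close> the element \<open>x\<close> is braided with the left leg of \<open>c(a \<otimes> y)\<close>, which leaves an element
  of \<open>I\<close> to be multiplied by the right leg. The ideal contains \<open>F\<close> by assumption.
\<close>

lemma braid_ideal_left: "x \<in> gen_ideal \<Longrightarrow> y \<in> carrier B \<Longrightarrow> braid S (pr x y) \<in> Hr"
proof -
  define J where "J = {x \<in> carrier B. \<forall>y\<in>carrier B. braid S (pr x y) \<in> Hr}"
  have J: "submodule J K B" unfolding J_def
    by (rule submodule_Inter_kernel[OF vsB vsBB sHr]) (rule lin_comp[OF lin_braid lin_pr_left])
  have "gen_ideal \<subseteq> J" unfolding gen_ideal_def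
  proof (rule genideal_subset[OF J])
    show "F \<subseteq> J"
      using F1 tspan_mono[OF vsB vsB subset_refl gen_ideal_props(1) subset_refl gen_ideal_subset] F by (auto simp: J_def)
  next
    fix a x assume a: "a \<in> carrier B" and x: "x \<in> J"
    have xc: "x \<in> carrier B" using x by (simp add: J_def)
    show "prd a x \<in> J" unfolding J_def
    proof (intro CollectI conjI ballI prd_closed a xc)
      fix y assume y: "y \<in> carrier B"
      have w: "braid S (pr x y) \<in> Hr" using x y by (simp add: J_def)
      have "pass_left a (braid S (pr x y)) \<in> Hr"
      proof (rule Hr_into[OF lin_pass_left[OF a] sHr _ w])
        fix r s assume r: "r \<in> carrier B" and s: "s \<in> gen_ideal"
        have sc: "s \<in> carrier B" using s gen_ideal_subset by blast
        show "pass_left a (pr r s) \<in> Hr" unfolding pass_left_pure[OF a r sc]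
          by (rule tens_into[OF lin_mul_leg_right[OF sc] sHr _ lin_closed[OF lin_braid pr_closed[OF a r]]])
             (simp add: mul_leg_right_pure sc pure_tspan gen_ideal_props(3) s)
      qed
      then show "braid S (pr (prd a x) y) \<in> Hr" by (simp add: braid_prd_left[OF a xc y])
    qed
    show "prd x a \<in> J" unfolding J_def
    proof (intro CollectI conjI ballI prd_closed a xc)
      fix y assume y: "y \<in> carrier B"
      have "pass_left x (braid S (pr a y)) \<in> Hr"
      proof (rule tens_into[OF lin_pass_left[OF xc] sHr _ lin_closed[OF lin_braid pr_closed[OF a y]]])
        fix r s assume r: "r \<in> carrier B" and s: "s \<in> carrier B"
        have w: "braid S (pr x r) \<in> Hr" using x r by (simp add: J_def)
        show "pass_left x (pr r s) \<in> Hr" unfolding pass_left_pure[OF xc r s]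
          by (rule Hr_into[OF lin_mul_leg_right[OF s] sHr _ w])
             (simp add: mul_leg_right_pure s subsetD[OF gen_ideal_subset] pure_tspan gen_ideal_props(4))
      qed
      then show "braid S (pr (prd x a) y) \<in> Hr" by (simp add: braid_prd_left[OF xc a y])
    qed
  qed
  then show "x \<in> gen_ideal \<Longrightarrow> y \<in> carrier B \<Longrightarrow> braid S (pr x y) \<in> Hr" by (auto simp: J_def)
qed

lemma braid_ideal_right: "x \<in> gen_ideal \<Longrightarrow> y \<in> carrier B \<Longrightarrow> braid S (pr y x) \<in> Hl"
proof -
  define J where "J = {x \<in> carrier B. \<forall>y\<in>carrier B. braid S (pr y x) \<in> Hl}"
  have J: "submodule J K B" unfolding J_def
    by (rule submodule_Inter_kernel[OF vsB vsBB sHl]) (rule lin_comp[OF lin_braid lin_pr_right])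
  have "gen_ideal \<subseteq> J" unfolding gen_ideal_def
  proof (rule genideal_subset[OF J])
    show "F \<subseteq> J"
      using F2 tspan_mono[OF vsB vsB gen_ideal_props(1) subset_refl gen_ideal_subset subset_refl] F by (auto simp: J_def)
  next
    fix a x assume a: "a \<in> carrier B" and x: "x \<in> J"
    have xc: "x \<in> carrier B" using x by (simp add: J_def)
    show "prd x a \<in> J" unfolding J_def
    proof (intro CollectI conjI ballI prd_closed a xc)
      fix y assume y: "y \<in> carrier B"
      have w: "braid S (pr y x) \<in> Hl" using x y by (simp add: J_def)
      have "pass_right (braid S (pr y x)) a \<in> Hl"
      proof (rule Hl_into[OF lin_pass_right[OF a] sHl _ w])
        fix r s assume r: "r \<in> gen_ideal" and s: "s \<in> carrier B"
        have rc: "r \<in> carrier B" using r gen_ideal_subset by blast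
        show "pass_right (pr r s) a \<in> Hl" unfolding pass_right_pure[OF rc s a]
          by (rule tens_into[OF lin_mul_leg_left[OF rc] sHl _ lin_closed[OF lin_braid pr_closed[OF s a]]])
             (simp add: mul_leg_left_pure rc pure_tspan gen_ideal_props(4) r)
      qed
      then show "braid S (pr y (prd x a)) \<in> Hl" by (simp add: braid_prd_right[OF y xc a])
    qed
    show "prd a x \<in> J" unfolding J_def
    proof (intro CollectI conjI ballI prd_closed a xc)
      fix y assume y: "y \<in> carrier B"
      have "pass_right (braid S (pr y a)) x \<in> Hl"
      proof (rule tens_into[OF lin_pass_right[OF xc] sHl _ lin_closed[OF lin_braid pr_closed[OF y a]]])
        fix r s assume r: "r \<in> carrier B" and s: "s \<in> carrier B"
        have w: "braid S (pr s x) \<in> Hl" using x s by (simp add: J_def)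
        show "pass_right (pr r s) x \<in> Hl" unfolding pass_right_pure[OF r s xc]
          by (rule Hl_into[OF lin_mul_leg_left[OF r] sHl _ w])
             (simp add: mul_leg_left_pure r subsetD[OF gen_ideal_subset] pure_tspan gen_ideal_props(3))
      qed
      then show "braid S (pr y (prd a x)) \<in> Hl" by (simp add: braid_prd_right[OF y a xc])
    qed
  qed
  then show "x \<in> gen_ideal \<Longrightarrow> y \<in> carrier B \<Longrightarrow> braid S (pr y x) \<in> Hl" by (auto simp: J_def)
qed

abbreviation (input) "NN \<equiv> tsum K B gen_ideal"

text \<open>
  The outer factors \<open>p\<close> and \<open>s\<close> are not moved by the braiding in the middle, and \<open>q\<close> or \<open>r\<close> remains in
  \<open>I\<close> when it passes the other one.
\<close>

lemma tens_mul_ideal: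
  assumes c: "p \<in> carrier B" "q \<in> carrier B" "r \<in> carrier B" "s \<in> carrier B"
    and i: "p \<in> gen_ideal \<or> q \<in> gen_ideal \<or> r \<in> gen_ideal \<or> s \<in> gen_ideal"
  shows "tens_mul (pr p q) (pr r s) \<in> NN"
proof -
  note sN = submodule_tsum[OF vsB, of gen_ideal]
  note w = lin_closed[OF lin_braid pr_closed[OF c(2,3)]]
  have N: "mul_legs p (pr a b) s \<in> NN" if "a \<in> carrier B" "b \<in> carrier B" "p \<in> gen_ideal \<or> a \<in> gen_ideal \<or> b \<in> gen_ideal \<or> s \<in> gen_ideal" for a b
    unfolding mul_legs_pure[OF c(1) that(1,2) c(4)]
    by (rule pure_tsum[OF vsB prd_closed[OF c(1) that(1)] prd_closed[OF that(2) c(4)]])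
       (use that c gen_ideal_props(3,4) in blast)
  show ?thesis unfolding tens_mul_pure[OF c]
    using i
  proof (elim disjE)
    assume "p \<in> gen_ideal"
    then show "mul_legs p (braid S (pr q r)) s \<in> NN"
      by (intro tens_into[OF lin_mul_legs[OF c(1,4)] sN _ w]) (simp add: N)
  next
    assume "s \<in> gen_ideal"
    then show "mul_legs p (braid S (pr q r)) s \<in> NN"
      by (intro tens_into[OF lin_mul_legs[OF c(1,4)] sN _ w]) (simp add: N)
  next
    assume "q \<in> gen_ideal"
    then show "mul_legs p (braid S (pr q r)) s \<in> NN"
      by (intro Hr_into[OF lin_mul_legs[OF c(1,4)] sN _ braid_ideal_left[OF _ c(3)]]) (simp_all add: N subsetD[OF gen_ideal_subset])
  next
    assume "r \<in> gen_ideal"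
    then show "mul_legs p (braid S (pr q r)) s \<in> NN"
      by (intro Hl_into[OF lin_mul_legs[OF c(1,4)] sN _ braid_ideal_right[OF _ c(2)]]) (simp_all add: N subsetD[OF gen_ideal_subset])
  qed
qed

text \<open>
  As \<open>\<Delta>(a x)\<close> is the braided product of \<open>\<Delta> a\<close> and \<open>\<Delta> x\<close>, the elements \<open>x\<close> with
  \<open>\<Delta> x \<in> I \<otimes> B + B \<otimes> I\<close> form a two-sided ideal.
\<close>

lemma comul_ideal: "x \<in> gen_ideal \<Longrightarrow> comul S x \<in> NN"
proof -
  note sN = submodule_tsum[OF vsB, of gen_ideal]
  define J where "J = {x \<in> carrier B. comul S x \<in> NN}"
  have J: "submodule J K B" unfolding J_def by (rule submodule_kernel[OF vsB vsBB lin_comul sN])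
  have "gen_ideal \<subseteq> J" unfolding gen_ideal_def
  proof (rule genideal_subset[OF J])
    show "F \<subseteq> J" using F3 tsum_mono[OF vsB gen_ideal_props(1)] F by (auto simp: J_def)
  next
    fix a x assume a: "a \<in> carrier B" and x: "x \<in> J"
    have xc: "x \<in> carrier B" and xN: "comul S x \<in> NN" using x by (auto simp: J_def)
    note Dx = lin_closed[OF lin_comul xc] and Da = lin_closed[OF lin_comul a]
    have "tens_mul (comul S a) (comul S x) \<in> NN"
    proof (rule lin_tsum[OF vsB vsBB lin_tens_mul_right[OF Da] sN _ xN])
      fix r s assume c: "r \<in> carrier B" "s \<in> carrier B" "r \<in> gen_ideal \<or> s \<in> gen_ideal"
      show "tens_mul (comul S a) (pr r s) \<in> NN"
        by (rule tens_into[OF lin_tens_mul_left[OF pr_closed[OF c(1,2)]] sN _ Da]) (use c tens_mul_ideal in blast)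
    qed
    then show "prd a x \<in> J" by (simp add: J_def comul_prd a xc prd_closed)
    have "tens_mul (comul S x) (comul S a) \<in> NN"
    proof (rule lin_tsum[OF vsB vsBB lin_tens_mul_left[OF Da] sN _ xN])
      fix p q assume c: "p \<in> carrier B" "q \<in> carrier B" "p \<in> gen_ideal \<or> q \<in> gen_ideal"
      show "tens_mul (pr p q) (comul S a) \<in> NN"
        by (rule tens_into[OF lin_tens_mul_right[OF pr_closed[OF c(1,2)]] sN _ Da]) (use c tens_mul_ideal in blast)
    qed
    then show "prd x a \<in> J" by (simp add: J_def comul_prd a xc prd_closed)
  qed
  then show "x \<in> gen_ideal \<Longrightarrow> comul S x \<in> NN" by (auto simp: J_def)
qed

lemma counit_ideal: "x \<in> gen_ideal \<Longrightarrow> counit S x = \<zero>\<^bsub>K\<^esub>"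
proof -
  have eK: "counit S y \<in> carrier K" if "y \<in> carrier B" for y using lin_closed[OF lin_counit that] by (simp add: self_simps)
  define J where "J = {x \<in> carrier B. counit S x \<in> {\<zero>\<^bsub>self K\<^esub>}}"
  have J: "submodule J K B" unfolding J_def
    by (rule submodule_kernel[OF vsB vspace_selfK[OF vsB] lin_counit submodule_zero[OF vspace_selfK[OF vsB]]])
  have "gen_ideal \<subseteq> J" unfolding gen_ideal_def
    by (rule genideal_subset[OF J])
       (use F F4 eK in \<open>auto simp: J_def self_simps(4) prd_closed counit_mul\<close>)
  then show "x \<in> gen_ideal \<Longrightarrow> counit S x = \<zero>\<^bsub>K\<^esub>" by (auto simp: J_def self_simps(4))
qed

theorem quotient_by_generated_ideal:
  "\<exists>!T :: ('k, 'b set) bb_data. braided_bialgebra K (quot B gen_ideal) T \<and>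
     braided_bialgebra_hom K B S (quot B gen_ideal) T (quot_proj B gen_ideal)"
proof -
  let ?U = "quot B gen_ideal" and ?p = "quot_proj B gen_ideal"
  note I = gen_ideal_props(2)
  note U = vspace_quot[OF vsB I]
  have pa: "?p x = gen_ideal +>\<^bsub>B\<^esub> x" if "x \<in> carrier B" for x using that by (simp add: quot_proj_def)
  have pL: "?p \<in> Lin K B ?U" unfolding quot_proj_def by (rule Lin_restrict[OF vsB lin_coset[OF vsB I]])
  note p = Lin_lin[OF pL]
  have p0: "?p x = \<zero>\<^bsub>?U\<^esub> \<longleftrightarrow> x \<in> gen_ideal" if "x \<in> carrier B" for x
    using coset_eq_zero_iff[OF vsB I that] pa[OF that] by simp
  let ?p2 = "tmap K B B ?U ?U ?p ?p"
  note W2 = vspace_tens[OF U U] and lp2 = lin_tmap[OF vsB vsB U U p p]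
  note z = submodule_zero[OF W2]
  have pz: "?p2 (pr x y) \<in> {\<zero>\<^bsub>tens K ?U ?U\<^esub>}" if "x \<in> carrier B" "y \<in> carrier B" "x \<in> gen_ideal \<or> y \<in> gen_ideal" for x y
  proof -
    have "pure K ?U ?U (?p x) (?p y) = \<zero>\<^bsub>tens K ?U ?U\<^esub>"
      using that(3)
    proof (elim disjE)
      assume "x \<in> gen_ideal"
      then have "?p x = \<zero>\<^bsub>?U\<^esub>" using p0[OF that(1)] by blast
      then show ?thesis using lin_pure_zero(1)[OF U U lin_closed[OF p that(2)]] by simp
    next
      assume "y \<in> gen_ideal"
      then have "?p y = \<zero>\<^bsub>?U\<^esub>" using p0[OF that(2)] by blast
      then show ?thesis using lin_pure_zero(2)[OF U U lin_closed[OF p that(1)]] by simp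
    qed
    then show ?thesis by (simp add: tmap_pure[OF vsB vsB U U p p that(1,2)])
  qed
  have pr0: "?p2 w \<in> {\<zero>\<^bsub>tens K ?U ?U\<^esub>}" if "w \<in> Hr" for w
    by (rule lin_tspan[OF vsB vsB W2 subset_refl gen_ideal_subset lp2 z _ that], rule pz) (auto simp: subsetD[OF gen_ideal_subset])
  have pl0: "?p2 w \<in> {\<zero>\<^bsub>tens K ?U ?U\<^esub>}" if "w \<in> Hl" for w
    by (rule lin_tspan[OF vsB vsB W2 gen_ideal_subset subset_refl lp2 z _ that], rule pz) (auto simp: subsetD[OF gen_ideal_subset])
  have pN0: "?p2 w \<in> {\<zero>\<^bsub>tens K ?U ?U\<^esub>}" if "w \<in> NN" for w
    by (rule lin_tsum[OF vsB W2 lp2 z pz that])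
  show ?thesis
  proof (rule quotient_bialgebra[OF braided_bialgebra_axioms U pL])
    show "?p ` carrier B = carrier ?U" by (auto simp: quot_carrier pa)
    fix x assume x: "x \<in> carrier B" "?p x = \<zero>\<^bsub>?U\<^esub>"
    then have xI: "x \<in> gen_ideal" using p0 by blast
    show "?p2 (comul S x) = \<zero>\<^bsub>tens K ?U ?U\<^esub>" using pN0[OF comul_ideal[OF xI]] by simp
    show "counit S x = \<zero>\<^bsub>K\<^esub>" by (rule counit_ideal[OF xI])
    fix y assume y: "y \<in> carrier B"
    show "?p (prd x y) = \<zero>\<^bsub>?U\<^esub> \<and> ?p (prd y x) = \<zero>\<^bsub>?U\<^esub> \<and>
        ?p2 (braid S (pr x y)) = \<zero>\<^bsub>tens K ?U ?U\<^esub> \<and> ?p2 (braid S (pr y x)) = \<zero>\<^bsub>tens K ?U ?U\<^esub>"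
      using gen_ideal_props(3)[OF y xI] gen_ideal_props(4)[OF y xI] p0[OF prd_closed[OF x(1) y]] p0[OF prd_closed[OF y x(1)]]
        pr0[OF braid_ideal_left[OF xI y]] pl0[OF braid_ideal_right[OF xI y]] by simp
  qed
qed

lemmas quotient_by_Idl = quotient_by_generated_ideal[unfolded gen_ideal_def]

end
end

section \<open>Gradings and the reduced comultiplication\<close>

context graded_braided_bialgebra
begin

abbreviation (input) "E \<equiv> E_comp K B S G"
abbreviation (input) "pj \<equiv> grade_proj B G"

lemmas gc = submodule_closed[OF vsB grade_sub]

lemma Gsub: "G n \<subseteq> carrier B" using gc(2) by blast

lemma is_decompI:
  assumes f: "\<And>n. f n \<in> G n" and A: "finite A" and z: "\<And>n. n \<notin> A \<Longrightarrow> f n = \<zero>\<^bsub>B\<^esub>"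
  shows "is_decomp B G (finsum B f A) f"
  unfolding is_decomp_def
proof (intro conjI allI f)
  show fin: "finite {n. f n \<noteq> \<zero>\<^bsub>B\<^esub>}" by (rule finite_subset[OF _ A]) (use z in auto)
  show "finsum B f A = finsum B f {n. f n \<noteq> \<zero>\<^bsub>B\<^esub>}"
    by (rule M.add.finprod_mono_neutral_cong_right[OF A]) (use z f Gsub in auto)
qed

lemma decomp_finsum:
  assumes d: "is_decomp B G x f" and A: "finite A" "{n. f n \<noteq> \<zero>\<^bsub>B\<^esub>} \<subseteq> A"
  shows "x = finsum B f A"
proof -
  have "finsum B f {n. f n \<noteq> \<zero>\<^bsub>B\<^esub>} = finsum B f A"
    by (rule M.add.finprod_mono_neutral_cong_left[OF A]) (use d Gsub in \<open>auto simp: is_decomp_def\<close>)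
  then show ?thesis using d by (simp add: is_decomp_def)
qed

lemma decomp_closed: "is_decomp B G x f \<Longrightarrow> x \<in> carrier B"
  using Gsub by (auto simp: is_decomp_def intro!: M.finsum_closed)

lemma grade_proj_decomp:
  assumes d: "is_decomp B G x f"
  shows "pj n x = f n"
proof -
  note x = decomp_closed[OF d]
  have "(THE f. is_decomp B G x f) = f"
    by (rule the1_equality) (rule grade_decomp[OF x], rule d)
  then show ?thesis using x by (simp add: grade_proj_def)
qed

lemma decomp_ex: "x \<in> carrier B \<Longrightarrow> \<exists>f. is_decomp B G x f"
  using grade_decomp by blast

lemma lin_grade_proj: "lin K B B (pj n)"
proof (rule linI)
  fix x assume x: "x \<in> carrier B"
  obtain f where f: "is_decomp B G x f" using decomp_ex[OF x] by blast
  have fG: "\<And>n. f n \<in> G n" using f by (simp add: is_decomp_def)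
  let ?A = "{n. f n \<noteq> \<zero>\<^bsub>B\<^esub>}"
  have fin: "finite ?A" using f by (simp add: is_decomp_def)
  show "pj n x \<in> carrier B" using grade_proj_decomp[OF f] fG Gsub by auto
  fix k assume k: "k \<in> carrier K"
  have fB: "f \<in> ?A \<rightarrow> carrier B" using fG Gsub by blast
  have d: "is_decomp B G (finsum B (\<lambda>n. k \<odot>\<^bsub>B\<^esub> f n) ?A) (\<lambda>n. k \<odot>\<^bsub>B\<^esub> f n)"
    by (rule is_decompI[OF gc(5)[OF k fG] fin]) (use k in auto)
  have s: "finsum B (\<lambda>n. k \<odot>\<^bsub>B\<^esub> f n) ?A = k \<odot>\<^bsub>B\<^esub> x"
    using finsum_smult_ldistr[OF fin k fB] decomp_finsum[OF f fin subset_refl] by simp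
  show "pj n (k \<odot>\<^bsub>B\<^esub> x) = k \<odot>\<^bsub>B\<^esub> pj n x"
    unfolding grade_proj_decomp[OF d[unfolded s]] grade_proj_decomp[OF f] ..
next
  fix x y assume x: "x \<in> carrier B" and y: "y \<in> carrier B"
  obtain f where f: "is_decomp B G x f" using decomp_ex[OF x] by blast
  obtain g where g: "is_decomp B G y g" using decomp_ex[OF y] by blast
  have fG: "\<And>n. f n \<in> G n" using f by (simp add: is_decomp_def)
  have gG: "\<And>n. g n \<in> G n" using g by (simp add: is_decomp_def)
  let ?A = "{n. f n \<noteq> \<zero>\<^bsub>B\<^esub>} \<union> {n. g n \<noteq> \<zero>\<^bsub>B\<^esub>}"
  have fin: "finite ?A" using f g by (simp add: is_decomp_def)
  have fB: "f \<in> ?A \<rightarrow> carrier B" "g \<in> ?A \<rightarrow> carrier B" using fG gG Gsub by blast+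
  have d: "is_decomp B G (finsum B (\<lambda>n. f n \<oplus>\<^bsub>B\<^esub> g n) ?A) (\<lambda>n. f n \<oplus>\<^bsub>B\<^esub> g n)"
    by (rule is_decompI[OF gc(3)[OF fG gG] fin]) auto
  have s: "finsum B (\<lambda>n. f n \<oplus>\<^bsub>B\<^esub> g n) ?A = x \<oplus>\<^bsub>B\<^esub> y"
    using M.finsum_addf[OF fB] decomp_finsum[OF f fin] decomp_finsum[OF g fin] by simp
  show "pj n (x \<oplus>\<^bsub>B\<^esub> y) = pj n x \<oplus>\<^bsub>B\<^esub> pj n y"
    unfolding grade_proj_decomp[OF d[unfolded s]] grade_proj_decomp[OF f] grade_proj_decomp[OF g] ..
qed

lemma grade_proj_in: "x \<in> carrier B \<Longrightarrow> pj n x \<in> G n"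
proof -
  assume "x \<in> carrier B"
  then obtain f where f: "is_decomp B G x f" using decomp_ex by blast
  then show ?thesis unfolding grade_proj_decomp[OF f] by (simp add: is_decomp_def)
qed

lemma lin_grade_proj_sub: "lin K B (sub B (G n)) (pj n)"
  by (rule lin_sub_codI[OF lin_grade_proj grade_proj_in])

lemma grade_proj_homog:
  assumes x: "x \<in> G i"
  shows "pj n x = (if n = i then x else \<zero>\<^bsub>B\<^esub>)"
proof -
  let ?f = "\<lambda>m. if m = i then x else \<zero>\<^bsub>B\<^esub>"
  have d: "is_decomp B G (finsum B ?f {i}) ?f"
    by (rule is_decompI) (use x gc(1) in auto)
  have s: "finsum B ?f {i} = x"
    by (rule M.add.finprod_singleton_swap) (use x Gsub in auto)
  show ?thesis unfolding grade_proj_decomp[OF d[unfolded s]] ..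
qed

lemma homog_induct [consumes 1, case_names homog add]:
  assumes x: "x \<in> carrier B"
    and h: "\<And>n x. x \<in> G n \<Longrightarrow> Q x"
    and a: "\<And>x y. x \<in> carrier B \<Longrightarrow> y \<in> carrier B \<Longrightarrow> Q x \<Longrightarrow> Q y \<Longrightarrow> Q (x \<oplus>\<^bsub>B\<^esub> y)"
  shows "Q x"
proof -
  obtain f where f: "is_decomp B G x f" using decomp_ex[OF x] by blast
  have fG: "\<And>n. f n \<in> G n" using f by (simp add: is_decomp_def)
  have fB: "\<And>n. f n \<in> carrier B" using fG Gsub by blast
  have "Q (finsum B f A)" if "finite A" for A
    using that
  proof (induction A)
    case empty
    then show ?case using h[OF gc(1)] by simp
  next
    case (insert n A)
    have "finsum B f (insert n A) = f n \<oplus>\<^bsub>B\<^esub> finsum B f A"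
      by (rule M.finsum_insert) (use insert fB in auto)
    moreover have "finsum B f A \<in> carrier B" by (rule M.finsum_closed) (use fB in auto)
    ultimately show ?case using a[OF fB _ h[OF fG] insert.IH] by simp
  qed
  then have "Q (finsum B f {n. f n \<noteq> \<zero>\<^bsub>B\<^esub>})" using f by (simp add: is_decomp_def)
  then show ?thesis using f unfolding is_decomp_def by (elim conjE) (simp only:)
qed

text \<open>
  Maps that keep some homogeneous components and kill the others: the projections, the identity and
  the part of positive degree. The braiding exchanges the factors of homogeneous tensors and the
  comultiplication splits them by degree, so such maps can be moved through both of them.
\<close>

definition selector :: "(nat \<Rightarrow> bool) \<Rightarrow> ('b \<Rightarrow> 'b) \<Rightarrow> bool" where
  "selector \<sigma> g \<longleftrightarrow> lin K B B g \<and> (\<forall>i. \<forall>x\<in>G i. g x = (if \<sigma> i then x else \<zero>\<^bsub>B\<^esub>))"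

lemma selector_lin: "selector \<sigma> g \<Longrightarrow> lin K B B g"
  and selector_homog: "selector \<sigma> g \<Longrightarrow> x \<in> G i \<Longrightarrow> g x = (if \<sigma> i then x else \<zero>\<^bsub>B\<^esub>)"
  by (auto simp: selector_def)

lemma selector_idm: "selector (\<lambda>_. True) (idm B)"
  by (simp add: selector_def lin_id idm_apply subsetD[OF Gsub])

lemma selector_proj: "selector (\<lambda>i. n = i) (pj n)"
  by (auto simp: selector_def lin_grade_proj grade_proj_homog)

definition pos_part :: "'b \<Rightarrow> 'b" where "pos_part x = x \<ominus>\<^bsub>B\<^esub> pj 0 x"

lemma selector_pos_part: "selector (\<lambda>i. i \<noteq> 0) pos_part"
  unfolding selector_def
proof (intro conjI allI ballI)
  show "lin K B B pos_part" unfolding pos_part_def[abs_def] by (rule lin_diff[OF vsB vsB lin_ident lin_grade_proj])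
  fix i x assume x: "x \<in> G i"
  then have "x \<in> carrier B" using Gsub by blast
  then show "pos_part x = (if i \<noteq> 0 then x else \<zero>\<^bsub>B\<^esub>)"
    using vspace_diff_zero[OF vsB] minus_eq_zero_iff[OF vsB] x by (simp add: pos_part_def grade_proj_homog)
qed

lemmas lin_pos_part = selector_lin[OF selector_pos_part]

lemma selector_tspan:
  assumes g: "selector \<sigma> g" and h: "selector \<tau> h" and w: "w \<in> tsp (G i) (G j)"
  shows "tm g h w = (if \<sigma> i \<and> \<tau> j then w else \<zero>\<^bsub>BB\<^esub>)"
proof -
  note lg = selector_lin[OF g] and lh = selector_lin[OF h]
  interpret T: vspace K "BB" by (rule vsBB)
  have l0: "lin K BB BB (\<lambda>_. \<zero>\<^bsub>BB\<^esub>)"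
    by (rule linI) auto
  have l: "lin K BB BB (\<lambda>w. if \<sigma> i \<and> \<tau> j then w else \<zero>\<^bsub>BB\<^esub>)"
  proof (cases "\<sigma> i \<and> \<tau> j")
    case True
    show ?thesis unfolding if_P[OF True] by (rule lin_ident)
  next
    case False
    show ?thesis unfolding if_not_P[OF False] by (rule l0)
  qed
  show ?thesis
  proof (rule tspan_ext[OF vsB vsB vsBB Gsub Gsub lin_tm[OF lg lh] l _ w])
    fix x y assume x: "x \<in> G i" and y: "y \<in> G j"
    have c: "x \<in> carrier B" "y \<in> carrier B" using x y Gsub by auto
    show "tm g h (pr x y) = (if \<sigma> i \<and> \<tau> j then pr x y else \<zero>\<^bsub>BB\<^esub>)"
      using lin_pure_zero[OF vsB vsB] c
      by (simp add: tm_pure[OF lg lh] selector_homog[OF g x] selector_homog[OF h y])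
  qed
qed

lemma braid_grade: "x \<in> G i \<Longrightarrow> y \<in> G j \<Longrightarrow> braid S (pr x y) \<in> tsp (G j) (G i)"
  using grade_braid[of i j] pure_tspan[of x "G i" y "G j" K B B]
  unfolding tsub_tspan[OF vsB grade_sub grade_sub] by blast

lemma tens_homog_ext:
  assumes f: "lin K BB P f" and g: "lin K BB P g"
    and e: "\<And>i j x y. x \<in> G i \<Longrightarrow> y \<in> G j \<Longrightarrow> f (pr x y) = g (pr x y)"
    and z: "z \<in> carrier BB"
  shows "f z = g z"
proof (rule tens_ext[OF vsB vsB f g _ z])
  fix x y assume x: "x \<in> carrier B" and y: "y \<in> carrier B"
  have 1: "f (pr x y) = g (pr x y)" if x: "x \<in> G i" for i x
  proof -
    have "x \<in> carrier B" using x Gsub by blast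
    note l = lin_comp[OF f lin_pr_right[OF this]] lin_comp[OF g lin_pr_right[OF this]]
    from y show ?thesis
      by (induction rule: homog_induct) (simp_all add: e[OF x] lin_add[OF l(1)] lin_add[OF l(2)])
  qed
  note l = lin_comp[OF f lin_pr_left[OF y]] lin_comp[OF g lin_pr_left[OF y]]
  from x show "f (pr x y) = g (pr x y)"
    by (induction rule: homog_induct) (simp_all add: 1 lin_add[OF l(1)] lin_add[OF l(2)])
qed

text \<open>
  As \<open>c\<close> maps \<open>B\<^sup>i \<otimes> B\<^sup>j\<close> to \<open>B\<^sup>j \<otimes> B\<^sup>i\<close>, a condition on the degree of one factor becomes the same
  condition on the other factor.
\<close>

lemma braid_selector:
  assumes g: "selector \<sigma> g" and z: "z \<in> carrier BB"
  shows "tm (idm B) g (braid S z) = braid S (tm g (idm B) z)"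
    and "tm g (idm B) (braid S z) = braid S (tm (idm B) g z)"
proof -
  note lg = selector_lin[OF g]
  note t1 = lin_tm[OF lin_id lg] and t2 = lin_tm[OF lg lin_id]
  note c0 = lin_zero[OF vsBB vsBB lin_braid]
  show "tm (idm B) g (braid S z) = braid S (tm g (idm B) z)"
  proof (rule tens_homog_ext[OF lin_comp[OF t1 lin_braid] lin_comp[OF lin_braid t2] _ z])
    fix i j x y assume x: "x \<in> G i" and y: "y \<in> G j"
    have c: "x \<in> carrier B" "y \<in> carrier B" using x y Gsub by auto
    show "tm (idm B) g (braid S (pr x y)) =
        braid S (tm g (idm B) (pr x y))"
      unfolding selector_tspan[OF selector_idm g braid_grade[OF x y]]
      using lin_pure_zero[OF vsB vsB] c c0
      by (simp add: tm_pure[OF lg lin_id] selector_homog[OF g x] idm_apply)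
  qed
  show "tm g (idm B) (braid S z) = braid S (tm (idm B) g z)"
  proof (rule tens_homog_ext[OF lin_comp[OF t2 lin_braid] lin_comp[OF lin_braid t1] _ z])
    fix i j x y assume x: "x \<in> G i" and y: "y \<in> G j"
    have c: "x \<in> carrier B" "y \<in> carrier B" using x y Gsub by auto
    show "tm g (idm B) (braid S (pr x y)) =
        braid S (tm (idm B) g (pr x y))"
      unfolding selector_tspan[OF g selector_idm braid_grade[OF x y]]
      using lin_pure_zero[OF vsB vsB] c c0
      by (simp add: tm_pure[OF lin_id lg] selector_homog[OF g y] idm_apply)
  qed
qed

text \<open>
  The values of all pairs of selectors on \<open>\<Delta> x\<close> are partial sums of one family of homogeneous
  components, so they can be compared by comparing index sets.
\<close>

lemma selector_comul:
  assumes x: "x \<in> G n"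
  shows "\<exists>f. (\<forall>i\<le>n. f i \<in> tsp (G i) (G (n - i))) \<and>
    (\<forall>\<sigma> \<tau> g h. selector \<sigma> g \<longrightarrow> selector \<tau> h \<longrightarrow> tm g h (comul S x) =
       finsum BB (\<lambda>i. if \<sigma> i \<and> \<tau> (n - i) then f i else \<zero>\<^bsub>BB\<^esub>) {..n})"
proof -
  interpret T: vspace K "BB" by (rule vsBB)
  obtain f where f: "\<forall>i\<le>n. f i \<in> tsub K B (G i) (G (n - i))" "comul S x = finsum BB f {..n}"
    using grade_comul[OF x] by blast
  have fs: "f i \<in> tsp (G i) (G (n - i))" if "i \<le> n" for i
    using f(1) that tsub_tspan[OF vsB grade_sub grade_sub] by blast
  have fc: "f i \<in> carrier BB" if "i \<le> n" for i
    by (rule tsp_closed[OF Gsub Gsub fs[OF that]])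
  show ?thesis
  proof (intro exI[of _ f] conjI allI impI fs)
    fix \<sigma> \<tau> g h assume g: "selector \<sigma> g" and h: "selector \<tau> h"
    have "tm g h (comul S x) = finsum BB (\<lambda>i. tm g h (f i)) {..n}"
      unfolding f(2)
      by (rule lin_finsum[OF vsBB vsBB lin_tm[OF selector_lin[OF g] selector_lin[OF h]]])
         (use fc in auto)
    also have "\<dots> = finsum BB (\<lambda>i. if \<sigma> i \<and> \<tau> (n - i) then f i else \<zero>\<^bsub>BB\<^esub>) {..n}"
      by (rule T.M.finsum_cong') (use fc selector_tspan[OF g h fs] in auto)
    finally show "tm g h (comul S x) =
       finsum BB (\<lambda>i. if \<sigma> i \<and> \<tau> (n - i) then f i else \<zero>\<^bsub>BB\<^esub>) {..n}" .
  qed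
qed

lemma selector_comul_eq:
  assumes x: "x \<in> G n" and g: "selector \<sigma> g" "selector \<tau> h" "selector \<sigma>' g'" "selector \<tau>' h'"
    and e: "\<And>i. i \<le> n \<Longrightarrow> (\<sigma> i \<and> \<tau> (n - i)) = (\<sigma>' i \<and> \<tau>' (n - i))"
  shows "tm g h (comul S x) = tm g' h' (comul S x)"
proof -
  interpret T: vspace K "BB" by (rule vsBB)
  obtain f where f1: "\<forall>i\<le>n. f i \<in> tsp (G i) (G (n - i))"
    and f2: "\<forall>\<sigma> \<tau> g h. selector \<sigma> g \<longrightarrow> selector \<tau> h \<longrightarrow> tm g h (comul S x) =
       finsum BB (\<lambda>i. if \<sigma> i \<and> \<tau> (n - i) then f i else \<zero>\<^bsub>BB\<^esub>) {..n}"
    using selector_comul[OF x] by (elim exE conjE)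
  note fs = f1[rule_format] and f = f2[rule_format]
  show ?thesis unfolding f[OF g(1,2)] f[OF g(3,4)]
    by (rule T.M.finsum_cong') (use e tsp_closed[OF Gsub Gsub fs] in auto)
qed

lemma selector_comul_zero:
  assumes x: "x \<in> G n" and g: "selector \<sigma> g" "selector \<tau> h"
    and e: "\<And>i. i \<le> n \<Longrightarrow> \<not> (\<sigma> i \<and> \<tau> (n - i))"
  shows "tm g h (comul S x) = \<zero>\<^bsub>BB\<^esub>"
proof -
  interpret T: vspace K "BB" by (rule vsBB)
  obtain f where f1: "\<forall>i\<le>n. f i \<in> tsp (G i) (G (n - i))"
    and f2: "\<forall>\<sigma> \<tau> g h. selector \<sigma> g \<longrightarrow> selector \<tau> h \<longrightarrow> tm g h (comul S x) =
       finsum BB (\<lambda>i. if \<sigma> i \<and> \<tau> (n - i) then f i else \<zero>\<^bsub>BB\<^esub>) {..n}"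
    using selector_comul[OF x] by (elim exE conjE)
  note fs = f1[rule_format] and f = f2[rule_format]
  show ?thesis unfolding f[OF g]
    by (rule T.M.add.finprod_one_eqI) (use e in auto)
qed

text \<open>
  The reduced comultiplication. The spaces \<open>E\<^sub>n\<close> are defined by a family of maps \<open>\<Delta>\<^sup>i\<^sup>,\<^sup>j\<close>; a single
  map with the same kernel in degree \<open>n\<close> is what the description of kernels of tensored maps needs.
\<close>

definition red_comul :: "'b \<Rightarrow> ('b \<times> 'b \<Rightarrow> 'k) set" where
  "red_comul x = tm pos_part pos_part (comul S x)"

lemma lin_red_comul: "lin K B BB red_comul"
  unfolding red_comul_def[abs_def] by (rule lin_comp[OF lin_tm[OF lin_pos_part lin_pos_part] lin_comul])

abbreviation (input) "pjs i j \<equiv> tm (pj i) (pj j)"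

lemma comul_comp_incl:
  assumes x: "x \<in> G (i + j)"
  shows "comul_comp K B S G i j x \<in> carrier (tens K (sub B (G i)) (sub B (G j)))"
    and "tincl K (sub B (G i)) (sub B (G j)) B B (comul_comp K B S G i j x) = pjs i j (comul S x)"
proof -
  note sG = vspace_sub[OF vsB grade_sub]
  have xc: "x \<in> carrier B" using x Gsub by blast
  note Dx = lin_closed[OF lin_comul xc]
  show "comul_comp K B S G i j x \<in> carrier (tens K (sub B (G i)) (sub B (G j)))"
    using x lin_closed[OF lin_tmap[OF vsB vsB sG sG lin_grade_proj_sub lin_grade_proj_sub] Dx]
    by (simp add: comul_comp_def)
  have "tincl K (sub B (G i)) (sub B (G j)) B B (tmap K B B (sub B (G i)) (sub B (G j))
      (pj i) (pj j) (comul S x)) = pjs i j (comul S x)"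
    unfolding tincl_def
    by (rule tmap_comp[OF vsB vsB sG sG vsB vsB lin_grade_proj_sub lin_grade_proj_sub
          lin_incl[OF grade_sub] lin_incl[OF grade_sub] lin_grade_proj lin_grade_proj _ _ Dx])
       (simp_all add: idm_apply grade_proj_in)
  then show "tincl K (sub B (G i)) (sub B (G j)) B B (comul_comp K B S G i j x) = pjs i j (comul S x)"
    using x by (simp add: comul_comp_def)
qed

lemma comul_comp_zero_iff:
  assumes x: "x \<in> G (i + j)"
  shows "comul_comp K B S G i j x = \<zero>\<^bsub>tens K (sub B (G i)) (sub B (G j))\<^esub> \<longleftrightarrow>
     pjs i j (comul S x) = \<zero>\<^bsub>BB\<^esub>"
proof -
  note sG = vspace_sub[OF vsB grade_sub]
  interpret T: vspace K "tens K (sub B (G i)) (sub B (G j))" by (rule vspace_tens[OF sG sG])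
  note l = lin_tinclB[OF grade_sub grade_sub, of i j]
  have 0: "tincl K (sub B (G i)) (sub B (G j)) B B \<zero>\<^bsub>tens K (sub B (G i)) (sub B (G j))\<^esub> = \<zero>\<^bsub>BB\<^esub>"
    by (rule lin_zero[OF vspace_tens[OF sG sG] vsBB l])
  show ?thesis
    using inj_on_eq_iff[OF tincl_inj[OF vsB vsB grade_sub grade_sub] comul_comp_incl(1)[OF x] T.M.zero_closed]
    unfolding comul_comp_incl(2)[OF x] 0 by blast
qed

text \<open>
  In degree \<open>n\<close> the reduced comultiplication is the sum of the \<open>\<Delta>\<^sup>i\<^sup>,\<^sup>j\<close> with \<open>i, j \<ge> 1\<close>, and each of
  these is recovered from the sum by projecting.
\<close>

lemma E_comp_iff:
  assumes n: "n \<ge> 2"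
  shows "x \<in> E n \<longleftrightarrow> x \<in> G n \<and> red_comul x = \<zero>\<^bsub>BB\<^esub>"
proof (cases "x \<in> G n")
  case x: True
  interpret T: vspace K "BB" by (rule vsBB)
  have xc: "x \<in> carrier B" using x Gsub by blast
  note Dx = lin_closed[OF lin_comul xc]
  have "x \<in> E n \<longleftrightarrow> (\<forall>i j. 1 \<le> i \<and> 1 \<le> j \<and> i + j = n \<longrightarrow> pjs i j (comul S x) = \<zero>\<^bsub>BB\<^esub>)"
    using n x comul_comp_zero_iff by (auto simp: E_comp_def)
  also have "\<dots> \<longleftrightarrow> red_comul x = \<zero>\<^bsub>BB\<^esub>"
  proof
    assume d: "red_comul x = \<zero>\<^bsub>BB\<^esub>"
    show "\<forall>i j. 1 \<le> i \<and> 1 \<le> j \<and> i + j = n \<longrightarrow> pjs i j (comul S x) = \<zero>\<^bsub>BB\<^esub>"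
    proof (intro allI impI)
      fix i j assume ij: "1 \<le> i \<and> 1 \<le> j \<and> i + j = n"
      have pq: "pj m (pos_part y) = pj m y" if y: "y \<in> carrier B" and m: "1 \<le> m" for m y
        using y
      proof (induction rule: homog_induct)
        case (homog k y)
        then show ?case
          using m selector_homog[OF selector_pos_part homog] lin_zero[OF vsB vsB lin_grade_proj]
          by (auto simp: grade_proj_homog)
      qed (simp add: lin_add[OF lin_pos_part] lin_add[OF lin_grade_proj] lin_closed[OF lin_pos_part])
      have "pjs i j (tm pos_part pos_part (comul S x)) = pjs i j (comul S x)"
        by (rule tm_comp[OF lin_pos_part lin_pos_part lin_grade_proj lin_grade_proj lin_grade_proj lin_grade_proj _ _ Dx])
           (use ij pq in auto)
      then show "pjs i j (comul S x) = \<zero>\<^bsub>BB\<^esub>"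
        using d lin_zero[OF vsBB vsBB lin_tm[OF lin_grade_proj lin_grade_proj]]
        by (simp add: red_comul_def)
    qed
  next
    assume h: "\<forall>i j. 1 \<le> i \<and> 1 \<le> j \<and> i + j = n \<longrightarrow> pjs i j (comul S x) = \<zero>\<^bsub>BB\<^esub>"
    obtain f where f1: "\<forall>i\<le>n. f i \<in> tsp (G i) (G (n - i))"
    and f2: "\<forall>\<sigma> \<tau> g h. selector \<sigma> g \<longrightarrow> selector \<tau> h \<longrightarrow> tm g h (comul S x) =
       finsum BB (\<lambda>i. if \<sigma> i \<and> \<tau> (n - i) then f i else \<zero>\<^bsub>BB\<^esub>) {..n}"
    using selector_comul[OF x] by (elim exE conjE)
  note fs = f1[rule_format] and f = f2[rule_format]
    have fc: "f i \<in> carrier BB" if "i \<le> n" for i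
      by (rule tsp_closed[OF Gsub Gsub fs[OF that]])
    have fi: "f i = \<zero>\<^bsub>BB\<^esub>" if i: "i \<le> n" "i \<noteq> 0" "n - i \<noteq> 0" for i
    proof -
      have "\<zero>\<^bsub>BB\<^esub> = pjs i (n - i) (comul S x)" using h i by simp
      also have "\<dots> = finsum BB (\<lambda>k. if i = k \<and> n - i = n - k then f k else \<zero>\<^bsub>BB\<^esub>) {..n}"
        by (rule f[OF selector_proj selector_proj])
      also have "\<dots> = finsum BB (\<lambda>k. if i = k then f k else \<zero>\<^bsub>BB\<^esub>) {..n}"
        by (rule T.M.finsum_cong') (use fc in auto)
      also have "\<dots> = f i" by (rule T.M.finsum_singleton) (use i fc in auto)
      finally show ?thesis by simp
    qed
    show "red_comul x = \<zero>\<^bsub>BB\<^esub>" unfolding red_comul_def f[OF selector_pos_part selector_pos_part]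
      by (rule T.M.add.finprod_one_eqI) (use fi in auto)
  qed
  finally show ?thesis using x by simp
next
  case False
  then show ?thesis using n by (auto simp: E_comp_def)
qed

lemma submodule_E_comp: "submodule (E n) K B"
proof (cases "n \<ge> 2")
  case True
  have "E n = {x \<in> carrier (sub B (G n)). red_comul x \<in> {\<zero>\<^bsub>BB\<^esub>}}"
    using E_comp_iff[OF True] by auto
  moreover have "submodule {x \<in> carrier (sub B (G n)). red_comul x \<in> {\<zero>\<^bsub>BB\<^esub>}} K (sub B (G n))"
    by (rule submodule_kernel[OF vspace_sub[OF vsB grade_sub] vsBB lin_sub_dom[OF lin_red_comul Gsub] submodule_zero[OF vsBB]])
  ultimately have s: "submodule (E n) K (sub B (G n))" by simp
  show ?thesis by (rule submodule_trans[OF vsB grade_sub s])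
next
  case False
  then show ?thesis by (simp add: E_comp_def submodule_zero[OF vsB])
qed

lemma E_comp_sub_G: "E n \<subseteq> G n"
  using gc(1) by (auto simp: E_comp_def)

lemmas Etsub = subset_trans[OF E_comp_sub_G Gsub]

section \<open>Braiding and comultiplication on the spaces \<open>E\<^sub>t\<close>\<close>

lemma tmap_zero_pure:
  assumes "vspace K P" "vspace K Q" "lin K (tens K P Q) R f" "vspace K R"
  shows "y \<in> carrier Q \<Longrightarrow> f (pure K P Q \<zero>\<^bsub>P\<^esub> y) = \<zero>\<^bsub>R\<^esub>"
    and "x \<in> carrier P \<Longrightarrow> f (pure K P Q x \<zero>\<^bsub>Q\<^esub>) = \<zero>\<^bsub>R\<^esub>"
  using lin_pure_zero[OF assms(1,2)] lin_zero[OF vspace_tens[OF assms(1,2)] assms(4,3)] by auto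

lemma braid_selectors:
  assumes g: "selector \<sigma> g" and h: "selector \<tau> h" and w: "w \<in> carrier BB"
  shows "braid S (tm g h w) = tm h g (braid S w)"
proof -
  note lg = selector_lin[OF g] and lh = selector_lin[OF h]
  have "tm g h w = tm g (idm B) (tm (idm B) h w)"
    by (rule tm_comp[symmetric, OF lin_id lh lg lin_id lg lh _ _ w])
       (simp_all add: idm_apply lin_closed[OF lh])
  also have "braid S \<dots> = tm (idm B) g (braid S (tm (idm B) h w))"
    by (rule braid_selector(1)[OF g lin_closed[OF lin_tm[OF lin_id lh] w], symmetric])
  also have "braid S (tm (idm B) h w) = tm h (idm B) (braid S w)"
    by (rule braid_selector(2)[OF h w, symmetric])
  also have "tm (idm B) g (tm h (idm B) (braid S w)) = tm h g (braid S w)"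
    by (rule tm_comp[OF lh lin_id lin_id lg lh lg _ _ lin_closed[OF lin_braid w]])
       (simp_all add: idm_apply lin_closed[OF lh])
  finally show ?thesis .
qed

lemma selector_br12:
  assumes g: "selector \<sigma> g" and h: "selector \<tau> h" and k: "selector \<rho> k" and z: "z \<in> carrier (tens K BB B)"
  shows "br12 K B (braid S) (tmap K BB B BB B (tm g h) k z) =
     tmap K BB B BB B (tm h g) k (br12 K B (braid S) z)"
proof -
  note lg = selector_lin[OF g] and lh = selector_lin[OF h] and lk = selector_lin[OF k]
  note gh = lin_tm[OF lg lh] and hg = lin_tm[OF lh lg]
  show ?thesis unfolding br12_def
    by (rule tmap_square[OF vsBB vsB vsBB vsB vsBB vsB vsBB vsB gh lk lin_braid lin_id lin_braid lin_id hg lk braid_selectors[OF g h] _ z])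
       (simp_all add: idm_apply lin_closed[OF lk])
qed

lemma selector_br23:
  assumes g: "selector \<sigma> g" and h: "selector \<tau> h" and k: "selector \<rho> k" and z: "z \<in> carrier (tens K BB B)"
  shows "br23 K B (braid S) (tmap K BB B BB B (tm g h) k z) =
     tmap K BB B BB B (tm g k) h (br23 K B (braid S) z)"
proof -
  note lg = selector_lin[OF g] and lh = selector_lin[OF h] and lk = selector_lin[OF k]
  note hk = lin_tm[OF lh lk] and kh = lin_tm[OF lk lh]
  note az = lin_closed[OF lin_asc[OF vsB vsB vsB] z]
  have sq: "tmap K B BB B BB (idm B) (braid S) (tmap K B BB B BB g (tm h k) (asc K B B B z)) =
     tmap K B BB B BB g (tm k h) (tmap K B BB B BB (idm B) (braid S) (asc K B B B z))"
    by (rule tmap_square[OF vsB vsBB vsB vsBB vsB vsBB vsB vsBB lg hk lin_id lin_braid lin_id lin_braid lg kh _ braid_selectors[OF h k] az])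
       (simp_all add: idm_apply lin_closed[OF lg])
  have "br23 K B (braid S) (tmap K BB B BB B (tm g h) k z) =
     asc_inv K B B B (tmap K B BB B BB g (tm k h) (tmap K B BB B BB (idm B) (braid S) (asc K B B B z)))"
    by (simp add: br23_def asc_natural[OF vsB vsB vsB vsB vsB vsB lg lh lk z] sq)
  also have "\<dots> = tmap K BB B BB B (tm g k) h (br23 K B (braid S) z)"
    by (simp add: br23_def asc_inv_natural[OF vsB vsB vsB vsB vsB vsB lg lk lh] lin_closed[OF lin_id_c[OF vsB lin_braid] az])
  finally show ?thesis .
qed

text \<open>
  Let \<open>\<delta>\<close> be the reduced comultiplication. Because \<open>c\<close> is compatible with \<open>\<Delta>\<close> and selectors pass
  through it, \<open>(B \<otimes> \<delta>) c(e \<otimes> y)\<close> arises from \<open>\<delta> e \<otimes> y\<close> by two braidings, so it vanishes. As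
  \<open>c(e \<otimes> y)\<close> lies in \<open>B\<^sup>u \<otimes> B\<^sup>t\<close>, it lies in \<open>B\<^sup>u \<otimes> (B\<^sup>t \<inter> ker \<delta>)\<close>. The second part is the mirror
  image.
\<close>

lemma braid_E_comp:
  assumes e: "e \<in> E t" and y: "y \<in> G u"
  shows "braid S (pr e y) \<in> tsp (G u) (E t)"
    and "braid S (pr y e) \<in> tsp (E t) (G u)"
proof -
  have eG: "e \<in> G t" using e E_comp_sub_G by blast
  have ec: "e \<in> carrier B" and yc: "y \<in> carrier B" using eG y Gsub by auto
  note lqqq = lin_tm[OF lin_pos_part lin_pos_part]
  note Bte = submodule_tsp[OF Gsub Etsub] and Bet = submodule_tsp[OF Etsub Gsub]
  have "braid S (pr e y) \<in> tsp (G u) (E t) \<and>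
     braid S (pr y e) \<in> tsp (E t) (G u)"
  proof (cases "t \<ge> 2")
    case False
    then have "e = \<zero>\<^bsub>B\<^esub>" using e by (simp add: E_comp_def)
    then have "braid S (pr e y) = \<zero>\<^bsub>BB\<^esub>" "braid S (pr y e) = \<zero>\<^bsub>BB\<^esub>"
      using tmap_zero_pure[OF vsB vsB lin_braid vsBB] yc by auto
    then show ?thesis using submodule_closed(1)[OF vsBB Bte] submodule_closed(1)[OF vsBB Bet] by simp
  next
    case True
    have de: "tm pos_part pos_part (comul S e) = \<zero>\<^bsub>BB\<^esub>"
      using E_comp_iff[OF True] e by (simp add: red_comul_def)
    have Ek: "E t = {x \<in> G t. red_comul x = \<zero>\<^bsub>BB\<^esub>}" using E_comp_iff[OF True] by auto
    note De = lin_closed[OF lin_comul ec]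
    note T3 = vspace_tens[OF vsBB vsB] and T3' = vspace_tens[OF vsB vsBB]
    note l12 = lin_br12[OF vsB lin_braid] and l23 = lin_br23[OF vsB lin_braid]
    note la = lin_asc[OF vsB vsB vsB] and lai = lin_asc_inv[OF vsB vsB vsB]
    note cp = pure_closed[OF vsB vsB] and cp3 = pure_closed[OF vsBB vsB] and cp3' = pure_closed[OF vsB vsBB]
    let ?c = "braid S"
    have 1: "tmap K B B B BB (idm B) red_comul (?c (pr e y)) = \<zero>\<^bsub>tens K B BB\<^esub>"
    proof -
      let ?z = "pure K BB B (comul S e) y"
      have z: "?z \<in> carrier (tens K BB B)" by (rule cp3[OF De yc])
      note ce = lin_closed[OF lin_braid cp[OF ec yc]]
      have c1: "br12 K B ?c (br23 K B ?c ?z) \<in> carrier (tens K BB B)"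
        by (rule lin_closed[OF l12 lin_closed[OF l23 z]])
      have iD: "tmap K B B B BB (idm B) (comul S) (?c (pr e y)) =
          asc K B B B (br12 K B ?c (br23 K B ?c ?z))"
      proof -
        have "asc_inv K B B B (tmap K B B B BB (idm B) (comul S) (?c (pr e y))) =
          br12 K B ?c (br23 K B ?c ?z)"
          using braid_comul_right[OF cp[OF ec yc]]
          by (simp add: tmap_pure[OF vsB vsB vsBB vsB lin_comul lin_id ec yc] idm_apply yc)
        then show ?thesis
          using asc_asc_inv[OF vsB vsB vsB lin_closed[OF lin_tmap[OF vsB vsB vsB vsBB lin_id lin_comul] ce]] by simp
      qed
      have "tmap K B B B BB (idm B) red_comul (?c (pr e y)) =
         tmap K B BB B BB (idm B) (tm pos_part pos_part) (tmap K B B B BB (idm B) (comul S) (?c (pr e y)))"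
        by (rule tmap_comp[symmetric, OF vsB vsB vsB vsBB vsB vsBB lin_id lin_comul lin_id lqqq lin_id lin_red_comul _ _ ce])
           (simp_all add: idm_apply red_comul_def)
      also have "\<dots> = asc K B B B (tmap K BB B BB B (tm (idm B) pos_part) pos_part (br12 K B ?c (br23 K B ?c ?z)))"
        unfolding iD by (rule asc_natural[symmetric, OF vsB vsB vsB vsB vsB vsB lin_id lin_pos_part lin_pos_part c1])
      also have "\<dots> = asc K B B B (br12 K B ?c (br23 K B ?c (tmap K BB B BB B (tm pos_part pos_part) (idm B) ?z)))"
        by (simp add: selector_br12[OF selector_pos_part selector_idm selector_pos_part lin_closed[OF l23 z], symmetric]
            selector_br23[OF selector_pos_part selector_pos_part selector_idm z, symmetric])
      also have "tmap K BB B BB B (tm pos_part pos_part) (idm B) ?z = \<zero>\<^bsub>tens K BB B\<^esub>"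
        using tmap_pure[OF vsBB vsB vsBB vsB lqqq lin_id De yc] de lin_pure_zero(1)[OF vsBB vsB yc] by (simp add: idm_apply yc)
      also have "asc K B B B (br12 K B ?c (br23 K B ?c \<zero>\<^bsub>tens K BB B\<^esub>)) = \<zero>\<^bsub>tens K B BB\<^esub>"
        by (rule lin_zero[OF T3 T3' lin_comp[OF la lin_comp[OF l12 l23]]])
      finally show ?thesis .
    qed
    have 2: "tmap K B B BB B red_comul (idm B) (?c (pr y e)) = \<zero>\<^bsub>tens K BB B\<^esub>"
    proof -
      let ?z = "pure K B BB y (comul S e)"
      have z: "?z \<in> carrier (tens K B BB)" by (rule cp3'[OF yc De])
      note ce = lin_closed[OF lin_braid cp[OF yc ec]]
      note az = lin_closed[OF lai z]
      have Di: "tmap K B B BB B (comul S) (idm B) (?c (pr y e)) =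
          br23 K B ?c (br12 K B ?c (asc_inv K B B B ?z))"
        using braid_comul_left[OF cp[OF yc ec]]
        by (simp add: tmap_pure[OF vsB vsB vsB vsBB lin_id lin_comul yc ec] idm_apply yc)
      have "tmap K B B BB B red_comul (idm B) (?c (pr y e)) =
         tmap K BB B BB B (tm pos_part pos_part) (idm B) (tmap K B B BB B (comul S) (idm B) (?c (pr y e)))"
        by (rule tmap_comp[symmetric, OF vsB vsB vsBB vsB vsBB vsB lin_comul lin_id lqqq lin_id lin_red_comul lin_id _ _ ce])
           (simp_all add: idm_apply red_comul_def)
      also have "\<dots> = br23 K B ?c (br12 K B ?c (tmap K BB B BB B (tm (idm B) pos_part) pos_part (asc_inv K B B B ?z)))"
        by (simp add: Di selector_br12[OF selector_idm selector_pos_part selector_pos_part az]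
            selector_br23[OF selector_pos_part selector_idm selector_pos_part lin_closed[OF l12 az]])
      also have "tmap K BB B BB B (tm (idm B) pos_part) pos_part (asc_inv K B B B ?z) =
         asc_inv K B B B (tmap K B BB B BB (idm B) (tm pos_part pos_part) ?z)"
        by (rule asc_inv_natural[symmetric, OF vsB vsB vsB vsB vsB vsB lin_id lin_pos_part lin_pos_part z])
      also have "tmap K B BB B BB (idm B) (tm pos_part pos_part) ?z = \<zero>\<^bsub>tens K B BB\<^esub>"
        using tmap_pure[OF vsB vsBB vsB vsBB lin_id lqqq yc De] de lin_pure_zero(2)[OF vsB vsBB yc] by (simp add: idm_apply yc)
      also have "br23 K B ?c (br12 K B ?c (asc_inv K B B B \<zero>\<^bsub>tens K B BB\<^esub>)) = \<zero>\<^bsub>tens K BB B\<^esub>"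
        by (rule lin_zero[OF T3' T3 lin_comp[OF l23 lin_comp[OF l12 lai]]])
      finally show ?thesis .
    qed
    show ?thesis unfolding Ek
      by (intro conjI tspan_kernel_right[OF vsB vsB grade_sub grade_sub vsBB lin_red_comul braid_grade[OF eG y] 1]
           tspan_kernel_left[OF vsB vsB grade_sub grade_sub vsBB lin_red_comul braid_grade[OF y eG] 2])
  qed
  then show "braid S (pr e y) \<in> tsp (G u) (E t)"
    and "braid S (pr y e) \<in> tsp (E t) (G u)" by auto
qed

lemma selector_ext:
  assumes f: "lin K B P f" and g: "lin K B P g" and x: "x \<in> carrier B"
    and e: "\<And>i x. x \<in> G i \<Longrightarrow> f x = g x"
  shows "f x = g x"
  using x by (induction rule: homog_induct) (simp_all add: e lin_add[OF f] lin_add[OF g])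

text \<open>
  The degree zero part of \<open>x\<close> contributes to \<open>B\<^sup>0 \<otimes> B\<^sup>0\<close> only, where one of the two selectors
  vanishes.
\<close>

lemma mixed_comul_pos_part:
  assumes "selector \<sigma> g" "selector \<tau> h" "\<not> (\<sigma> 0 \<and> \<tau> 0)" "x \<in> carrier B"
  shows "tm g h (comul S (pos_part x)) = tm g h (comul S x)"
proof (rule selector_ext[OF _ _ assms(4)])
  note l = lin_comp[OF lin_tm[OF selector_lin[OF assms(1)] selector_lin[OF assms(2)]] lin_comul]
  show l1: "lin K B BB (\<lambda>x. tm g h (comul S x))" by (rule l)
  show "lin K B BB (\<lambda>x. tm g h (comul S (pos_part x)))" by (rule lin_comp[OF l lin_pos_part])
  fix i x assume x: "x \<in> G i"
  show "tm g h (comul S (pos_part x)) = tm g h (comul S x)"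
  proof (cases "i = 0")
    case True
    have "tm g h (comul S x) = \<zero>\<^bsub>BB\<^esub>"
      by (rule selector_comul_zero[OF x assms(1,2)]) (use True assms(3) in auto)
    moreover have "pos_part x = \<zero>\<^bsub>B\<^esub>" using selector_homog[OF selector_pos_part x] True by simp
    ultimately show ?thesis using lin_zero[OF vsB vsBB l1] by simp
  next
    case False
    then show ?thesis using selector_homog[OF selector_pos_part x] by simp
  qed
qed

text \<open>
  Let \<open>\<delta>\<close> be the reduced comultiplication, \<open>p\<close> the projection to degree zero, \<open>q\<close> the part of
  positive degree and \<open>\<eta> = (q \<otimes> p) \<Delta>\<close>. Up to associativity, coassociativity gives
  \<open>(\<delta> \<otimes> B) \<Delta>\<^sup>t\<^sup>,\<^sup>0 e = (q \<otimes> q \<otimes> p) (\<Delta> \<otimes> B) \<Delta> e = (q \<otimes> \<eta>) \<Delta> e = (B \<otimes> \<eta>) \<delta> e = 0\<close>, where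
  \<open>\<delta> q = \<delta>\<close> and \<open>\<eta> q = \<eta>\<close> are used. Hence \<open>\<Delta>\<^sup>t\<^sup>,\<^sup>0 e\<close>, an element of \<open>B\<^sup>t \<otimes> B\<^sup>0\<close>, has its
  left leg in \<open>B\<^sup>t \<inter> ker \<delta>\<close>.
\<close>

lemma coaction_E_comp:
  assumes e: "e \<in> E t" and t: "t \<ge> 2"
  shows "pjs t 0 (comul S e) \<in> tsp (E t) (G 0)"
    and "pjs 0 t (comul S e) \<in> tsp (G 0) (E t)"
proof -
  have eG: "e \<in> G t" using e E_comp_sub_G by blast
  then have ec: "e \<in> carrier B" using Gsub by blast
  note De = lin_closed[OF lin_comul ec]
  have de: "tm pos_part pos_part (comul S e) = \<zero>\<^bsub>BB\<^esub>"
    using E_comp_iff[OF t] e by (simp add: red_comul_def)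
  have Ek: "E t = {x \<in> G t. red_comul x = \<zero>\<^bsub>BB\<^esub>}" using E_comp_iff[OF t] by auto
  let ?p = "pj 0"
  note lp = lin_grade_proj[of 0] and sp = selector_proj[of 0]
  note T3 = vspace_tens[OF vsBB vsB] and T3' = vspace_tens[OF vsB vsBB]
  have mem: "pjs i j (comul S e) \<in> tsp (G i) (G j)" for i j
    by (rule lin_tens_into[OF vsB vsB lin_tm[OF lin_grade_proj lin_grade_proj] vsBB
          submodule_tsp[OF Gsub Gsub] _ De])
       (simp add: tm_pure[OF lin_grade_proj lin_grade_proj] pure_tspan grade_proj_in)
  note lqqq = lin_tm[OF lin_pos_part lin_pos_part] and lqp = lin_tm[OF lin_pos_part lp]
    and lpq = lin_tm[OF lp lin_pos_part]
  have dq: "red_comul (pos_part x) = red_comul x" if "x \<in> carrier B" for x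
    unfolding red_comul_def by (rule mixed_comul_pos_part[OF selector_pos_part selector_pos_part _ that]) simp
  define \<eta> where "\<eta> x = tm pos_part ?p (comul S x)" for x
  define \<eta>' where "\<eta>' x = tm ?p pos_part (comul S x)" for x
  have l\<eta>: "lin K B BB \<eta>" and l\<eta>': "lin K B BB \<eta>'"
    unfolding \<eta>_def[abs_def] \<eta>'_def[abs_def] by (rule lin_comp[OF lqp lin_comul] lin_comp[OF lpq lin_comul])+
  have \<eta>q: "\<eta> (pos_part x) = \<eta> x" and \<eta>'q: "\<eta>' (pos_part x) = \<eta>' x" if "x \<in> carrier B" for x
    unfolding \<eta>_def \<eta>'_def
    by (rule mixed_comul_pos_part[OF selector_pos_part sp _ that], simp)
       (rule mixed_comul_pos_part[OF sp selector_pos_part _ that], simp)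
  have qp: "pjs t 0 (comul S e) = tm pos_part ?p (comul S e)"
    by (rule selector_comul_eq[OF eG selector_proj sp selector_pos_part sp]) (use t in auto)
  have pq: "pjs 0 t (comul S e) = tm ?p pos_part (comul S e)"
    by (rule selector_comul_eq[OF eG sp selector_proj sp selector_pos_part]) (use t in auto)
  have 1: "tmap K B B BB B red_comul (idm B) (pjs t 0 (comul S e)) = \<zero>\<^bsub>tens K BB B\<^esub>"
  proof -
    note lDi = lin_tmap[OF vsB vsB vsBB vsB lin_comul lin_id] and liD = lin_tmap[OF vsB vsB vsB vsBB lin_id lin_comul]
    have "tmap K B B BB B red_comul (idm B) (pjs t 0 (comul S e)) = tmap K B B BB B red_comul ?p (comul S e)"
      unfolding qp
      by (rule tmap_comp[OF vsB vsB vsB vsB vsBB vsB lin_pos_part lp lin_red_comul lin_id lin_red_comul lp _ _ De])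
         (simp_all add: dq idm_apply lin_closed[OF lp])
    also have "\<dots> = tmap K BB B BB B (tm pos_part pos_part) ?p (tmap K B B BB B (comul S) (idm B) (comul S e))"
      by (rule tmap_comp[symmetric, OF vsB vsB vsBB vsB vsBB vsB lin_comul lin_id lqqq lp lin_red_comul lp _ _ De])
         (simp_all add: red_comul_def idm_apply)
    also have "tmap K B B BB B (comul S) (idm B) (comul S e) =
        asc_inv K B B B (tmap K B B B BB (idm B) (comul S) (comul S e))"
      using comul_coassoc[OF ec] asc_inv_asc[OF vsB vsB vsB lin_closed[OF lDi De]] by simp
    also have "tmap K BB B BB B (tm pos_part pos_part) ?p \<dots> =
        asc_inv K B B B (tmap K B BB B BB pos_part (tm pos_part ?p) (tmap K B B B BB (idm B) (comul S) (comul S e)))"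
      by (rule asc_inv_natural[symmetric, OF vsB vsB vsB vsB vsB vsB lin_pos_part lin_pos_part lp lin_closed[OF liD De]])
    also have "tmap K B BB B BB pos_part (tm pos_part ?p) (tmap K B B B BB (idm B) (comul S) (comul S e)) =
        tmap K B B B BB (idm B) \<eta> (tm pos_part pos_part (comul S e))"
      by (rule tmap_square[OF vsB vsB vsB vsBB vsB vsB vsB vsBB lin_id lin_comul lin_pos_part lqp lin_pos_part lin_pos_part lin_id l\<eta> _ _ De])
         (simp_all add: idm_apply lin_closed[OF lin_pos_part] \<eta>q, simp add: \<eta>_def)
    also have "\<dots> = \<zero>\<^bsub>tens K B BB\<^esub>" unfolding de
      by (rule lin_zero[OF vsBB T3' lin_tmap[OF vsB vsB vsB vsBB lin_id l\<eta>]])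
    also have "asc_inv K B B B \<zero>\<^bsub>tens K B BB\<^esub> = \<zero>\<^bsub>tens K BB B\<^esub>"
      by (rule lin_zero[OF T3' T3 lin_asc_inv[OF vsB vsB vsB]])
    finally show ?thesis .
  qed
  have 2: "tmap K B B B BB (idm B) red_comul (pjs 0 t (comul S e)) = \<zero>\<^bsub>tens K B BB\<^esub>"
  proof -
    note lDi = lin_tmap[OF vsB vsB vsBB vsB lin_comul lin_id]
    have "tmap K B B B BB (idm B) red_comul (pjs 0 t (comul S e)) = tmap K B B B BB ?p red_comul (comul S e)"
      unfolding pq
      by (rule tmap_comp[OF vsB vsB vsB vsB vsB vsBB lp lin_pos_part lin_id lin_red_comul lp lin_red_comul _ _ De])
         (simp_all add: dq idm_apply lin_closed[OF lp])
    also have "\<dots> = tmap K B BB B BB ?p (tm pos_part pos_part) (tmap K B B B BB (idm B) (comul S) (comul S e))"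
      by (rule tmap_comp[symmetric, OF vsB vsB vsB vsBB vsB vsBB lin_id lin_comul lp lqqq lp lin_red_comul _ _ De])
         (simp_all add: red_comul_def idm_apply)
    also have "tmap K B B B BB (idm B) (comul S) (comul S e) =
        asc K B B B (tmap K B B BB B (comul S) (idm B) (comul S e))"
      using comul_coassoc[OF ec] by simp
    also have "tmap K B BB B BB ?p (tm pos_part pos_part) \<dots> =
        asc K B B B (tmap K BB B BB B (tm ?p pos_part) pos_part (tmap K B B BB B (comul S) (idm B) (comul S e)))"
      by (rule asc_natural[symmetric, OF vsB vsB vsB vsB vsB vsB lp lin_pos_part lin_pos_part lin_closed[OF lDi De]])
    also have "tmap K BB B BB B (tm ?p pos_part) pos_part (tmap K B B BB B (comul S) (idm B) (comul S e)) =
        tmap K B B BB B \<eta>' (idm B) (tm pos_part pos_part (comul S e))"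
      by (rule tmap_square[OF vsB vsB vsBB vsB vsB vsB vsBB vsB lin_comul lin_id lpq lin_pos_part lin_pos_part lin_pos_part l\<eta>' lin_id _ _ De])
         (simp_all add: idm_apply lin_closed[OF lin_pos_part] \<eta>'q, simp add: \<eta>'_def)
    also have "\<dots> = \<zero>\<^bsub>tens K BB B\<^esub>" unfolding de
      by (rule lin_zero[OF vsBB T3 lin_tmap[OF vsB vsB vsBB vsB l\<eta>' lin_id]])
    also have "asc K B B B \<zero>\<^bsub>tens K BB B\<^esub> = \<zero>\<^bsub>tens K B BB\<^esub>"
      by (rule lin_zero[OF T3 T3' lin_asc[OF vsB vsB vsB]])
    finally show ?thesis .
  qed
  show "pjs t 0 (comul S e) \<in> tsp (E t) (G 0)" unfolding Ek
    by (rule tspan_kernel_left[OF vsB vsB grade_sub grade_sub vsBB lin_red_comul mem 1])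
  show "pjs 0 t (comul S e) \<in> tsp (G 0) (E t)" unfolding Ek
    by (rule tspan_kernel_right[OF vsB vsB grade_sub grade_sub vsBB lin_red_comul mem 2])
qed

text \<open>
  The identity of \<open>B \<otimes> B\<close> is the sum of the four tensor products of the projection to degree zero and
  the part of positive degree. On \<open>\<Delta> x\<close> the term with two projections vanishes since \<open>n > 0\<close>, and
  the term with two positive parts is the reduced comultiplication.
\<close>

lemma comul_split:
  assumes x: "x \<in> G n" and n: "n \<noteq> 0" and d: "red_comul x = \<zero>\<^bsub>BB\<^esub>"
  shows "comul S x = pjs n 0 (comul S x) \<oplus>\<^bsub>BB\<^esub> pjs 0 n (comul S x)"
proof -
  interpret T: vspace K BB by (rule vsBB)
  have xc: "x \<in> carrier B" using x Gsub by blast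
  note Dx = lin_closed[OF lin_comul xc]
  let ?p = "pj 0"
  note lp = lin_grade_proj[of 0] and sp = selector_proj[of 0]
  note lt = lin_tm
  have "comul S x = tm (idm B) (idm B) (comul S x)"
    by (rule tmap_id[symmetric, OF vsB vsB lin_id lin_id _ _ Dx]) (simp_all add: idm_apply)
  have split: "w = (tm pos_part pos_part w \<oplus>\<^bsub>BB\<^esub> tm pos_part ?p w) \<oplus>\<^bsub>BB\<^esub>
      (tm ?p pos_part w \<oplus>\<^bsub>BB\<^esub> tm ?p ?p w)" if w: "w \<in> carrier BB" for w
  proof (rule tens_homog_ext[OF lin_ident lin_plus[OF vsBB vsBB lin_plus[OF vsBB vsBB lt[OF lin_pos_part lin_pos_part] lt[OF lin_pos_part lp]]
         lin_plus[OF vsBB vsBB lt[OF lp lin_pos_part] lt[OF lp lp]]] _ w])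
    fix i j x y assume x: "x \<in> G i" and y: "y \<in> G j"
    have m: "pr x y \<in> tsp (G i) (G j)" by (rule pure_tspan[OF x y])
    have c: "pr x y \<in> carrier BB" by (rule tsp_closed[OF Gsub Gsub m])
    show "pr x y = (tm pos_part pos_part (pr x y) \<oplus>\<^bsub>BB\<^esub> tm pos_part ?p (pr x y)) \<oplus>\<^bsub>BB\<^esub>
      (tm ?p pos_part (pr x y) \<oplus>\<^bsub>BB\<^esub> tm ?p ?p (pr x y))"
      unfolding selector_tspan[OF selector_pos_part selector_pos_part m] selector_tspan[OF selector_pos_part sp m]
        selector_tspan[OF sp selector_pos_part m] selector_tspan[OF sp sp m]
      using c by (cases "i = 0"; cases "j = 0") simp_all
  qed
  have qp: "tm pos_part ?p (comul S x) = pjs n 0 (comul S x)"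
    by (rule selector_comul_eq[OF x selector_pos_part sp selector_proj sp]) (use n in auto)
  have pq: "tm ?p pos_part (comul S x) = pjs 0 n (comul S x)"
    by (rule selector_comul_eq[OF x sp selector_pos_part sp selector_proj]) (use n in auto)
  have pp: "tm ?p ?p (comul S x) = \<zero>\<^bsub>BB\<^esub>"
    by (rule selector_comul_zero[OF x sp sp]) (use n in auto)
  have c: "pjs n 0 (comul S x) \<in> carrier BB" "pjs 0 n (comul S x) \<in> carrier BB"
    by (rule lin_closed[OF lt[OF lin_grade_proj lin_grade_proj] Dx])+
  show ?thesis using split[OF Dx] unfolding qp pq pp d[unfolded red_comul_def]
    using c by simp
qed

abbreviation (input) "Esp \<equiv> E_space K B S G"

lemma submodule_E: "submodule Esp K B"
  unfolding E_space_def by (rule lspan_submodule[OF vsB]) (use Etsub in blast)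

lemmas Ec = submodule_closed[OF vsB submodule_E]

lemma E_sub: "Esp \<subseteq> carrier B" using Ec(2) by blast

lemma E_comp_E: "E t \<subseteq> Esp"
  unfolding E_space_def by (rule subsetI, rule lspan_incl) blast

lemma E_least:
  assumes H: "submodule H K B" and e: "\<And>t x. x \<in> E t \<Longrightarrow> x \<in> H"
  shows "Esp \<subseteq> H"
  unfolding E_space_def by (rule lspan_least[OF H]) (use e in blast)

lemma braid_E:
  assumes y: "y \<in> G u" and e: "e \<in> Esp"
  shows "braid S (pr e y) \<in> tsp (G u) Esp"
    and "braid S (pr y e) \<in> tsp Esp (G u)"
proof -
  have yc: "y \<in> carrier B" using y Gsub by blast
  note l1 = lin_comp[OF lin_braid lin_pr_left[OF yc]] and l2 = lin_comp[OF lin_braid lin_pr_right[OF yc]]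
  note s1 = submodule_tsp[OF Gsub E_sub, of u] and s2 = submodule_tsp[OF E_sub Gsub, of u]
  have "Esp \<subseteq> {e \<in> carrier B. braid S (pr e y) \<in> tsp (G u) Esp}"
  proof (rule E_least[OF submodule_kernel[OF vsB vsBB l1 s1]])
    fix t x assume x: "x \<in> E t"
    show "x \<in> {e \<in> carrier B. braid S (pr e y) \<in> tsp (G u) Esp}"
      using braid_E_comp(1)[OF x y] tspan_mono[OF vsB vsB subset_refl E_comp_E Gsub E_sub] x Etsub by blast
  qed
  then show "braid S (pr e y) \<in> tsp (G u) Esp" using e by blast
  have "Esp \<subseteq> {e \<in> carrier B. braid S (pr y e) \<in> tsp Esp (G u)}"
  proof (rule E_least[OF submodule_kernel[OF vsB vsBB l2 s2]])
    fix t x assume x: "x \<in> E t"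
    show "x \<in> {e \<in> carrier B. braid S (pr y e) \<in> tsp Esp (G u)}"
      using braid_E_comp(2)[OF x y] tspan_mono[OF vsB vsB E_comp_E subset_refl E_sub Gsub] x Etsub by blast
  qed
  then show "braid S (pr y e) \<in> tsp Esp (G u)" using e by blast
qed

text \<open>
  An equation in \<open>B \<otimes> B\<close> in place of the inverse image in the definition of \<^const>\<open>braid_restr\<close>.
\<close>

lemma braid_restr_spec:
  assumes X: "submodule X K B" and Y: "submodule Y K B"
    and z: "z \<in> carrier (tens K (sub B X) (sub B Y))"
    and m: "braid S (tincl K (sub B X) (sub B Y) B B z) \<in> tsp Y X"
  shows "braid_restr K B S X Y z \<in> carrier (tens K (sub B Y) (sub B X))"
    and "tincl K (sub B Y) (sub B X) B B (braid_restr K B S X Y z) = braid S (tincl K (sub B X) (sub B Y) B B z)"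
proof -
  note inj = tincl_inj[OF vsB vsB Y X]
  note m' = m[folded tincl_image[OF vsB vsB Y X]]
  show "braid_restr K B S X Y z \<in> carrier (tens K (sub B Y) (sub B X))"
    using the_inv_into_into[OF inj m' subset_refl] z by (simp add: braid_restr_def)
  show "tincl K (sub B Y) (sub B X) B B (braid_restr K B S X Y z) = braid S (tincl K (sub B X) (sub B Y) B B z)"
    using f_the_inv_into_f[OF inj m'] z by (simp add: braid_restr_def)
qed

section \<open>The relations imposed by a bracket\<close>

context
  fixes b :: "'b \<Rightarrow> 'b"
  assumes br: "is_bracket K B S G b"
begin

definition "bracket_rels = (\<lambda>z. z \<ominus>\<^bsub>B\<^esub> b z) ` Esp"

lemma b_lin: "lin K (sub B Esp) (sub B (G 1)) b"
  using br unfolding is_bracket_def Let_def by (blast intro: Lin_lin)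

lemma b_G: "z \<in> Esp \<Longrightarrow> b z \<in> G 1"
  using lin_closed[OF b_lin] by simp

lemma b_linB: "lin K (sub B Esp) B b"
  by (rule lin_sub_cod[OF b_lin Gsub])

lemma b_lin_Et: "lin K (sub B (E t)) (sub B (G 1)) b"
  using lin_sub_dom[OF b_lin, of "E t"] E_comp_E by simp

lemma bracket_rels_sub: "bracket_rels \<subseteq> carrier B"
  using b_G Gsub Ec(2) by (auto simp: bracket_rels_def intro!: M.minus_closed)

lemma bracket_rels_I: "e \<in> Esp \<Longrightarrow> e \<ominus>\<^bsub>B\<^esub> b e \<in> bracket_rels"
  by (simp add: bracket_rels_def)

lemma br_left: "z \<in> carrier (tens K (sub B Esp) (sub B (G t))) \<Longrightarrow>
     braid_restr K B S (G 1) (G t) (tmap K (sub B Esp) (sub B (G t)) (sub B (G 1)) (sub B (G t)) b (idm (sub B (G t))) z) =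
     tmap K (sub B (G t)) (sub B Esp) (sub B (G t)) (sub B (G 1)) (idm (sub B (G t))) b (braid_restr K B S Esp (G t) z)"
  and br_right: "z \<in> carrier (tens K (sub B (G t)) (sub B Esp)) \<Longrightarrow>
     braid_restr K B S (G t) (G 1) (tmap K (sub B (G t)) (sub B Esp) (sub B (G t)) (sub B (G 1)) (idm (sub B (G t))) b z) =
     tmap K (sub B Esp) (sub B (G t)) (sub B (G 1)) (sub B (G t)) b (idm (sub B (G t))) (braid_restr K B S (G t) Esp z)"
  and br_coright: "x \<in> E t \<Longrightarrow> comul_comp K B S G 1 0 (b x) =
     tmap K (sub B (E t)) (sub B (G 0)) (sub B (G 1)) (sub B (G 0)) b (idm (sub B (G 0))) (E_coact_right K B S G t x)"
  and br_coleft: "x \<in> E t \<Longrightarrow> comul_comp K B S G 0 1 (b x) =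
     tmap K (sub B (G 0)) (sub B (E t)) (sub B (G 0)) (sub B (G 1)) (idm (sub B (G 0))) b (E_coact_left K B S G t x)"
  using br unfolding is_bracket_def Let_def by simp_all

lemma tincl_tmap:
  assumes X: "submodule X K B" and Y: "submodule Y K B" and X': "submodule X' K B" and Y': "submodule Y' K B"
    and f: "lin K (sub B X) (sub B X') f" and g: "lin K (sub B Y) (sub B Y') g"
    and \<phi>: "lin K B B \<phi>" "\<And>x. x \<in> X \<Longrightarrow> \<phi> x = f x" and \<gamma>: "lin K B B \<gamma>" "\<And>y. y \<in> Y \<Longrightarrow> \<gamma> y = g y"
    and v: "v \<in> carrier (tens K (sub B X) (sub B Y))"
  shows "tincl K (sub B X') (sub B Y') B B (tmap K (sub B X) (sub B Y) (sub B X') (sub B Y') f g v) =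
    tm \<phi> \<gamma> (tincl K (sub B X) (sub B Y) B B v)"
  unfolding tincl_def
  by (rule tmap_square[OF vspace_sub[OF vsB X] vspace_sub[OF vsB Y] vspace_sub[OF vsB X'] vspace_sub[OF vsB Y']
        vsB vsB vsB vsB f g lin_incl[OF X'] lin_incl[OF Y'] lin_incl[OF X] lin_incl[OF Y] \<phi>(1) \<gamma>(1) _ _ v])
     (use \<phi>(2) \<gamma>(2) lin_closed[OF f] lin_closed[OF g] in \<open>simp_all add: idm_apply\<close>)

text \<open>
  An extension of the bracket to a linear endomorphism of \<open>B\<close>. With it the bracket axioms, which
  relate tensor products of various subspaces, become equations in \<open>B \<otimes> B\<close>.
\<close>

definition "bracket_ext = (SOME \<beta>. lin K B B \<beta> \<and> (\<forall>e\<in>Esp. \<beta> e = b e))"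

lemma bracket_ext: "lin K B B bracket_ext" "e \<in> Esp \<Longrightarrow> bracket_ext e = b e"
proof -
  obtain r where r: "lin K B (sub B Esp) r" "\<forall>x\<in>Esp. r x = x"
    using retraction_exists[OF vsB submodule_E] by blast
  have "\<exists>\<beta>. lin K B B \<beta> \<and> (\<forall>e\<in>Esp. \<beta> e = b e)"
    by (rule exI[of _ "\<lambda>x. b (r x)"]) (use lin_comp[OF b_linB r(1)] r(2) in simp)
  then have "lin K B B bracket_ext \<and> (\<forall>e\<in>Esp. bracket_ext e = b e)"
    unfolding bracket_ext_def by (rule someI_ex)
  then show "lin K B B bracket_ext" "e \<in> Esp \<Longrightarrow> bracket_ext e = b e" by auto
qed

definition "bracket_diff x = x \<ominus>\<^bsub>B\<^esub> bracket_ext x"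

lemma lin_bracket_diff: "lin K B B bracket_diff"
  unfolding bracket_diff_def[abs_def] by (rule lin_diff[OF vsB vsB lin_ident bracket_ext(1)])

lemma bracket_diff_E: "e \<in> Esp \<Longrightarrow> bracket_diff e = e \<ominus>\<^bsub>B\<^esub> b e" "e \<in> Esp \<Longrightarrow> bracket_diff e \<in> bracket_rels"
  by (simp_all add: bracket_diff_def bracket_ext(2) bracket_rels_I)

lemma tm_bracket_diff_right: "w \<in> carrier BB \<Longrightarrow> w \<ominus>\<^bsub>BB\<^esub> tm (idm B) bracket_ext w = tm (idm B) bracket_diff w"
proof (rule tens_ext[OF vsB vsB lin_diff[OF vsBB vsBB lin_ident lin_tm[OF lin_id bracket_ext(1)]] lin_tm[OF lin_id lin_bracket_diff]])
  fix x y assume x: "x \<in> carrier B" and y: "y \<in> carrier B"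
  show "pr x y \<ominus>\<^bsub>BB\<^esub> tm (idm B) bracket_ext (pr x y) = tm (idm B) bracket_diff (pr x y)"
    using lin_minus[OF vsB vsBB lin_pr_right[OF x] y lin_closed[OF bracket_ext(1) y]] x y
    by (simp add: tm_pure[OF lin_id bracket_ext(1)] tm_pure[OF lin_id lin_bracket_diff] idm_apply bracket_diff_def)
qed

lemma tm_bracket_diff_left: "w \<in> carrier BB \<Longrightarrow> w \<ominus>\<^bsub>BB\<^esub> tm bracket_ext (idm B) w = tm bracket_diff (idm B) w"
proof (rule tens_ext[OF vsB vsB lin_diff[OF vsBB vsBB lin_ident lin_tm[OF bracket_ext(1) lin_id]] lin_tm[OF lin_bracket_diff lin_id]])
  fix x y assume x: "x \<in> carrier B" and y: "y \<in> carrier B"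
  show "pr x y \<ominus>\<^bsub>BB\<^esub> tm bracket_ext (idm B) (pr x y) = tm bracket_diff (idm B) (pr x y)"
    using lin_minus[OF vsB vsBB lin_pr_left[OF y] x lin_closed[OF bracket_ext(1) x]] x y
    by (simp add: tm_pure[OF bracket_ext(1) lin_id] tm_pure[OF lin_bracket_diff lin_id] idm_apply bracket_diff_def)
qed

lemma braid_bracket:
  assumes e: "e \<in> Esp" and y: "y \<in> G t"
  shows "braid S (pr (b e) y) = tm (idm B) bracket_ext (braid S (pr e y))"
    and "braid S (pr y (b e)) = tm bracket_ext (idm B) (braid S (pr y e))"
proof -
  let ?E = "sub B Esp" and ?Bt = "sub B (G t)" and ?B1 = "sub B (G 1)"
  note sE = vspace_sub[OF vsB submodule_E] and sG = vspace_sub[OF vsB grade_sub]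
  note gs = grade_sub and bG = b_G[OF e] and it = lin_idm[OF sG[of t]]
  have idt: "idm B y = idm ?Bt y" if "y \<in> G t" for y using that subsetD[OF Gsub that] by (simp add: idm_apply)
  have z: "pure K ?E ?Bt e y \<in> carrier (tens K ?E ?Bt)" by (rule pure_closed[OF sE sG]) (use e y in auto)
  have bz: "tmap K ?E ?Bt ?B1 ?Bt b (idm ?Bt) (pure K ?E ?Bt e y) = pure K ?B1 ?Bt (b e) y"
    using tmap_pure[OF sE sG sG sG b_lin it] e y by (simp add: idm_apply)
  have bzc: "pure K ?B1 ?Bt (b e) y \<in> carrier (tens K ?B1 ?Bt)"
    by (rule pure_closed[OF sG sG]) (use bG y in auto)
  note v = braid_restr_spec[OF submodule_E gs z, unfolded tincl_pureB[OF submodule_E gs e y], OF braid_E(1)[OF y e]]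
  note w = braid_restr_spec(2)[OF gs gs bzc, unfolded tincl_pureB[OF gs gs bG y], OF braid_grade[OF bG y]]
  have "braid S (pr (b e) y) = tincl K ?Bt ?B1 B B (tmap K ?Bt ?E ?Bt ?B1 (idm ?Bt) b (braid_restr K B S Esp (G t) (pure K ?E ?Bt e y)))"
    using w br_left[OF z] by (simp only: bz)
  also have "\<dots> = tm (idm B) bracket_ext (braid S (pr e y))"
    by (subst tincl_tmap[OF gs submodule_E gs gs it b_lin lin_id idt bracket_ext v(1)]) (simp_all only: v(2))
  finally show "braid S (pr (b e) y) = tm (idm B) bracket_ext (braid S (pr e y))" .
  have z': "pure K ?Bt ?E y e \<in> carrier (tens K ?Bt ?E)" by (rule pure_closed[OF sG sE]) (use e y in auto)
  have bz': "tmap K ?Bt ?E ?Bt ?B1 (idm ?Bt) b (pure K ?Bt ?E y e) = pure K ?Bt ?B1 y (b e)"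
    using tmap_pure[OF sG sE sG sG it b_lin] e y by (simp add: idm_apply)
  have bzc': "pure K ?Bt ?B1 y (b e) \<in> carrier (tens K ?Bt ?B1)"
    by (rule pure_closed[OF sG sG]) (use bG y in auto)
  note v' = braid_restr_spec[OF gs submodule_E z', unfolded tincl_pureB[OF gs submodule_E y e], OF braid_E(2)[OF y e]]
  note w' = braid_restr_spec(2)[OF gs gs bzc', unfolded tincl_pureB[OF gs gs y bG], OF braid_grade[OF y bG]]
  have "braid S (pr y (b e)) = tincl K ?B1 ?Bt B B (tmap K ?E ?Bt ?B1 ?Bt b (idm ?Bt) (braid_restr K B S (G t) Esp (pure K ?Bt ?E y e)))"
    using w' br_right[OF z'] by (simp only: bz')
  also have "\<dots> = tm bracket_ext (idm B) (braid S (pr y e))"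
    by (subst tincl_tmap[OF submodule_E gs gs gs b_lin it bracket_ext lin_id idt v'(1)]) (simp_all only: v'(2))
  finally show "braid S (pr y (b e)) = tm bracket_ext (idm B) (braid S (pr y e))" .
qed

text \<open>
  The bracket axioms give \<open>c((e - b e) \<otimes> y) = (B \<otimes> (Id - b)) c(e \<otimes> y)\<close>, and \<open>c(e \<otimes> y)\<close> has its
  right leg in \<open>E\<close>; similarly on the other side.
\<close>

lemma braid_bracket_rels_homog:
  assumes e: "e \<in> Esp" and y: "y \<in> G t"
  shows "braid S (pr (e \<ominus>\<^bsub>B\<^esub> b e) y) \<in> tsp (carrier B) bracket_rels"
    and "braid S (pr y (e \<ominus>\<^bsub>B\<^esub> b e)) \<in> tsp bracket_rels (carrier B)"
proof -
  have c: "e \<in> carrier B" "b e \<in> carrier B" "y \<in> carrier B" using e y E_sub Gsub b_G by auto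
  have "braid S (pr (e \<ominus>\<^bsub>B\<^esub> b e) y) = tm (idm B) bracket_diff (braid S (pr e y))"
    using lin_minus[OF vsB vsBB lin_comp[OF lin_braid lin_pr_left[OF c(3)]] c(1,2)] braid_bracket(1)[OF e y]
      tm_bracket_diff_right[OF lin_closed[OF lin_braid pr_closed[OF c(1,3)]]] by simp
  also have "\<dots> \<in> tsp (carrier B) bracket_rels"
    by (rule lin_tspan[OF vsB vsB vsBB Gsub E_sub lin_tm[OF lin_id lin_bracket_diff]
          submodule_tsp[OF subset_refl bracket_rels_sub] _ braid_E(1)[OF y e]])
       (simp add: tm_pure[OF lin_id lin_bracket_diff] idm_apply pure_tspan bracket_diff_E(2) subsetD[OF Gsub] subsetD[OF E_sub])
  finally show "braid S (pr (e \<ominus>\<^bsub>B\<^esub> b e) y) \<in> tsp (carrier B) bracket_rels" .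
  have "braid S (pr y (e \<ominus>\<^bsub>B\<^esub> b e)) = tm bracket_diff (idm B) (braid S (pr y e))"
    using lin_minus[OF vsB vsBB lin_comp[OF lin_braid lin_pr_right[OF c(3)]] c(1,2)] braid_bracket(2)[OF e y]
      tm_bracket_diff_left[OF lin_closed[OF lin_braid pr_closed[OF c(3,1)]]] by simp
  also have "\<dots> \<in> tsp bracket_rels (carrier B)"
    by (rule lin_tspan[OF vsB vsB vsBB E_sub Gsub lin_tm[OF lin_bracket_diff lin_id]
          submodule_tsp[OF bracket_rels_sub subset_refl] _ braid_E(2)[OF y e]])
       (simp add: tm_pure[OF lin_bracket_diff lin_id] idm_apply pure_tspan bracket_diff_E(2) subsetD[OF Gsub] subsetD[OF E_sub])
  finally show "braid S (pr y (e \<ominus>\<^bsub>B\<^esub> b e)) \<in> tsp bracket_rels (carrier B)" .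
qed

lemma braid_bracket_rels:
  assumes x: "x \<in> bracket_rels" and y: "y \<in> carrier B"
  shows "braid S (pr x y) \<in> tsp (carrier B) bracket_rels"
    and "braid S (pr y x) \<in> tsp bracket_rels (carrier B)"
proof -
  obtain e where e: "e \<in> Esp" "x = e \<ominus>\<^bsub>B\<^esub> b e" using x by (auto simp: bracket_rels_def)
  have xc: "x \<in> carrier B" using x bracket_rels_sub by blast
  note s1 = submodule_tsp[OF subset_refl bracket_rels_sub] and s2 = submodule_tsp[OF bracket_rels_sub subset_refl]
  note l1 = lin_comp[OF lin_braid lin_pr_right[OF xc]] and l2 = lin_comp[OF lin_braid lin_pr_left[OF xc]]
  from y show "braid S (pr x y) \<in> tsp (carrier B) bracket_rels"
    by (induction rule: homog_induct)
       (simp_all add: e(2)[symmetric] braid_bracket_rels_homog(1)[OF e(1), folded e(2)] lin_add[OF l1] submodule_closed(3)[OF vsBB s1])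
  from y show "braid S (pr y x) \<in> tsp bracket_rels (carrier B)"
    by (induction rule: homog_induct)
       (simp_all add: e(2)[symmetric] braid_bracket_rels_homog(2)[OF e(1), folded e(2)] lin_add[OF l2] submodule_closed(3)[OF vsBB s2])
qed

text \<open>
  The inverse images in \<^const>\<open>E_coact_right\<close> and \<^const>\<open>E_coact_left\<close> are taken along inclusions
  of tensor products. These are injective, because they become injective after composition with the
  inclusion into \<open>B \<otimes> B\<close>.
\<close>

lemma tincl_preimage:
  assumes X: "submodule X K B" and Y: "submodule Y K B" and X': "submodule X' K B" and Y': "submodule Y' K B"
    and XX: "X \<subseteq> X'" and YY: "Y \<subseteq> Y'"
    and u: "u \<in> carrier (tens K (sub B X') (sub B Y'))"
    and m: "tincl K (sub B X') (sub B Y') B B u \<in> tsp X Y"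
  defines "w \<equiv> the_inv_into (carrier (tens K (sub B X) (sub B Y))) (tincl K (sub B X) (sub B Y) (sub B X') (sub B Y')) u"
  shows "w \<in> carrier (tens K (sub B X) (sub B Y))"
    and "tincl K (sub B X) (sub B Y) B B w = tincl K (sub B X') (sub B Y') B B u"
proof -
  note sX = vspace_sub[OF vsB X] and sY = vspace_sub[OF vsB Y] and sX' = vspace_sub[OF vsB X'] and sY' = vspace_sub[OF vsB Y']
  let ?i = "tincl K (sub B X) (sub B Y) (sub B X') (sub B Y')"
  have inc: "lin K (sub B X) (sub B X') (idm (sub B X))" "lin K (sub B Y) (sub B Y') (idm (sub B Y))"
    using lin_incl[OF X] lin_incl[OF Y] XX YY by (auto simp: lin_def idm_def)
  note li = lin_tmap[OF sX sY sX' sY' inc, folded tincl_def]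
  have comp: "tincl K (sub B X') (sub B Y') B B (?i v) = tincl K (sub B X) (sub B Y) B B v"
    if v: "v \<in> carrier (tens K (sub B X) (sub B Y))" for v
    unfolding tincl_def
    by (rule tmap_comp[OF sX sY sX' sY' vsB vsB inc lin_incl[OF X'] lin_incl[OF Y'] lin_incl[OF X] lin_incl[OF Y] _ _ v])
       (simp_all add: idm_apply subsetD[OF XX] subsetD[OF YY])
  have inj: "inj_on ?i (carrier (tens K (sub B X) (sub B Y)))"
    by (rule inj_onI) (metis comp tincl_inj[OF vsB vsB X Y] inj_onD)
  obtain v where v: "v \<in> carrier (tens K (sub B X) (sub B Y))"
    "tincl K (sub B X) (sub B Y) B B v = tincl K (sub B X') (sub B Y') B B u"
    using m[folded tincl_image[OF vsB vsB X Y]] by auto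
  have "?i v = u"
    by (rule inj_onD[OF tincl_inj[OF vsB vsB X' Y'] _ lin_closed[OF li v(1)] u]) (simp add: comp v)
  then have "w = v" unfolding w_def using the_inv_into_f_f[OF inj v(1)] by simp
  then show "w \<in> carrier (tens K (sub B X) (sub B Y))"
    "tincl K (sub B X) (sub B Y) B B w = tincl K (sub B X') (sub B Y') B B u" using v by auto
qed

lemma comul_bracket:
  assumes x: "x \<in> E t" and t: "t \<ge> 2"
  shows "pjs 1 0 (comul S (b x)) = tm bracket_ext (idm B) (pjs t 0 (comul S x))"
    and "pjs 0 1 (comul S (b x)) = tm (idm B) bracket_ext (pjs 0 t (comul S x))"
proof -
  note gs = grade_sub and it = lin_idm[OF vspace_sub[OF vsB grade_sub[of 0]]]
  have xG: "x \<in> G (t + 0)" "x \<in> G (0 + t)" using x E_comp_sub_G by auto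
  have bG: "b x \<in> G (1 + 0)" "b x \<in> G (0 + 1)" using x E_comp_E b_G by auto
  have id0: "idm B y = idm (sub B (G 0)) y" if "y \<in> G 0" for y using that subsetD[OF Gsub that] by (simp add: idm_apply)
  have bE: "bracket_ext y = b y" if "y \<in> E t" for y using that E_comp_E bracket_ext(2) by blast
  note cR = comul_comp_incl[OF xG(1)] and cL = comul_comp_incl[OF xG(2)]
  \<comment> \<open>The degrees \<open>t\<close> and \<open>1\<close> enter as \<open>t + 0\<close>, \<open>0 + t\<close>, \<open>1 + 0\<close> and \<open>0 + 1\<close>, as in \<^const>\<open>comul_comp\<close>.\<close>
  note R = tincl_preimage[OF submodule_E_comp gs gs gs E_comp_sub_G subset_refl cR(1), unfolded cR(2), OF coaction_E_comp(1)[OF x t]]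
    and L = tincl_preimage[OF gs submodule_E_comp gs gs subset_refl E_comp_sub_G cL(1), unfolded cL(2), OF coaction_E_comp(2)[OF x t]]
  have R': "E_coact_right K B S G t x = the_inv_into (carrier (tens K (sub B (E t)) (sub B (G 0))))
      (tincl K (sub B (E t)) (sub B (G 0)) (sub B (G t)) (sub B (G 0))) (comul_comp K B S G t 0 x)"
    and L': "E_coact_left K B S G t x = the_inv_into (carrier (tens K (sub B (G 0)) (sub B (E t))))
      (tincl K (sub B (G 0)) (sub B (E t)) (sub B (G 0)) (sub B (G t))) (comul_comp K B S G 0 t x)"
    using x by (simp_all add: E_coact_right_def E_coact_left_def Let_def)
  show "pjs 1 0 (comul S (b x)) = tm bracket_ext (idm B) (pjs t 0 (comul S x))"
    unfolding comul_comp_incl(2)[OF bG(1), symmetric] br_coright[OF x] R'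
    by (subst tincl_tmap[OF submodule_E_comp gs gs gs b_lin_Et it bracket_ext(1) bE lin_id id0 R(1)]) (simp_all only: R(2))
  show "pjs 0 1 (comul S (b x)) = tm (idm B) bracket_ext (pjs 0 t (comul S x))"
    unfolding comul_comp_incl(2)[OF bG(2), symmetric] br_coleft[OF x] L'
    by (subst tincl_tmap[OF gs submodule_E_comp gs gs it b_lin_Et lin_id id0 bracket_ext(1) bE L(1)]) (simp_all only: L(2))
qed

lemma lin_b_diff: "lin K (sub B Esp) B (\<lambda>z. z \<ominus>\<^bsub>B\<^esub> b z)"
  by (rule lin_diff[OF vspace_sub[OF vsB submodule_E] vsB lin_sub_dom[OF lin_ident E_sub] b_linB])

text \<open>
  Both \<open>x\<close> and \<open>b x\<close> are killed by the reduced comultiplication, the latter since its degree is 1. So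
  each has only the two extreme components, and those of \<open>b x\<close> are obtained by applying \<open>b\<close> to those
  of \<open>x\<close>.
\<close>

lemma comul_bracket_rels_homog:
  assumes x: "x \<in> E t"
  shows "comul S (x \<ominus>\<^bsub>B\<^esub> b x) \<in> tsum K B bracket_rels"
proof -
  note sN = submodule_tsum[OF vsB, of bracket_rels]
  have xE: "x \<in> Esp" using x E_comp_E by blast
  show ?thesis
  proof (cases "t \<ge> 2")
    case False
    then have "x = \<zero>\<^bsub>B\<^esub>" using x by (simp add: E_comp_def)
    then have "x \<ominus>\<^bsub>B\<^esub> b x = \<zero>\<^bsub>B\<^esub>"
      using lin_zero[OF vspace_sub[OF vsB submodule_E] vsB lin_b_diff] by simp
    then show ?thesis using lin_zero[OF vsB vsBB lin_comul] submodule_closed(1)[OF vsBB sN] by simp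
  next
    case t: True
    interpret T: vspace K BB by (rule vsBB)
    have xG: "x \<in> G t" using x E_comp_sub_G by blast
    note bG = b_G[OF xE]
    have xc: "x \<in> carrier B" and bc: "b x \<in> carrier B" using xG bG Gsub by auto
    have dx: "red_comul x = \<zero>\<^bsub>BB\<^esub>" using x E_comp_iff[OF t] by blast
    have db: "red_comul (b x) = \<zero>\<^bsub>BB\<^esub>" unfolding red_comul_def
      by (rule selector_comul_zero[OF bG selector_pos_part selector_pos_part]) auto
    let ?R = "pjs t 0 (comul S x)" and ?L = "pjs 0 t (comul S x)"
    note mR = coaction_E_comp(1)[OF x t] and mL = coaction_E_comp(2)[OF x t]
    have R: "?R \<in> carrier BB" and L: "?L \<in> carrier BB"
      using tsp_closed[OF Etsub Gsub mR] tsp_closed[OF Gsub Etsub mL] by blast+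
    have Dx: "comul S x = ?R \<oplus>\<^bsub>BB\<^esub> ?L" by (rule comul_split[OF xG _ dx]) (use t in simp)
    have Db: "comul S (b x) = tm bracket_ext (idm B) ?R \<oplus>\<^bsub>BB\<^esub> tm (idm B) bracket_ext ?L"
      using comul_split[OF bG _ db] unfolding comul_bracket[OF x t] by simp
    have "comul S (x \<ominus>\<^bsub>B\<^esub> b x) = (?R \<oplus>\<^bsub>BB\<^esub> ?L) \<ominus>\<^bsub>BB\<^esub> (tm bracket_ext (idm B) ?R \<oplus>\<^bsub>BB\<^esub> tm (idm B) bracket_ext ?L)"
      using lin_minus[OF vsB vsBB lin_comul xc bc] unfolding Db by (simp only: Dx[symmetric])
    also have "\<dots> = (?R \<ominus>\<^bsub>BB\<^esub> tm bracket_ext (idm B) ?R) \<oplus>\<^bsub>BB\<^esub> (?L \<ominus>\<^bsub>BB\<^esub> tm (idm B) bracket_ext ?L)"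
      using R L lin_closed[OF lin_tm[OF bracket_ext(1) lin_id] R] lin_closed[OF lin_tm[OF lin_id bracket_ext(1)] L]
      by (simp add: a_minus_def T.M.minus_add T.M.a_ac)
    also have "\<dots> = tm bracket_diff (idm B) ?R \<oplus>\<^bsub>BB\<^esub> tm (idm B) bracket_diff ?L"
      by (simp only: tm_bracket_diff_left[OF R] tm_bracket_diff_right[OF L])
    also have "\<dots> \<in> tsum K B bracket_rels"
    proof (rule submodule_closed(3)[OF vsBB sN])
      have kE: "bracket_diff p \<in> bracket_rels" "bracket_diff p \<in> carrier B" if "p \<in> E t" for p
        using bracket_diff_E(2) that E_comp_E bracket_rels_sub by blast+
      show "tm bracket_diff (idm B) ?R \<in> tsum K B bracket_rels"
        by (rule lin_tspan[OF vsB vsB vsBB Etsub Gsub lin_tm[OF lin_bracket_diff lin_id] sN _ mR])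
           (simp add: tm_pure[OF lin_bracket_diff lin_id] idm_apply subsetD[OF Gsub] subsetD[OF Etsub] pure_tsum[OF vsB] kE)
      show "tm (idm B) bracket_diff ?L \<in> tsum K B bracket_rels"
        by (rule lin_tspan[OF vsB vsB vsBB Gsub Etsub lin_tm[OF lin_id lin_bracket_diff] sN _ mL])
           (simp add: tm_pure[OF lin_id lin_bracket_diff] idm_apply subsetD[OF Gsub] subsetD[OF Etsub] pure_tsum[OF vsB] kE)
    qed
    finally show ?thesis .
  qed
qed

lemma comul_bracket_rels: "x \<in> bracket_rels \<Longrightarrow> comul S x \<in> tsum K B bracket_rels"
proof -
  note sE = vspace_sub[OF vsB submodule_E]
  have "Esp \<subseteq> {z \<in> carrier (sub B Esp). comul S (z \<ominus>\<^bsub>B\<^esub> b z) \<in> tsum K B bracket_rels}"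
    by (rule E_least[OF submodule_trans[OF vsB submodule_E submodule_kernel[OF sE vsBB
           lin_comp[OF lin_comul lin_b_diff] submodule_tsum[OF vsB]]]])
       (use comul_bracket_rels_homog E_comp_E in auto)
  then show "x \<in> bracket_rels \<Longrightarrow> comul S x \<in> tsum K B bracket_rels" unfolding bracket_rels_def by blast
qed

lemma counit_bracket_rels: "x \<in> bracket_rels \<Longrightarrow> counit S x = \<zero>\<^bsub>K\<^esub>"
proof -
  note sK = vspace_selfK[OF vsB]
  have "Esp \<subseteq> {z \<in> carrier B. counit S z \<in> {\<zero>\<^bsub>self K\<^esub>}}"
  proof (rule E_least[OF submodule_kernel[OF vsB sK lin_counit submodule_zero[OF sK]]])
    fix t x assume x: "x \<in> E t"
    have xG: "x \<in> G t" using x E_comp_sub_G by blast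
    have "counit S x = \<zero>\<^bsub>self K\<^esub>"
    proof (cases "t \<ge> 2")
      case True
      then show ?thesis using grade_counit[OF _ xG] by (simp add: self_simps)
    next
      case False
      then have "x = \<zero>\<^bsub>B\<^esub>" using x by (simp add: E_comp_def)
      then show ?thesis using lin_zero[OF vsB sK lin_counit] by simp
    qed
    then show "x \<in> {z \<in> carrier B. counit S z \<in> {\<zero>\<^bsub>self K\<^esub>}}" using xG Gsub by auto
  qed
  then have eE: "counit S z = \<zero>\<^bsub>self K\<^esub>" if "z \<in> Esp" for z using that by auto
  assume "x \<in> bracket_rels"
  then obtain e where e: "e \<in> Esp" "x = e \<ominus>\<^bsub>B\<^esub> b e" by (auto simp: bracket_rels_def)
  have c: "e \<in> carrier B" "b e \<in> carrier B" using e E_sub b_G[OF e(1)] Gsub by auto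
  have "counit S (b e) = \<zero>\<^bsub>self K\<^esub>" using grade_counit[OF _ b_G[OF e(1)]] by (simp add: self_simps)
  then have "counit S x = \<zero>\<^bsub>self K\<^esub>"
    using lin_minus[OF vsB sK lin_counit c] eE[OF e(1)] e(2) vspace_diff_zero[OF sK, of "\<zero>\<^bsub>self K\<^esub>"] by (simp add: self_simps)
  then show "counit S x = \<zero>\<^bsub>K\<^esub>" by (simp add: self_simps)
qed

end
end

theorem theorem3p9:
  fixes K :: "('k, 'l) ring_scheme" and B :: "('k, 'b, 'm) module_scheme"
    and S :: "('k, 'b) bb_data" and G :: "nat \<Rightarrow> 'b set" and b :: "'b \<Rightarrow> 'b"
  assumes "graded_braided_bialgebra K B S G"
    and "is_bracket K B S G b"
  shows "\<exists>!T :: ('k, 'b set) bb_data.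
           braided_bialgebra K (U_space K B S G b) T \<and>
           braided_bialgebra_hom K B S (U_space K B S G b) T (U_proj K B S G b)"
proof -
  interpret B: graded_braided_bialgebra K B S G by (rule assms(1))
  note b = assms(2)
  show ?thesis
    unfolding U_space_def U_proj_def U_ideal_def B.bracket_rels_def[OF b, symmetric]
    by (rule B.quotient_by_Idl[OF B.bracket_rels_sub[OF b] B.braid_bracket_rels(1)[OF b] B.braid_bracket_rels(2)[OF b]
          B.comul_bracket_rels[OF b] B.counit_bracket_rels[OF b]])
qed

end
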